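(* Let $(\Omega,\mathcal H)$ be a strong Green biharmonic space with associated harmonic spaces $(\Omega,\mathcal H_1)$ and $(\Omega,\mathcal H_2)$, such that there is a base of open subsets of $\Omega$ that are $\mathcal H_i$-completely determining for both $i=1,2$, and such that $(1,1)$ is a finite and continuous $\mathcal H$-potential. Let $y\mapsto q_y$ be a continuous map from $\Omega$ into $\mathcal S_2^+(\Omega)$ such that, for every $y\in\Omega$, $q_y$ is an $\mathcal H_2$-potential of harmonic support $\{y\}$, and let $p'_y$ be the pure hyperharmonic function of order 2 associated with $q_y$. Suppose that for every $y\in\Omega$ the function $p'_y$ is $\mathcal H_1$-superharmonic on $\Omega$ and that for every $x\in\Omega$ the function $y\mapsto p'_y(x)$ is continuous on $\Omega\smallsetminus\{x\}$. Then the kernel $H$ defined by $H(x,y)=p'_y(x)$ for $(x,y)\in\Omega\times\Omega$ has the following properties: 1. $H$ is l.s.c. on $\Omega\times\Omega$. 2. $H$ is continuous on $(\Omega\times\Omega)\smallsetminus\Delta$, where $\Delta=\{(x,x):x\in\Omega\}$ is the diagonal.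
   Context: Biharmonic spaces. Let $\Omega$ be a locally compact space with countable base and let $\mathcal H$ assign to each open $U\subset\Omega$ a real vector space $\mathcal H(U)$ of pairs of continuous real functions on $U$ (called biharmonic, or $\mathcal H$-harmonic, pairs on $U$), compatible: if $(u,v)\in\mathcal H(U)$ and $u=0$ on an open $\omega\subset U$ then $v=0$ on $\omega$. A relatively compact open set $\omega$ is ($\mathcal H$-)regular if for all continuous real $f,g$ on $\partial\omega$ there is $(u,v)\in\mathcal H(\omega)$ with $u(x)\to f(y)$, $v(x)\to g(y)$ as $x\to y$ for every $y\in\partial\omega$, and $u,v\ge0$ whenever $f,g\ge 0$. The pair is then unique, and for $x\in\omega$ there are nonnegative Radon measures $\mu_x^\omega,\nu_x^\omega,\lambda_x^\omega$ on $\partial\omega$ with $u(x)=\int f\,d\mu_x^\omega+\int g\,d\nu_x^\omega$, $v(x)=\int g\,d\lambda_x^\omega$. A pair $(u,v)$ of l.s.c. functions $U\to\,]-\infty,+\infty]$ is $\mathcal H$-hyperharmonic on $U$, written $(u,v)\in\mathcal H^*(U)$, if for every regular $\omega$ with $\overline\omega\subset U$ and every $x\in\omega$: $\int^*u\,d\mu_x^\omega+\int^*v\,d\nu_x^\omega\le u(x)$ and $\int^*v\,d\lambda_x^\omega\le v(x)$. Put $\mathcal H_1^*(U)=\{u:(u,0)\in\mathcal H^*(U)\}$, $\mathcal H_2^*(U)=\{v:(+\infty,v)\in\mathcal H^*(U)\}$ and $\mathcal H_j(U)=\mathcal H_j^*(U)\cap(-\mathcal H_j^*(U))$. $(\Omega,\mathcal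 H)$ is a biharmonic space if (1) $\mathcal H$ is a sheaf, (2) the regular sets form a base of the topology of $\Omega$, (3) $(\Omega,\mathcal H_1)$ and $(\Omega,\mathcal H_2)$ are Bauer harmonic spaces; these are called the (first and second) associated harmonic spaces. Pairs are ordered componentwise; $(f,g)>0$ means $f>0$ and $g>0$; a superscript $+$ denotes the nonnegative elements. An $\mathcal H$-hyperharmonic pair $(u,v)$ on $U$ is $\mathcal H$-superharmonic, $(u,v)\in\mathcal S(U)$, if $u$ is finite on a dense subset of $U$. $(p,q)\in\mathcal S^+(\Omega)$ is an $\mathcal H$-potential if every $(h,k)\in\mathcal H^+(\Omega)$ with $(h,k)\le(p,q)$ is $(0,0)$. $(\Omega,\mathcal H)$ is strong if there is an $\mathcal H$-potential $(p,q)>0$ on $\Omega$. $\mathcal H_j$-superharmonic functions are $\mathcal H_j$-hyperharmonic functions finite on a dense set; $\mathcal H_j$-potentials are nonnegative $\mathcal H_j$-superharmonic functions whose only nonnegative $\mathcal H_j$-harmonic minorant is $0$; the harmonic support of a superharmonic function is the complement of the largest open set on which it is harmonic. For an $\mathcal H_2$-hyperharmonic $v\ge0$ on $\Omega$, the pure hyperharmonic function of order 2 associated with $v$ is the smallest nonnegative $\mathcal H_1$-hyperharmonic $u$ on $\Omega$ such that $(u,v)$ is $\mathcal H$-hyperharmonic on $\Omega$. Green spaces. A Green harmonic space is a Brelot harmonic space (on a noncompact, connected, locally connected $\Omega$) in which any two potentials with the same one-point harmonic support are proportional. A Green biharmonic space is a biharmonic space whose two associated harmonic spaces are Green harmonic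 spaces. $\mathcal S_j^+(\Omega)$ is the cone of nonnegative $\mathcal H_j$-superharmonic functions on $\Omega$ with the (metrizable) topology of R.-M. Hervé, in which an ultrafilter converges to $v$ if and only if $v$ is the l.s.c. regularization of the pointwise limit of the ultrafilter (limits in $[0,+\infty]$). A map $y\mapsto q_y$ as in the claim exists. A relatively compact open set $\omega$ is $\mathcal H_j$-completely determining if $\widehat R_p^{\,j,\Omega\smallsetminus\omega}=p$ for every $\mathcal H_j$-potential $p$ on $\Omega$ that is $\mathcal H_j$-harmonic on $\omega$, where $\widehat R^{\,j,A}_p$ is the balayage of $p$ on $A$ in $(\Omega,\mathcal H_j)$ (the l.s.c. regularization of the infimum of nonnegative $\mathcal H_j$-hyperharmonic functions $\ge p$ on $A$). *)

theory Defs
  imports "HOL-Analysis.Analysis"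
begin

section \<open>Semicontinuity and Radon measures\<close>

definition lsc_on :: "'a::topological_space set \<Rightarrow> ('a \<Rightarrow> ereal) \<Rightarrow> bool" where
  "lsc_on U f \<longleftrightarrow> (\<forall>t. openin (top_of_set U) {x \<in> U. t < f x})"

definition lsc_regularization :: "('a::topological_space \<Rightarrow> ereal) \<Rightarrow> 'a \<Rightarrow> ereal" where
  "lsc_regularization f = (\<lambda>x. Liminf (nhds x) f)"

text \<open>
  Nonnegative Radon measures on a compact set \<open>K\<close> are taken in the sense of Bourbaki, as positive
  linear forms on the space of continuous real functions on \<open>K\<close>; \<open>\<mu> f\<close> stands for the integral
  of \<open>f\<close>. Functions on a subset are represented by total functions of which only the values on
  the subset matter (positivity and linearity give \<open>\<mu> f = \<mu> g\<close> if \<open>f = g\<close> on \<open>K\<close>).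
\<close>

definition radon_measure :: "'a::topological_space set \<Rightarrow> (('a \<Rightarrow> real) \<Rightarrow> real) \<Rightarrow> bool" where
  "radon_measure K \<mu> \<longleftrightarrow>
     (\<forall>f g. continuous_on K f \<and> continuous_on K g \<longrightarrow> \<mu> (\<lambda>x. f x + g x) = \<mu> f + \<mu> g) \<and>
     (\<forall>c f. continuous_on K f \<longrightarrow> \<mu> (\<lambda>x. c * f x) = c * \<mu> f) \<and>
     (\<forall>f. continuous_on K f \<and> (\<forall>x\<in>K. 0 \<le> f x) \<longrightarrow> 0 \<le> \<mu> f)"

text \<open>
  The upper integral, over the compact set \<open>K\<close>, of a function that is l.s.c. and \<open>> -\<infinity>\<close> on \<open>K\<close>
  (the only functions to which it is applied): the supremum of the integrals of its continuous
  real minorants.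
\<close>

definition upper_integral ::
  "'a::topological_space set \<Rightarrow> (('a \<Rightarrow> real) \<Rightarrow> real) \<Rightarrow> ('a \<Rightarrow> ereal) \<Rightarrow> ereal" where
  "upper_integral K \<mu> u =
     (SUP f \<in> {f. continuous_on K f \<and> (\<forall>x\<in>K. ereal (f x) \<le> u x)}. ereal (\<mu> f))"

definition has_boundary_values :: "'a::topological_space set \<Rightarrow> ('a \<Rightarrow> real) \<Rightarrow> ('a \<Rightarrow> real) \<Rightarrow> bool" where
  "has_boundary_values \<omega> u f \<longleftrightarrow> (\<forall>y\<in>frontier \<omega>. (u \<longlongrightarrow> f y) (at y within \<omega>))"

section \<open>Harmonic spaces\<close>

text \<open>
  The space \<open>\<Omega>\<close> is the universe of a type. The sections over an open set \<open>U\<close> are total functions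
  (or pairs of them) and membership only depends on the values on \<open>U\<close>. Restriction of sections
  is then the identity, and the following condition comprises both the restriction and the
  gluing property of a sheaf.
\<close>

definition is_sheaf :: "('a::topological_space set \<Rightarrow> 'b set) \<Rightarrow> bool" where
  "is_sheaf F \<longleftrightarrow> (\<forall>\<U>. (\<forall>U\<in>\<U>. open U) \<longrightarrow> F (\<Union>\<U>) = (\<Inter>U\<in>\<U>. F U))"

definition harmonic_functions :: "('a::topological_space set \<Rightarrow> ('a \<Rightarrow> real) set) \<Rightarrow> bool" where
  "harmonic_functions F \<longleftrightarrow> (\<forall>U. open U \<longrightarrow>
     (\<forall>u\<in>F U. continuous_on U u) \<and>
     (\<lambda>x. 0) \<in> F U \<and>
     (\<forall>u\<in>F U. \<forall>v\<in>F U. (\<lambda>x. u x + v x) \<in> F U) \<and>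
     (\<forall>c. \<forall>u\<in>F U. (\<lambda>x. c * u x) \<in> F U) \<and>
     (\<forall>u\<in>F U. \<forall>v. (\<forall>x\<in>U. v x = u x) \<longrightarrow> v \<in> F U))"

text \<open>Nonnegativity is demanded of every solution; this makes the solution unique.\<close>

definition regular :: "('a::topological_space set \<Rightarrow> ('a \<Rightarrow> real) set) \<Rightarrow> 'a set \<Rightarrow> bool" where
  "regular F \<omega> \<longleftrightarrow> open \<omega> \<and> compact (closure \<omega>) \<and>
     (\<forall>f. continuous_on (frontier \<omega>) f \<longrightarrow>
        (\<exists>u\<in>F \<omega>. has_boundary_values \<omega> u f) \<and>
        ((\<forall>y\<in>frontier \<omega>. 0 \<le> f y) \<longrightarrow>
           (\<forall>u\<in>F \<omega>. has_boundary_values \<omega> u f \<longrightarrow> (\<forall>x\<in>\<omega>. 0 \<le> u x))))"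

text \<open>\<open>harmonic_measure F \<omega> x \<mu>\<close>: \<open>\<mu>\<close> is the harmonic measure of the regular set \<open>\<omega>\<close> at \<open>x\<close>.\<close>

definition harmonic_measure ::
  "('a::topological_space set \<Rightarrow> ('a \<Rightarrow> real) set) \<Rightarrow> 'a set \<Rightarrow> 'a \<Rightarrow> (('a \<Rightarrow> real) \<Rightarrow> real) \<Rightarrow> bool" where
  "harmonic_measure F \<omega> x \<mu> \<longleftrightarrow> radon_measure (frontier \<omega>) \<mu> \<and>
     (\<forall>f. continuous_on (frontier \<omega>) f \<longrightarrow>
        (\<forall>u\<in>F \<omega>. has_boundary_values \<omega> u f \<longrightarrow> u x = \<mu> f))"

definition hyperharmonic ::
  "('a::topological_space set \<Rightarrow> ('a \<Rightarrow> real) set) \<Rightarrow> 'a set \<Rightarrow> ('a \<Rightarrow> ereal) set" where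
  "hyperharmonic F U = {u. lsc_on U u \<and> (\<forall>x\<in>U. u x \<noteq> -\<infinity>) \<and>
     (\<forall>\<omega> x \<mu>. regular F \<omega> \<and> closure \<omega> \<subseteq> U \<and> x \<in> \<omega> \<and> harmonic_measure F \<omega> x \<mu> \<longrightarrow>
        upper_integral (frontier \<omega>) \<mu> u \<le> u x)}"

text \<open>
  Bauer's axioms: sheaf axiom, base axiom, convergence axiom (increasing locally bounded
  sequences) and separation axiom (locally, the nonnegative hyperharmonic functions separate
  points linearly).
\<close>

definition bauer_space :: "('a::topological_space set \<Rightarrow> ('a \<Rightarrow> real) set) \<Rightarrow> bool" where
  "bauer_space F \<longleftrightarrow>
     harmonic_functions F \<and> is_sheaf F \<and> topological_basis {\<omega>. regular F \<omega>} \<and>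
     (\<forall>U h. open U \<and> (\<forall>n::nat. h n \<in> F U) \<and> (\<forall>n. \<forall>x\<in>U. h n x \<le> h (Suc n) x) \<and>
        (\<forall>x\<in>U. \<exists>V c. open V \<and> x \<in> V \<and> V \<subseteq> U \<and> (\<forall>n. \<forall>y\<in>V. h n y \<le> c)) \<longrightarrow>
        (\<lambda>x. SUP n. h n x) \<in> F U) \<and>
     (\<forall>x. \<exists>U. open U \<and> x \<in> U \<and>
        (\<forall>y\<in>U. \<forall>z\<in>U. y \<noteq> z \<longrightarrow> (\<forall>c\<ge>0. \<exists>u\<in>hyperharmonic F U.
           (\<forall>w\<in>U. 0 \<le> u w) \<and> u y \<noteq> ereal c * u z)))"

text \<open>
  Brelot's axioms: sheaf axiom, existence of a base of regular domains, and convergence axiom for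
  upward directed families of harmonic functions on a domain.
\<close>

definition brelot_space :: "('a::topological_space set \<Rightarrow> ('a \<Rightarrow> real) set) \<Rightarrow> bool" where
  "brelot_space F \<longleftrightarrow>
     locally compact (UNIV :: 'a set) \<and> \<not> compact (UNIV :: 'a set) \<and>
     connected (UNIV :: 'a set) \<and> locally connected (UNIV :: 'a set) \<and>
     harmonic_functions F \<and> is_sheaf F \<and> topological_basis {\<omega>. regular F \<omega> \<and> connected \<omega>} \<and>
     (\<forall>U G. open U \<and> connected U \<and> G \<noteq> {} \<and> G \<subseteq> F U \<and>
        (\<forall>f\<in>G. \<forall>g\<in>G. \<exists>h\<in>G. \<forall>x\<in>U. f x \<le> h x \<and> g x \<le> h x) \<longrightarrow>
        (\<forall>x\<in>U. (SUP g\<in>G. ereal (g x)) = \<infinity>) \<or>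
        (\<exists>h\<in>F U. \<forall>x\<in>U. (SUP g\<in>G. ereal (g x)) = ereal (h x)))"

text \<open>
  In what follows \<open>F\<close> is a sheaf of harmonic functions and \<open>S\<close> the corresponding sheaf of
  cones of hyperharmonic functions.
\<close>

definition dense_finite :: "'a::topological_space set \<Rightarrow> ('a \<Rightarrow> ereal) \<Rightarrow> bool" where
  "dense_finite U u \<longleftrightarrow> U \<subseteq> closure {x \<in> U. \<bar>u x\<bar> \<noteq> \<infinity>}"

definition superharmonic :: "('a::topological_space set \<Rightarrow> ('a \<Rightarrow> ereal) set) \<Rightarrow> ('a \<Rightarrow> ereal) set" where
  "superharmonic S = {u \<in> S UNIV. dense_finite UNIV u}"

definition potential ::
  "('a::topological_space set \<Rightarrow> ('a \<Rightarrow> real) set) \<Rightarrow> ('a set \<Rightarrow> ('a \<Rightarrow> ereal) set) \<Rightarrow> ('a \<Rightarrow> ereal) \<Rightarrow> bool" where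
  "potential F S p \<longleftrightarrow> p \<in> superharmonic S \<and> (\<forall>x. 0 \<le> p x) \<and>
     (\<forall>h\<in>F UNIV. (\<forall>x. 0 \<le> h x \<and> ereal (h x) \<le> p x) \<longrightarrow> (\<forall>x. h x = 0))"

definition harmonic_on ::
  "('a::topological_space set \<Rightarrow> ('a \<Rightarrow> real) set) \<Rightarrow> 'a set \<Rightarrow> ('a \<Rightarrow> ereal) \<Rightarrow> bool" where
  "harmonic_on F U s \<longleftrightarrow> (\<exists>h\<in>F U. \<forall>x\<in>U. s x = ereal (h x))"

definition harmonic_support ::
  "('a::topological_space set \<Rightarrow> ('a \<Rightarrow> real) set) \<Rightarrow> ('a \<Rightarrow> ereal) \<Rightarrow> 'a set" where
  "harmonic_support F s = - \<Union>{U. open U \<and> harmonic_on F U s}"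

definition green_space :: "('a::topological_space set \<Rightarrow> ('a \<Rightarrow> real) set) \<Rightarrow> bool" where
  "green_space F \<longleftrightarrow> brelot_space F \<and>
     (\<forall>p q z. potential F (hyperharmonic F) p \<and> potential F (hyperharmonic F) q \<and>
        harmonic_support F p = {z} \<and> harmonic_support F q = {z} \<longrightarrow>
        (\<exists>c>0. \<forall>x. p x = ereal c * q x))"

definition balayage ::
  "('a::topological_space set \<Rightarrow> ('a \<Rightarrow> ereal) set) \<Rightarrow> 'a set \<Rightarrow> ('a \<Rightarrow> ereal) \<Rightarrow> 'a \<Rightarrow> ereal" where
  "balayage S A p = lsc_regularization
     (\<lambda>x. INF s \<in> {s \<in> S UNIV. (\<forall>y. 0 \<le> s y) \<and> (\<forall>y\<in>A. p y \<le> s y)}. s x)"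

definition completely_determining ::
  "('a::topological_space set \<Rightarrow> ('a \<Rightarrow> real) set) \<Rightarrow> ('a set \<Rightarrow> ('a \<Rightarrow> ereal) set) \<Rightarrow> 'a set \<Rightarrow> bool" where
  "completely_determining F S \<omega> \<longleftrightarrow> open \<omega> \<and> compact (closure \<omega>) \<and>
     (\<forall>p. potential F S p \<and> harmonic_on F \<omega> p \<longrightarrow> balayage S (- \<omega>) p = p)"

section \<open>The topology of R.-M. Herve\<close>

definition is_ultrafilter :: "'b filter \<Rightarrow> bool" where
  "is_ultrafilter \<F> \<longleftrightarrow> \<F> \<noteq> bot \<and> (\<forall>P. eventually P \<F> \<or> eventually (\<lambda>x. \<not> P x) \<F>)"

definition pos_superharmonic :: "('a::topological_space set \<Rightarrow> ('a \<Rightarrow> ereal) set) \<Rightarrow> ('a \<Rightarrow> ereal) set" where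
  "pos_superharmonic S = {u \<in> superharmonic S. \<forall>x. 0 \<le> u x}"

text \<open>
  A topology is determined by its convergent ultrafilters, so at most one topology on the cone of
  nonnegative superharmonic functions satisfies this predicate.
\<close>

definition herve_topology ::
  "('a::topological_space set \<Rightarrow> ('a \<Rightarrow> ereal) set) \<Rightarrow> ('a \<Rightarrow> ereal) topology \<Rightarrow> bool" where
  "herve_topology S T \<longleftrightarrow> topspace T = pos_superharmonic S \<and>
     (\<forall>\<F> v. is_ultrafilter \<F> \<and> eventually (\<lambda>s. s \<in> pos_superharmonic S) \<F> \<and>
        v \<in> pos_superharmonic S \<longrightarrow>
        (limitin T (\<lambda>s. s) v \<F> \<longleftrightarrow> v = lsc_regularization (\<lambda>x. Lim \<F> (\<lambda>s. s x))))"

section \<open>Biharmonic spaces\<close>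

type_synonym 'a pair_sheaf = "'a set \<Rightarrow> (('a \<Rightarrow> real) \<times> ('a \<Rightarrow> real)) set"

definition biharmonic_pairs :: "'a::topological_space pair_sheaf \<Rightarrow> bool" where
  "biharmonic_pairs H \<longleftrightarrow> (\<forall>U. open U \<longrightarrow>
     (\<forall>(u,v)\<in>H U. continuous_on U u \<and> continuous_on U v) \<and>
     (\<lambda>x. 0, \<lambda>x. 0) \<in> H U \<and>
     (\<forall>(u,v)\<in>H U. \<forall>(u',v')\<in>H U. (\<lambda>x. u x + u' x, \<lambda>x. v x + v' x) \<in> H U) \<and>
     (\<forall>c. \<forall>(u,v)\<in>H U. (\<lambda>x. c * u x, \<lambda>x. c * v x) \<in> H U) \<and>
     (\<forall>(u,v)\<in>H U. \<forall>u' v'. (\<forall>x\<in>U. u' x = u x \<and> v' x = v x) \<longrightarrow> (u',v') \<in> H U) \<and>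
     (\<forall>(u,v)\<in>H U. \<forall>\<omega>. open \<omega> \<and> \<omega> \<subseteq> U \<and> (\<forall>x\<in>\<omega>. u x = 0) \<longrightarrow> (\<forall>x\<in>\<omega>. v x = 0)))"

definition biregular :: "'a::topological_space pair_sheaf \<Rightarrow> 'a set \<Rightarrow> bool" where
  "biregular H \<omega> \<longleftrightarrow> open \<omega> \<and> compact (closure \<omega>) \<and>
     (\<forall>f g. continuous_on (frontier \<omega>) f \<and> continuous_on (frontier \<omega>) g \<longrightarrow>
        (\<exists>(u,v)\<in>H \<omega>. has_boundary_values \<omega> u f \<and> has_boundary_values \<omega> v g) \<and>
        ((\<forall>y\<in>frontier \<omega>. 0 \<le> f y \<and> 0 \<le> g y) \<longrightarrow>
           (\<forall>(u,v)\<in>H \<omega>. has_boundary_values \<omega> u f \<and> has_boundary_values \<omega> v g \<longrightarrow>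
              (\<forall>x\<in>\<omega>. 0 \<le> u x \<and> 0 \<le> v x))))"

text \<open>
  \<open>biharmonic_measures H \<omega> x \<mu> \<nu> \<kappa>\<close>: the measures \<open>\<mu>\<close>, \<open>\<nu>\<close>, \<open>\<kappa>\<close> are \<open>\<mu>\<close>, \<open>\<nu>\<close>, \<open>\<lambda>\<close>
  (with indices \<open>\<omega>\<close> and \<open>x\<close>) in the usual notation.
\<close>

definition biharmonic_measures ::
  "'a::topological_space pair_sheaf \<Rightarrow> 'a set \<Rightarrow> 'a \<Rightarrow>
     (('a \<Rightarrow> real) \<Rightarrow> real) \<Rightarrow> (('a \<Rightarrow> real) \<Rightarrow> real) \<Rightarrow> (('a \<Rightarrow> real) \<Rightarrow> real) \<Rightarrow> bool" where
  "biharmonic_measures H \<omega> x \<mu> \<nu> \<kappa> \<longleftrightarrow>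
     radon_measure (frontier \<omega>) \<mu> \<and> radon_measure (frontier \<omega>) \<nu> \<and> radon_measure (frontier \<omega>) \<kappa> \<and>
     (\<forall>f g. continuous_on (frontier \<omega>) f \<and> continuous_on (frontier \<omega>) g \<longrightarrow>
        (\<forall>(u,v)\<in>H \<omega>. has_boundary_values \<omega> u f \<and> has_boundary_values \<omega> v g \<longrightarrow>
           u x = \<mu> f + \<nu> g \<and> v x = \<kappa> g))"

definition hyperharmonic_pairs ::
  "'a::topological_space pair_sheaf \<Rightarrow> 'a set \<Rightarrow> (('a \<Rightarrow> ereal) \<times> ('a \<Rightarrow> ereal)) set" where
  "hyperharmonic_pairs H U = {(u,v).
     lsc_on U u \<and> lsc_on U v \<and> (\<forall>x\<in>U. u x \<noteq> -\<infinity> \<and> v x \<noteq> -\<infinity>) \<and>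
     (\<forall>\<omega> x \<mu> \<nu> \<kappa>. biregular H \<omega> \<and> closure \<omega> \<subseteq> U \<and> x \<in> \<omega> \<and> biharmonic_measures H \<omega> x \<mu> \<nu> \<kappa> \<longrightarrow>
        upper_integral (frontier \<omega>) \<mu> u + upper_integral (frontier \<omega>) \<nu> v \<le> u x \<and>
        upper_integral (frontier \<omega>) \<kappa> v \<le> v x)}"

definition hyperharmonic1 :: "'a::topological_space pair_sheaf \<Rightarrow> 'a set \<Rightarrow> ('a \<Rightarrow> ereal) set" where
  "hyperharmonic1 H U = {u. (u, \<lambda>x. 0) \<in> hyperharmonic_pairs H U}"

definition hyperharmonic2 :: "'a::topological_space pair_sheaf \<Rightarrow> 'a set \<Rightarrow> ('a \<Rightarrow> ereal) set" where
  "hyperharmonic2 H U = {v. (\<lambda>x. \<infinity>, v) \<in> hyperharmonic_pairs H U}"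

definition harmonic1 :: "'a::topological_space pair_sheaf \<Rightarrow> 'a set \<Rightarrow> ('a \<Rightarrow> real) set" where
  "harmonic1 H U = {u. (\<lambda>x. ereal (u x)) \<in> hyperharmonic1 H U \<and> (\<lambda>x. ereal (- u x)) \<in> hyperharmonic1 H U}"

definition harmonic2 :: "'a::topological_space pair_sheaf \<Rightarrow> 'a set \<Rightarrow> ('a \<Rightarrow> real) set" where
  "harmonic2 H U = {v. (\<lambda>x. ereal (v x)) \<in> hyperharmonic2 H U \<and> (\<lambda>x. ereal (- v x)) \<in> hyperharmonic2 H U}"

definition biharmonic_space ::
  "'a::{t2_space, second_countable_topology} pair_sheaf \<Rightarrow> bool" where
  "biharmonic_space H \<longleftrightarrow> locally compact (UNIV :: 'a set) \<and> biharmonic_pairs H \<and>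
     is_sheaf H \<and> topological_basis {\<omega>. biregular H \<omega>} \<and>
     bauer_space (harmonic1 H) \<and> bauer_space (harmonic2 H)"

definition superharmonic_pairs ::
  "'a::topological_space pair_sheaf \<Rightarrow> 'a set \<Rightarrow> (('a \<Rightarrow> ereal) \<times> ('a \<Rightarrow> ereal)) set" where
  "superharmonic_pairs H U = {(u,v) \<in> hyperharmonic_pairs H U. dense_finite U u}"

definition bipotential ::
  "'a::topological_space pair_sheaf \<Rightarrow> ('a \<Rightarrow> ereal) \<Rightarrow> ('a \<Rightarrow> ereal) \<Rightarrow> bool" where
  "bipotential H p q \<longleftrightarrow> (p,q) \<in> superharmonic_pairs H UNIV \<and> (\<forall>x. 0 \<le> p x \<and> 0 \<le> q x) \<and>
     (\<forall>(h,k)\<in>H UNIV.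
        (\<forall>x. 0 \<le> h x \<and> 0 \<le> k x \<and> ereal (h x) \<le> p x \<and> ereal (k x) \<le> q x) \<longrightarrow>
        (\<forall>x. h x = 0 \<and> k x = 0))"

definition strong :: "'a::topological_space pair_sheaf \<Rightarrow> bool" where
  "strong H \<longleftrightarrow> (\<exists>p q. bipotential H p q \<and> (\<forall>x. 0 < p x \<and> 0 < q x))"

definition green_biharmonic_space ::
  "'a::{t2_space, second_countable_topology} pair_sheaf \<Rightarrow> bool" where
  "green_biharmonic_space H \<longleftrightarrow>
     biharmonic_space H \<and> green_space (harmonic1 H) \<and> green_space (harmonic2 H)"

text \<open>\<open>u\<close> is the pure hyperharmonic function of order 2 associated with \<open>v\<close>.\<close>

definition pure_hyperharmonic ::
  "'a::topological_space pair_sheaf \<Rightarrow> ('a \<Rightarrow> ereal) \<Rightarrow> ('a \<Rightarrow> ereal) \<Rightarrow> bool" where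
  "pure_hyperharmonic H v u \<longleftrightarrow>
     (let A = {w \<in> hyperharmonic1 H UNIV. (\<forall>x. 0 \<le> w x) \<and> (w, v) \<in> hyperharmonic_pairs H UNIV}
      in u \<in> A \<and> (\<forall>w\<in>A. \<forall>x. u x \<le> w x))"

end

theory Submission
  imports Defs
begin

text \<open>
  Brelot's convergence axiom yields Harnack's inequality, by which the harmonic measures of a regular
  set at nearby points dominate each other. Hence pointwise limits along ultrafilters of bounded harmonic
  functions are harmonic, and pointwise convergent bounded sequences of them converge locally uniformly,
  by dominated convergence at a single point. Off the diagonal, the limits that describe the topology
  of Herve are therefore pointwise limits, and \<open>(x, y) \<mapsto> q\<^sub>y(x)\<close> is continuous there.

  Replacing \<open>p'\<^sub>y\<close> by its Poisson integral in a regular set whose closure omits \<open>y\<close> gives, by minimality,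
  \<open>p'\<^sub>y(x) = \<integral> p'\<^sub>y d\<mu>\<^sub>x + \<integral> q\<^sub>y d\<nu>\<^sub>x\<close>. This mean value property, Harnack's inequality and the
  assumed continuity of \<open>y \<mapsto> p'\<^sub>y(x)\<close> prove continuity off the diagonal.

  For lower semicontinuity, regularize \<open>p'\<^sub>y(x)\<close> and \<open>q\<^sub>y(x)\<close> in both variables jointly. For fixed \<open>y\<close> the
  second function is again \<open>q\<^sub>y\<close>; together with the first it forms a hyperharmonic pair, so
  the minimality of \<open>p'\<^sub>y\<close> shows that the first is \<open>p'\<^sub>y\<close>.
\<close>

text \<open>This is why the continuity of pointwise limits rests on a Hilbert space argument for
  boundary functions; once pointwise convergence is known, sequences suffice because
  \<open>\<Omega>\<close> has a countable base.

  Harnack's inequality does not apply to \<open>p' y\<close> directly, since this function need not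
  be harmonic for the first structure off \<open>y\<close>. It applies to the
  \<open>\<mu>\<close>-part of \<open>p' y\<close> in a fixed regular set, while the
  \<open>\<nu>\<close>-part is controlled by uniform convergence of the \<open>q y\<close> on a
  compact boundary and by masses at most 1, a bound that stems from the hyperharmonicity of
  \<open>(1, 1)\<close>.

  For lower semicontinuity the obstacle is the diagonal, where regularizing \<open>q\<close> jointly
  might lower its value. The supermean inequality survives regularization, and small regular sets
  have mass nearly 1, which restores the value of \<open>q y\<close> at \<open>y\<close>.

  Measures being linear forms on continuous functions, semicontinuous and infinite integrands are
  handled through families of continuous minorants.\<close>

text \<open>By compactness finitely many members of \<open>G\<close> suffice to exceed
  \<open>t\<close> on all of \<open>K\<close>, and directedness replaces them by a single one. Uses:
  Dini's theorem, and the exchange of a directed supremum with an integral in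
  \<open>pure_poisson\<close>.\<close>

lemma directed_family_exceeds:
  fixes t :: "'a::topological_space \<Rightarrow> real"
  assumes "compact K" "G \<noteq> {}"
    and cont: "\<And>g. g \<in> G \<Longrightarrow> continuous_on K g" "continuous_on K t"
    and dir: "\<And>f g. f \<in> G \<Longrightarrow> g \<in> G \<Longrightarrow> \<exists>h\<in>G. \<forall>x\<in>K. f x \<le> h x \<and> g x \<le> h x"
    and ex: "\<And>x. x \<in> K \<Longrightarrow> \<exists>g\<in>G. t x < g x"
  shows "\<exists>g\<in>G. \<forall>x\<in>K. t x < g x"
proof -
  have "\<exists>T. open T \<and> T \<inter> K = (\<lambda>x. g x - t x) -` {0<..} \<inter> K" if "g \<in> G" for g
    using cont that by (intro iffD1[OF continuous_on_open_invariant, rule_format]) (auto intro: continuous_intros)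
  then obtain T where T: "\<And>g. g \<in> G \<Longrightarrow> open (T g)"
      "\<And>g. g \<in> G \<Longrightarrow> T g \<inter> K = (\<lambda>x. g x - t x) -` {0<..} \<inter> K"
    by metis
  have "K \<subseteq> (\<Union>g\<in>G. T g)"
  proof
    fix x assume x: "x \<in> K"
    with ex obtain g where g: "g \<in> G" "t x < g x" by blast
    then have "x \<in> (\<lambda>x. g x - t x) -` {0<..} \<inter> K" using x by simp
    then show "x \<in> (\<Union>g\<in>G. T g)" using T(2)[OF g(1)] g(1) by blast
  qed
  then obtain D where D: "D \<subseteq> G" "finite D" "K \<subseteq> (\<Union>g\<in>D. T g)"
    using compactE_image[OF \<open>compact K\<close>, of G T] T(1) by blast
  have "\<exists>h\<in>G. \<forall>g\<in>D. \<forall>x\<in>K. g x \<le> h x"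
    using D(2,1)
  proof (induction D rule: finite_induct)
    case empty
    then show ?case using \<open>G \<noteq> {}\<close> by auto
  next
    case (insert g D)
    then obtain h where h: "h \<in> G" "\<forall>g\<in>D. \<forall>x\<in>K. g x \<le> h x" by auto
    obtain h' where "h' \<in> G" "\<forall>x\<in>K. g x \<le> h' x \<and> h x \<le> h' x"
      using dir[of g h] insert.prems h(1) by auto
    then show ?case using h by (metis insertE order_trans)
  qed
  then obtain h where h: "h \<in> G" "\<And>g x. g \<in> D \<Longrightarrow> x \<in> K \<Longrightarrow> g x \<le> h x" by blast
  have "t x < h x" if x: "x \<in> K" for x
  proof -
    obtain g where g: "g \<in> D" "x \<in> T g" using D(3) x by blast
    then have "x \<in> (\<lambda>x. g x - t x) -` {0<..} \<inter> K" using T(2)[of g] D(1) x by blast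
    then have "t x < g x" by simp
    then show ?thesis using h(2)[OF g(1) x] by linarith
  qed
  with h(1) show ?thesis by blast
qed

text \<open>The negatives of the \<open>\<phi> n\<close> form an upward directed family that
  pointwise exceeds \<open>- e\<close>.\<close>

lemma dini:
  fixes \<phi> :: "nat \<Rightarrow> 'a::topological_space \<Rightarrow> real"
  assumes "compact K" "\<And>n. continuous_on K (\<phi> n)"
    and dec: "\<And>n x. x \<in> K \<Longrightarrow> \<phi> (Suc n) x \<le> \<phi> n x"
    and lim: "\<And>x. x \<in> K \<Longrightarrow> (\<lambda>n. \<phi> n x) \<longlonglongrightarrow> 0" and "e > 0"
  shows "\<exists>N. \<forall>n\<ge>N. \<forall>x\<in>K. \<phi> n x < e"
proof -
  have dec': "\<phi> n x \<le> \<phi> m x" if "m \<le> n" "x \<in> K" for m n x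
    using lift_Suc_antimono_le[of "\<lambda>n. \<phi> n x" m n] dec that by blast
  have "\<exists>g\<in>range (\<lambda>n x. - \<phi> n x). \<forall>x\<in>K. - e < g x"
  proof (rule directed_family_exceeds[OF \<open>compact K\<close>])
    fix f g assume "f \<in> range (\<lambda>n x. - \<phi> n x)" "g \<in> range (\<lambda>n x. - \<phi> n x)"
    then obtain m n where "f = (\<lambda>x. - \<phi> m x)" "g = (\<lambda>x. - \<phi> n x)" by blast
    then have "\<forall>x\<in>K. f x \<le> - \<phi> (max m n) x \<and> g x \<le> - \<phi> (max m n) x"
      using dec' by auto
    then show "\<exists>h\<in>range (\<lambda>n x. - \<phi> n x). \<forall>x\<in>K. f x \<le> h x \<and> g x \<le> h x"
      by (intro bexI[of _ "\<lambda>x. - \<phi> (max m n) x"]) auto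
  next
    fix x assume "x \<in> K"
    then have "\<forall>\<^sub>F n in sequentially. \<phi> n x < e" using order_tendstoD(2)[OF lim \<open>e > 0\<close>] by blast
    then obtain n where "\<phi> n x < e" by (auto simp: eventually_sequentially)
    then show "\<exists>g\<in>range (\<lambda>n x. - \<phi> n x). - e < g x"
      by (intro bexI[of _ "\<lambda>x. - \<phi> n x"]) auto
  qed (use assms in \<open>auto intro!: continuous_intros\<close>)
  then obtain N where "\<And>x. x \<in> K \<Longrightarrow> \<phi> N x < e" by auto
  then show ?thesis using dec' by (meson order_le_less_trans)
qed

section \<open>Ultrafilters\<close>

text \<open>Zorn's lemma for the reversed order gives a minimal proper filter below
  \<open>F\<close>, and minimality makes it decide every predicate.\<close>

lemma ultrafilter_exists:
  assumes "F \<noteq> bot"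
  shows "\<exists>G\<le>F. is_ultrafilter G"
proof -
  define A where "A = {G. G \<le> F \<and> G \<noteq> bot}"
  have po: "partial_order_on A (relation_of (\<lambda>G G'. G' \<le> G) A)"
    by (rule partial_order_on_relation_ofI) auto
  have "\<exists>m\<in>A. \<forall>a\<in>A. a \<le> m \<longrightarrow> a = m"
  proof (rule predicate_Zorn[OF po])
    fix C assume C: "C \<in> Chains (relation_of (\<lambda>G G'. G' \<le> G) A)"
    then have CA: "C \<subseteq> A" by (auto simp: Chains_def relation_of_def)
    show "\<exists>u\<in>A. \<forall>a\<in>C. u \<le> a"
    proof (cases "C = {}")
      case True then show ?thesis using assms by (auto simp: A_def)
    next
      case False
      \<comment> \<open>In a chain, a predicate that is eventual for the infimum is eventual for
        some member, so an infimum of proper filters stays proper.\<close>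
      have "eventually (\<lambda>_. False) (Inf C) \<longleftrightarrow> (\<exists>b\<in>C. eventually (\<lambda>_. False) b)"
      proof (rule eventually_Inf_base[OF False])
        fix G G' assume "G \<in> C" "G' \<in> C"
        then show "\<exists>x\<in>C. x \<le> inf G G'"
          using C by (auto simp: Chains_def relation_of_def inf.absorb1 inf.absorb2)
      qed
      then have "Inf C \<noteq> bot" using CA by (auto simp: trivial_limit_def A_def)
      moreover have "Inf C \<le> F" using False CA by (auto simp: A_def intro: Inf_lower2)
      ultimately show ?thesis by (auto simp: A_def intro!: bexI[of _ "Inf C"] Inf_lower)
    qed
  qed
  then obtain G where G: "G \<le> F" "G \<noteq> bot" and
    mx: "\<And>G'. G' \<le> F \<Longrightarrow> G' \<noteq> bot \<Longrightarrow> G' \<le> G \<Longrightarrow> G' = G"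
    by (auto simp: A_def)
  have "eventually P G \<or> eventually (\<lambda>x. \<not> P x) G" for P
  proof (rule disjCI)
    assume "\<not> eventually (\<lambda>x. \<not> P x) G"
    \<comment> \<open>Cutting \<open>G\<close> down to \<open>P\<close> leaves a proper filter and
      hence, by minimality, changes nothing.\<close>
    then have "inf G (principal {x. P x}) \<noteq> bot"
      by (auto simp: trivial_limit_def eventually_inf_principal)
    then have "inf G (principal {x. P x}) = G"
      using mx G by (meson inf_le1 order_trans)
    moreover have "eventually P (inf G (principal {x. P x}))"
      by (simp add: eventually_inf_principal)
    ultimately show "eventually P G" by simp
  qed
  with G show ?thesis by (auto simp: is_ultrafilter_def)
qed

text \<open>Otherwise the trace of \<open>F\<close> on the points sent outside some neighbourhood of
  \<open>l\<close> is proper, and an ultrafilter below it contradicts the hypothesis. This turns the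
  description of the topology of Herve by ultrafilters into ordinary limits.\<close>

lemma tendsto_ultrafilterI:
  assumes "\<And>G. G \<le> F \<Longrightarrow> is_ultrafilter G \<Longrightarrow> (f \<longlongrightarrow> l) G"
  shows "(f \<longlongrightarrow> l) F"
proof (rule topological_tendstoI, rule ccontr)
  fix S assume S: "open S" "l \<in> S" and n: "\<not> eventually (\<lambda>x. f x \<in> S) F"
  then have "inf F (principal {x. f x \<notin> S}) \<noteq> bot"
    by (auto simp: trivial_limit_def eventually_inf_principal)
  then obtain G where G: "G \<le> inf F (principal {x. f x \<notin> S})" "is_ultrafilter G"
    using ultrafilter_exists by blast
  have "eventually (\<lambda>x. f x \<in> S) G"
    using assms[OF _ G(2)] G(1) S by (auto simp: tendsto_def)
  moreover have "eventually (\<lambda>x. f x \<notin> S) G"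
    using G(1) by (auto simp: le_principal)
  ultimately have "eventually (\<lambda>_. False) G" by (rule eventually_elim2) simp
  then show False using G(2) by (simp add: is_ultrafilter_def trivial_limit_def)
qed

text \<open>The extended reals are compact, so the image filter has a cluster point, and a cluster
  point of an ultrafilter is a limit.\<close>

lemma ultrafilter_convergent:
  fixes f :: "'b \<Rightarrow> ereal"
  assumes "is_ultrafilter G"
  shows "\<exists>l. (f \<longlongrightarrow> l) G"
proof -
  have "filtermap f G \<noteq> bot" using assms by (simp add: is_ultrafilter_def filtermap_bot_iff)
  then obtain l where l: "inf (nhds l) (filtermap f G) \<noteq> bot"
    using compact_UNIV[where 'a=ereal] unfolding compact_filter by auto
  have "(f \<longlongrightarrow> l) G"
  proof (rule topological_tendstoI, rule ccontr)
    fix S assume S: "open S" "l \<in> S" and "\<not> eventually (\<lambda>x. f x \<in> S) G"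
    then have "eventually (\<lambda>x. f x \<notin> S) G" using assms by (auto simp: is_ultrafilter_def)
    then have "eventually (\<lambda>x. x \<notin> S) (filtermap f G)" by (simp add: eventually_filtermap)
    moreover have "eventually (\<lambda>x. x \<in> S) (nhds l)" using S by (simp add: eventually_nhds_in_open)
    ultimately have "eventually (\<lambda>_. False) (inf (nhds l) (filtermap f G))"
      unfolding eventually_inf by blast
    with l show False by (simp add: trivial_limit_def)
  qed
  then show ?thesis ..
qed

lemma is_ultrafilter_filtermap: "is_ultrafilter G \<Longrightarrow> is_ultrafilter (filtermap f G)"
  by (auto simp: is_ultrafilter_def filtermap_bot_iff eventually_filtermap)

section \<open>Semicontinuity\<close>

lemma lsc_on_subset: "lsc_on U f \<Longrightarrow> K \<subseteq> U \<Longrightarrow> lsc_on K f"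
  unfolding lsc_on_def
proof safe
  fix t assume "\<forall>t. openin (top_of_set U) {x \<in> U. t < f x}" "K \<subseteq> U"
  then obtain T where T: "open T" "{x \<in> U. t < f x} = U \<inter> T" unfolding openin_open by blast
  then have "{x \<in> K. t < f x} = K \<inter> T" using \<open>K \<subseteq> U\<close> by blast
  then show "openin (top_of_set K) {x \<in> K. t < f x}" using T by (auto simp: openin_open)
qed

lemma lsc_onD:
  assumes "lsc_on U f" "x \<in> U" "t < f x"
  shows "eventually (\<lambda>z. z \<in> U \<longrightarrow> t < f z) (nhds x)"
proof -
  obtain T where T: "open T" "{x \<in> U. t < f x} = U \<inter> T"
    using assms(1) unfolding lsc_on_def openin_open by blast
  then have "x \<in> T" using assms by blast
  then show ?thesis using T unfolding eventually_nhds by blast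
qed

lemma lsc_on_UNIV_I:
  assumes "\<And>x t. t < f x \<Longrightarrow> eventually (\<lambda>z. t < f z) (nhds x)"
  shows "lsc_on UNIV f"
proof -
  have "open {x. t < f x}" for t
  proof (rule topological_space_class.openI)
    fix x assume "x \<in> {x. t < f x}"
    then show "\<exists>T. open T \<and> x \<in> T \<and> T \<subseteq> {x. t < f x}"
      using assms[of t x] by (auto simp: eventually_nhds subset_iff)
  qed
  then show ?thesis by (simp add: lsc_on_def)
qed

lemma lsc_on_continuous:
  fixes f :: "'a::topological_space \<Rightarrow> ereal"
  assumes "continuous_on U f"
  shows "lsc_on U f"
proof -
  have "openin (top_of_set U) (U \<inter> f -` {t<..})" for t
    by (rule continuous_openin_preimage_gen[OF assms]) simp
  moreover have "U \<inter> f -` {t<..} = {x \<in> U. t < f x}" for t by auto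
  ultimately show ?thesis by (simp add: lsc_on_def)
qed

text \<open>Urysohn's lemma in the compact, hence normal, space \<open>K\<close>: the function is
  \<open>t\<close> at \<open>z\<close> and vanishes where \<open>p \<le> t\<close>, so nonnegativity
  of \<open>p\<close> makes it a minorant. A strict lower bound for a semicontinuous function thus
  becomes a continuous minorant with a prescribed value.\<close>

lemma lsc_bump:
  fixes p :: "'a::t2_space \<Rightarrow> ereal"
  assumes "compact K" "lsc_on K p" and nn: "\<And>x. x \<in> K \<Longrightarrow> 0 \<le> p x"
    and z: "z \<in> K" "ereal t < p z" "0 \<le> t"
  shows "\<exists>f. continuous_on K f \<and> (\<forall>x\<in>K. 0 \<le> f x \<and> ereal (f x) \<le> p x) \<and> f z = t"
proof -
  define S where "S = {x \<in> K. ereal t < p x}"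
  have S: "openin (top_of_set K) S" using assms(2) by (simp add: lsc_on_def S_def)
  have "Hausdorff_space (top_of_set K)"
    by (rule Hausdorff_space_subtopology) (simp add: Hausdorff_space_def disjnt_def, meson hausdorff)
  then have N: "normal_space (top_of_set K)"
    using \<open>compact K\<close> by (intro compact_Hausdorff_or_regular_imp_normal_space)
      (auto simp: compact_space_subtopology)
  obtain f where f: "continuous_map (top_of_set K) (top_of_set {0..t}) f"
     "f ` (K - S) \<subseteq> {0}" "f ` {z} \<subseteq> {t}"
  proof (rule Urysohn_lemma[OF N _ _ _ \<open>0 \<le> t\<close>, of "K - S" "{z}"])
    show "closedin (top_of_set K) (K - S)" using S closedin_diff by fastforce
    show "closedin (top_of_set K) {z}" using z by (intro closed_subset) auto
    show "disjnt (K - S) {z}" using z by (auto simp: S_def)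
  qed auto
  have fb: "continuous_on K f" "\<And>x. x \<in> K \<Longrightarrow> 0 \<le> f x \<and> f x \<le> t"
    using f(1) by (auto simp: continuous_map_in_subtopology)
  moreover have "ereal (f x) \<le> p x" if x: "x \<in> K" for x
  proof (cases "x \<in> S")
    case True
    then have "ereal (f x) \<le> ereal t" using fb(2)[OF x] by simp
    also have "\<dots> \<le> p x" using True by (auto simp: S_def)
    finally show ?thesis .
  next
    case False then show ?thesis using f(2) x nn[OF x] by (auto simp: image_subset_iff zero_ereal_def[symmetric])
  qed
  ultimately show ?thesis using f(3) by auto
qed


section \<open>Positive linear forms on spaces of continuous functions\<close>

lemma radon_cmult: "radon_measure K \<mu> \<Longrightarrow> continuous_on K f \<Longrightarrow> \<mu> (\<lambda>x. c * f x) = c * \<mu> f"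
  and radon_add: "radon_measure K \<mu> \<Longrightarrow> continuous_on K f \<Longrightarrow> continuous_on K g \<Longrightarrow>
    \<mu> (\<lambda>x. f x + g x) = \<mu> f + \<mu> g"
  and radon_nonneg: "radon_measure K \<mu> \<Longrightarrow> continuous_on K f \<Longrightarrow> (\<And>x. x \<in> K \<Longrightarrow> 0 \<le> f x) \<Longrightarrow> 0 \<le> \<mu> f"
  by (auto simp: radon_measure_def)

lemma radon_diff:
  assumes "radon_measure K \<mu>" "continuous_on K f" "continuous_on K g"
  shows "\<mu> (\<lambda>x. f x - g x) = \<mu> f - \<mu> g"
  using radon_add[OF assms(1,2), of "\<lambda>x. (-1) * g x"] radon_cmult[OF assms(1,3), of "-1"] assms(3)
  by (simp add: continuous_on_minus)

lemma radon_mono: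
  assumes "radon_measure K \<mu>" "continuous_on K f" "continuous_on K g" "\<And>x. x \<in> K \<Longrightarrow> f x \<le> g x"
  shows "\<mu> f \<le> \<mu> g"
  using radon_nonneg[OF assms(1), of "\<lambda>x. g x - f x"] radon_diff[OF assms(1,3,2)] assms
  by (auto intro: continuous_intros)

lemma radon_const:
  assumes "radon_measure K \<mu>"
  shows "\<mu> (\<lambda>x. c) = c * \<mu> (\<lambda>x. 1)"
  using radon_cmult[OF assms, of "\<lambda>x. 1" c] by simp

lemma radon_add_const:
  assumes "radon_measure K \<mu>" "continuous_on K f"
  shows "\<mu> (\<lambda>x. f x + c) = \<mu> f + c * \<mu> (\<lambda>x. 1)" "\<mu> (\<lambda>x. f x - c) = \<mu> f - c * \<mu> (\<lambda>x. 1)"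
  using radon_add[OF assms, of "\<lambda>x. c"] radon_diff[OF assms, of "\<lambda>x. c"] radon_const[OF assms(1), of c]
  by auto

lemma radon_abs_le:
  assumes "radon_measure K \<mu>" "continuous_on K f"
  shows "\<bar>\<mu> f\<bar> \<le> \<mu> (\<lambda>x. \<bar>f x\<bar>)"
proof -
  have "continuous_on K (\<lambda>x. \<bar>f x\<bar>)" using assms(2) by (intro continuous_intros)
  then have "\<mu> f \<le> \<mu> (\<lambda>x. \<bar>f x\<bar>)" "(-1) * \<mu> f \<le> \<mu> (\<lambda>x. \<bar>f x\<bar>)"
    unfolding radon_cmult[OF assms, of "-1", symmetric]
    by (auto intro!: radon_mono[OF assms(1)] continuous_intros assms(2))
  then show ?thesis by simp
qed

lemma radon_cong:
  assumes "radon_measure K \<mu>" "continuous_on K f" "\<And>x. x \<in> K \<Longrightarrow> f x = g x"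
  shows "\<mu> f = \<mu> g"
proof -
  have "continuous_on K g" using assms(2,3) continuous_on_cong[of K K f g] by simp
  then show ?thesis using radon_mono[OF assms(1,2)] radon_mono[OF assms(1) _ assms(2)] assms(3)
    by (simp add: order_antisym)
qed

lemma upper_integralI:
  "continuous_on K f \<Longrightarrow> (\<And>x. x \<in> K \<Longrightarrow> ereal (f x) \<le> u x) \<Longrightarrow> ereal (\<mu> f) \<le> upper_integral K \<mu> u"
  unfolding upper_integral_def by (intro SUP_upper) auto

lemma upper_integral_le:
  assumes "\<And>f. continuous_on K f \<Longrightarrow> (\<And>x. x \<in> K \<Longrightarrow> ereal (f x) \<le> u x) \<Longrightarrow> ereal (\<mu> f) \<le> c"
  shows "upper_integral K \<mu> u \<le> c"
  unfolding upper_integral_def by (intro SUP_least) (auto intro: assms)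

lemma upper_integral_mono:
  assumes "\<And>x. x \<in> K \<Longrightarrow> u x \<le> v x"
  shows "upper_integral K \<mu> u \<le> upper_integral K \<mu> v"
proof (rule upper_integral_le)
  fix f assume "continuous_on K f" "\<And>x. x \<in> K \<Longrightarrow> ereal (f x) \<le> u x"
  then show "ereal (\<mu> f) \<le> upper_integral K \<mu> v"
    using assms by (intro upper_integralI) (meson order_trans)+
qed

lemma upper_integral_real:
  assumes "radon_measure K \<mu>" "continuous_on K f"
  shows "upper_integral K \<mu> (\<lambda>x. ereal (f x)) = ereal (\<mu> f)"
proof (rule antisym)
  show "upper_integral K \<mu> (\<lambda>x. ereal (f x)) \<le> ereal (\<mu> f)"
    by (rule upper_integral_le) (simp add: radon_mono[OF assms(1) _ assms(2)])
  show "ereal (\<mu> f) \<le> upper_integral K \<mu> (\<lambda>x. ereal (f x))"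
    by (rule upper_integralI[OF assms(2)]) simp
qed

lemma upper_integral_nonneg:
  assumes "radon_measure K \<mu>" "\<And>x. x \<in> K \<Longrightarrow> 0 \<le> u x"
  shows "0 \<le> upper_integral K \<mu> u"
  using upper_integralI[of K "\<lambda>x. 0" u \<mu>] radon_const[OF assms(1), of 0] assms(2)
  by (simp add: zero_ereal_def)

text \<open>The zero function minorizes both integrands, so no supremum is taken over an empty set
  and the sum of the suprema is the supremum of the sums, also at infinity. Supermean inequalities
  for pairs are tested on real data in this way.\<close>

lemma upper_integral_add_le:
  assumes "radon_measure K \<mu>" "radon_measure K \<nu>"
    and nn: "\<And>x. x \<in> K \<Longrightarrow> 0 \<le> u x" "\<And>x. x \<in> K \<Longrightarrow> 0 \<le> v x"
    and le: "\<And>f g. continuous_on K f \<Longrightarrow> (\<And>x. x \<in> K \<Longrightarrow> ereal (f x) \<le> u x) \<Longrightarrow>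
       continuous_on K g \<Longrightarrow> (\<And>x. x \<in> K \<Longrightarrow> ereal (g x) \<le> v x) \<Longrightarrow> ereal (\<mu> f + \<nu> g) \<le> c"
  shows "upper_integral K \<mu> u + upper_integral K \<nu> v \<le> c"
proof -
  let ?A = "{f. continuous_on K f \<and> (\<forall>x\<in>K. ereal (f x) \<le> u x)}"
  let ?B = "{f. continuous_on K f \<and> (\<forall>x\<in>K. ereal (f x) \<le> v x)}"
  have ne: "?A \<noteq> {}" "?B \<noteq> {}"
    using nn by (auto intro!: exI[of _ "\<lambda>x. 0"] simp: zero_ereal_def)
  have "upper_integral K \<mu> u + upper_integral K \<nu> v
      = (SUP f\<in>?A. ereal (\<mu> f) + upper_integral K \<nu> v)"
    unfolding upper_integral_def[of K \<mu>] using ne upper_integral_nonneg[OF assms(2) nn(2)]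
    by (subst SUP_ereal_add_left) auto
  also have "\<dots> = (SUP f\<in>?A. SUP g\<in>?B. ereal (\<mu> f) + ereal (\<nu> g))"
    unfolding upper_integral_def using ne by (subst SUP_ereal_add_right) auto
  also have "\<dots> \<le> c"
    using le by (intro SUP_least) simp
  finally show ?thesis .
qed

text \<open>The maximum of \<open>g n\<close> over \<open>k \<le> n \<le> k + m\<close>; the last
  index counts the steps beyond \<open>k\<close>. Finite maxima stay continuous, whereas the
  supremum over all \<open>n \<ge> k\<close> may not.\<close>

fun running_max :: "(nat \<Rightarrow> 'a \<Rightarrow> real) \<Rightarrow> nat \<Rightarrow> nat \<Rightarrow> 'a \<Rightarrow> real" where
  "running_max g k 0 = g k"
| "running_max g k (Suc m) = (\<lambda>x. max (running_max g k m x) (g (k + Suc m) x))"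

lemma running_max_ge: "n \<le> m \<Longrightarrow> g (k + n) x \<le> running_max g k m x"
  by (induction m) (auto simp: le_Suc_eq le_max_iff_disj)

lemma running_max_le: "(\<And>n. k \<le> n \<Longrightarrow> n \<le> k + m \<Longrightarrow> g n x \<le> c) \<Longrightarrow> running_max g k m x \<le> c"
  by (induction m) auto

lemma running_max_continuous:
  "(\<And>n. continuous_on K (g n)) \<Longrightarrow> continuous_on K (running_max g k m)"
  by (induction m) (auto intro: continuous_on_max)

text \<open>The dominated convergence theorem, without extending the linear form beyond continuous
  functions. Running maxima reduce it to the monotone case, which is Dini's theorem.\<close>

lemma radon_dominated_convergence_zero:
  fixes \<mu> :: "('a::topological_space \<Rightarrow> real) \<Rightarrow> real"
  assumes "compact K" and R: "radon_measure K \<mu>"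
    and cont: "\<And>n. continuous_on K (g n)"
    and bd: "\<And>n x. x \<in> K \<Longrightarrow> 0 \<le> g n x \<and> g n x \<le> M"
    and lim: "\<And>x. x \<in> K \<Longrightarrow> (\<lambda>n. g n x) \<longlonglongrightarrow> 0"
  shows "(\<lambda>n. \<mu> (g n)) \<longlonglongrightarrow> 0"
proof (rule tendstoI)
  fix e :: real assume e: "0 < e"
  define G where "G = running_max g"
  have Gc: "continuous_on K (G k m)" for k m
    unfolding G_def by (rule running_max_continuous[OF cont])
  have GM: "G k m x \<le> M" if "x \<in> K" for k m x
    unfolding G_def by (rule running_max_le) (use bd that in auto)
  have G0: "0 \<le> G k m x" if "x \<in> K" for k m x
    using running_max_ge[of 0 m g k x] bd[OF that, of k] by (simp add: G_def)
  \<comment> \<open>\<open>s k\<close> stands in for the integral of the supremum of the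
    \<open>g n\<close> with \<open>n \<ge> k\<close>.\<close>
  define s where "s k = (SUP m. \<mu> (G k m))" for k
  have bdd: "bdd_above (range (\<lambda>m. \<mu> (G k m)))" for k
    by (intro bdd_aboveI[of _ "\<mu> (\<lambda>x. M)"]) (auto intro!: radon_mono[OF R] Gc GM)
  have sle: "\<mu> (G k m) \<le> s k" for k m
    unfolding s_def by (rule cSUP_upper[OF _ bdd]) simp
  have "\<exists>m. s k - e / 4 * (1/2) ^ k < \<mu> (G k m)" for k
  proof -
    have "s k - e / 4 * (1/2) ^ k < (SUP m. \<mu> (G k m))" using e by (simp add: s_def)
    then show ?thesis using less_cSUP_iff[OF _ bdd] by auto
  qed
  \<comment> \<open>\<open>G k (m k)\<close> exhausts \<open>s k\<close> up to a term of a geometric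
    series whose partial sums are at most \<open>e / 2\<close>.\<close>
  then obtain m where m: "\<And>k. s k - e / 4 * (1/2) ^ k < \<mu> (G k (m k))" by metis
  \<comment> \<open>The functions \<open>G k (m k)\<close> need not decrease in \<open>k\<close>;
    their successive minima do, as Dini's theorem requires, and \<open>est\<close> shows that little
    of the integral is lost.\<close>
  define \<phi> where "\<phi> = rec_nat (G 0 (m 0)) (\<lambda>k f x. min (f x) (G (Suc k) (m (Suc k)) x))"
  have \<phi>0: "\<phi> 0 = G 0 (m 0)" and \<phi>S: "\<phi> (Suc k) = (\<lambda>x. min (\<phi> k x) (G (Suc k) (m (Suc k)) x))" for k
    by (simp_all add: \<phi>_def)
  have \<phi>c: "continuous_on K (\<phi> k)" for k
    by (induction k) (auto simp: \<phi>0 \<phi>S intro!: continuous_on_min Gc)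
  have \<phi>le: "\<phi> k x \<le> G k (m k) x" for k x by (cases k) (auto simp: \<phi>0 \<phi>S)
  have \<phi>n: "0 \<le> \<phi> k x" if "x \<in> K" for k x by (induction k) (auto simp: \<phi>0 \<phi>S G0 that)
  have est: "\<mu> (G k (m k)) - (\<Sum>j<k. e / 4 * (1/2) ^ j) \<le> \<mu> (\<phi> k)" for k
  proof (induction k)
    case 0 then show ?case by (simp add: \<phi>0)
  next
    case (Suc k)
    let ?X = "\<lambda>x. max (\<phi> k x) (G (Suc k) (m (Suc k)) x)"
    \<comment> \<open>The indices from \<open>k\<close> to \<open>k + ?M\<close> comprise those up
      to \<open>k + m k\<close> as well as those from \<open>Suc k\<close> to
      \<open>Suc k + m (Suc k)\<close>, so \<open>G k ?M\<close> dominates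
      \<open>?X\<close>.\<close>
    let ?M = "m k + Suc (m (Suc k))"
    have Xc: "continuous_on K ?X" by (intro continuous_on_max \<phi>c Gc)
    have "G k (m k) x \<le> G k ?M x" for x
      unfolding G_def
    proof (rule running_max_le)
      fix n assume "k \<le> n" "n \<le> k + m k"
      then show "g n x \<le> running_max g k ?M x"
        using running_max_ge[of "n - k" ?M g k x] by simp
    qed
    moreover have "G (Suc k) (m (Suc k)) x \<le> G k ?M x" for x
      unfolding G_def
    proof (rule running_max_le)
      fix n assume "Suc k \<le> n" "n \<le> Suc k + m (Suc k)"
      then show "g n x \<le> running_max g k ?M x"
        using running_max_ge[of "n - k" ?M g k x] by simp
    qed
    ultimately have "?X x \<le> G k ?M x" for x
      using \<phi>le[of k x] by (meson max.boundedI order_trans)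
    then have "\<mu> ?X \<le> \<mu> (G k ?M)"
      by (intro radon_mono[OF R] Xc Gc)
    also have "\<dots> \<le> \<mu> (G k (m k)) + e / 4 * (1/2) ^ k" using sle[of k ?M] m[of k] by simp
    finally have 1: "\<mu> ?X \<le> \<mu> (G k (m k)) + e / 4 * (1/2) ^ k" .
    \<comment> \<open>A minimum is the sum minus the maximum: the upper bound for
      \<open>\<mu> ?X\<close> becomes a lower bound for the integral of the minimum.\<close>
    have "\<phi> (Suc k) = (\<lambda>x. (\<phi> k x + G (Suc k) (m (Suc k)) x) - ?X x)"
      by (auto simp: \<phi>S fun_eq_iff max_def min_def)
    then have "\<mu> (\<phi> (Suc k)) = \<mu> (\<phi> k) + \<mu> (G (Suc k) (m (Suc k))) - \<mu> ?X"
      using radon_diff[OF R continuous_on_add[OF \<phi>c Gc] Xc] radon_add[OF R \<phi>c Gc]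
      by simp
    with 1 Suc.IH show ?case by simp
  qed
  have sum: "(\<Sum>j<k. e / 4 * (1/2) ^ j) \<le> e / 2" for k
  proof -
    have "(\<Sum>j<k. (1/2::real) ^ j) = 2 - 2 * (1/2) ^ k" by (induction k) auto
    then have "(\<Sum>j<k. (1/2::real) ^ j) \<le> 2" by simp
    then have "e / 4 * (\<Sum>j<k. (1/2) ^ j) \<le> e / 4 * 2" using e by (intro mult_left_mono) auto
    then show ?thesis by (simp only: sum_distrib_left)
  qed
  have lim\<phi>: "(\<lambda>n. \<phi> n x) \<longlonglongrightarrow> 0" if x: "x \<in> K" for x
  proof (rule LIMSEQ_I)
    fix r :: real assume "0 < r"
    then obtain N where N: "\<And>n. n \<ge> N \<Longrightarrow> g n x < r / 2"
      using order_tendstoD(2)[OF lim[OF x], of "r/2"] by (auto simp: eventually_sequentially)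
    have "G n (m n) x \<le> r / 2" if "n \<ge> N" for n
      unfolding G_def by (rule running_max_le) (use N that in \<open>auto intro: less_imp_le\<close>)
    moreover have "norm (\<phi> n x - 0) \<le> G n (m n) x" for n
      using \<phi>le[of n x] \<phi>n[OF x, of n] by simp
    moreover have "r / 2 < r" using \<open>0 < r\<close> by simp
    ultimately show "\<exists>no. \<forall>n\<ge>no. norm (\<phi> n x - 0) < r"
      by (meson order_trans order_le_less_trans)
  qed
  \<comment> \<open>The constant \<open>d\<close> has integral below \<open>e / 2\<close>; the
    summand 1 allows for total mass zero.\<close>
  define d where "d = e / (4 * (\<mu> (\<lambda>x. 1) + 1))"
  have m1: "0 \<le> \<mu> (\<lambda>x. 1)" by (rule radon_nonneg[OF R]) auto
  have d: "0 < d" "d * \<mu> (\<lambda>x. 1) < e / 2"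
    using e m1 by (auto simp: d_def divide_simps)
  obtain N where N: "\<And>n x. n \<ge> N \<Longrightarrow> x \<in> K \<Longrightarrow> \<phi> n x < d"
    using dini[OF \<open>compact K\<close> \<phi>c _ lim\<phi> d(1)] by (auto simp: \<phi>S)
  have "\<mu> (g n) < e" "0 \<le> \<mu> (g n)" if "n \<ge> N" for n
  proof -
    have "\<mu> (g n) \<le> \<mu> (G n (m n))"
      using running_max_ge[of 0 "m n" g n] by (intro radon_mono[OF R cont Gc]) (simp add: G_def)
    also have "\<dots> \<le> \<mu> (\<phi> n) + e / 2" using est[of n] sum[of n] by simp
    also have "\<mu> (\<phi> n) \<le> \<mu> (\<lambda>x. d)"
      using N[OF that] by (intro radon_mono[OF R \<phi>c]) (auto intro: less_imp_le)
    also have "\<mu> (\<lambda>x. d) < e / 2" using d(2) radon_const[OF R, of d] by simp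
    finally show "\<mu> (g n) < e" by simp
    show "0 \<le> \<mu> (g n)" using bd by (intro radon_nonneg[OF R cont]) auto
  qed
  then show "\<forall>\<^sub>F n in sequentially. dist (\<mu> (g n)) 0 < e"
    unfolding eventually_sequentially by (intro exI[of _ N]) simp
qed

section \<open>Brelot spaces\<close>

lemma locally_compact_nhd:
  fixes x :: "'a::t2_space"
  assumes "locally compact (UNIV :: 'a set)" "open N" "x \<in> N"
  shows "\<exists>V. open V \<and> x \<in> V \<and> compact (closure V) \<and> closure V \<subseteq> N"
proof -
  obtain U V where "open U" "compact V" "x \<in> U" "U \<subseteq> V" "V \<subseteq> N"
    using assms(1)[unfolded locally_def, rule_format, of N x] assms(2,3) by auto
  moreover have "closure U \<subseteq> V"
    using calculation by (simp add: closure_minimal compact_imp_closed)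
  moreover have "compact (closure U)"
    using calculation by (metis closed_closure compact_Int_closed inf.absorb2)
  ultimately show ?thesis by blast
qed

text \<open>A boundary point of \<open>U\<close> inside \<open>W\<close> would have an open
  component of \<open>W\<close> around it that meets \<open>U\<close>, hence equals
  \<open>U\<close>. Solvable sets need not be connected, whereas the convergence axiom speaks of
  domains; the inclusion of boundaries makes the boundary values on \<open>W\<close> usable on the
  component.\<close>

lemma component_facts:
  fixes W :: "'a::topological_space set"
  assumes "locally connected (UNIV :: 'a set)" "open W" "x \<in> W"
  defines "U \<equiv> connected_component_set W x"
  shows "open U" "connected U" "x \<in> U" "U \<subseteq> W" "frontier U \<subseteq> frontier W"
proof -
  have op: "open (connected_component_set W z)" if "z \<in> W" for z
    using assms(1,2) that unfolding locally_connected_open_connected_component by auto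
  then show U: "open U" "connected U" "x \<in> U" "U \<subseteq> W"
    using assms(3) by (auto simp: U_def connected_component_subset)
  show "frontier U \<subseteq> frontier W"
  proof
    fix z assume z: "z \<in> frontier U"
    have "z \<notin> W"
    proof
      assume zW: "z \<in> W"
      have "z \<in> connected_component_set W z \<inter> closure U" using z zW by (simp add: frontier_def)
      then have "connected_component_set W z \<inter> U \<noteq> {}"
        using open_Int_closure_eq_empty[OF op[OF zW], of U] by blast
      then have "connected_component_set W z = U"
        using connected_component_nonoverlap[of W z x] U_def by simp
      moreover have "z \<in> connected_component_set W z" using zW by simp
      ultimately have "z \<in> U" by simp
      then show False using z U(1) by (simp add: frontier_def interior_open)
    qed
    moreover have "z \<in> closure W" using z U(4) closure_mono by (auto simp: frontier_def)
    ultimately show "z \<in> frontier W" using assms(2) by (simp add: frontier_def interior_open)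
  qed
qed

text \<open>\<open>\<kappa> x\<close> is the harmonic measure at \<open>x\<close> of the set \<open>R\<close>, for which the Dirichlet problem is
  solvable.\<close>

definition dirichlet_kernel ::
  "('a::topological_space set \<Rightarrow> ('a \<Rightarrow> real) set) \<Rightarrow> 'a set \<Rightarrow> ('a \<Rightarrow> ('a \<Rightarrow> real) \<Rightarrow> real) \<Rightarrow> bool" where
  "dirichlet_kernel F R \<kappa> \<longleftrightarrow> open R \<and> compact (closure R) \<and>
     (\<forall>x\<in>R. radon_measure (frontier R) (\<kappa> x)) \<and>
     (\<forall>f. continuous_on (frontier R) f \<longrightarrow>
        (\<lambda>x. \<kappa> x f) \<in> F R \<and> has_boundary_values R (\<lambda>x. \<kappa> x f) f)"

text \<open>The sheaf condition for the cover of \<open>U\<close> by \<open>U\<close> and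
  \<open>V\<close> already contains restriction.\<close>

lemma sheaf_restrict:
  assumes "is_sheaf F" "open U" "open V" "V \<subseteq> U" "h \<in> F U"
  shows "h \<in> F V"
proof -
  have "F (\<Union>{U,V}) = (\<Inter>W\<in>{U,V}. F W)"
    using spec[OF assms(1)[unfolded is_sheaf_def], of "{U,V}"] assms(2,3) by simp
  moreover have "\<Union>{U,V} = U" using assms(4) by auto
  ultimately have "h \<in> (\<Inter>W\<in>{U,V}. F W)" using assms(5) by (simp only:)
  then show ?thesis by blast
qed

lemma frontier_nontrivial:
  assumes "open U" "z \<in> frontier U"
  shows "at z within U \<noteq> bot"
proof -
  have "z \<in> closure U" "z \<notin> U" using assms by (simp_all add: frontier_def interior_open)
  then have "z islimpt U" using islimpt_in_closure[of z U] by simp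
  then show ?thesis by (simp add: trivial_limit_within)
qed

lemma boundary_subset_tendsto:
  assumes "has_boundary_values R u f" "U \<subseteq> R" "z \<in> frontier R"
  shows "(u \<longlongrightarrow> f z) (at z within U)"
  by (rule tendsto_within_subset[OF _ assms(2)]) (use assms in \<open>simp add: has_boundary_values_def\<close>)

text \<open>A substitute for the Cauchy--Schwarz inequality.\<close>

lemma abs_le_average:
  fixes a t :: real
  assumes "a > 0"
  shows "\<bar>t\<bar> \<le> a / 2 + t\<^sup>2 / (2 * a)"
proof -
  have "0 \<le> (a - \<bar>t\<bar>)\<^sup>2" by simp
  then have "2 * a * \<bar>t\<bar> \<le> a\<^sup>2 + t\<^sup>2" by (simp add: power2_diff)
  then show ?thesis using assms by (simp add: field_simps power2_eq_square)
qed

text \<open>A weak limit of a bounded family of boundary functions is a limit, in the Hilbert space norm of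
  \<open>\<sigma>\<close>, of functions of almost minimal norm in the convex hulls of the tails. The set \<open>tail_hull P\<close> below
  contains the convex hull of the \<open>f i\<close> with \<open>P i\<close> and only differs from it by being easier to
  handle.\<close>

lemma weak_limit_continuous:
  fixes \<kappa> :: "'a::topological_space \<Rightarrow> ('a \<Rightarrow> real) \<Rightarrow> real"
  assumes \<sigma>: "radon_measure K \<sigma>" and \<kappa>: "\<And>x. x \<in> N \<Longrightarrow> radon_measure K (\<kappa> x)"
    and dom: "\<And>x g. x \<in> N \<Longrightarrow> continuous_on K g \<Longrightarrow> (\<And>z. z \<in> K \<Longrightarrow> 0 \<le> g z) \<Longrightarrow> \<kappa> x g \<le> C * \<sigma> g"
    and "0 \<le> C"
    and cont: "\<And>\<phi>. continuous_on K \<phi> \<Longrightarrow> continuous_on N (\<lambda>x. \<kappa> x \<phi>)"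
    and G: "G \<noteq> bot"
    and f: "\<forall>\<^sub>F i in G. continuous_on K (f i) \<and> (\<forall>z\<in>K. \<bar>f i z\<bar> \<le> M)"
    and lim: "\<And>x. x \<in> N \<Longrightarrow> ((\<lambda>i. \<kappa> x (f i)) \<longlongrightarrow> h x) G"
  shows "continuous_on N h"
proof -
  define tail_hull where "tail_hull P = {\<phi>. continuous_on K \<phi> \<and>
      (\<forall>x\<in>N. \<forall>a b. (\<forall>i. P i \<longrightarrow> a \<le> \<kappa> x (f i) \<and> \<kappa> x (f i) \<le> b) \<longrightarrow> a \<le> \<kappa> x \<phi> \<and> \<kappa> x \<phi> \<le> b)}" for P
  define Q where "Q i \<longleftrightarrow> continuous_on K (f i) \<and> (\<forall>z\<in>K. \<bar>f i z\<bar> \<le> M)" for i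
  \<comment> \<open>These are the tails. Each forces the bound in \<open>Q\<close>, whence
    \<open>c\<close> is bounded on them.\<close>
  define \<P> where "\<P> = {P. eventually P G \<and> (\<forall>i. P i \<longrightarrow> Q i)}"
  define c where "c P = (INF \<phi>\<in>tail_hull P. \<sigma> (\<lambda>z. (\<phi> z)\<^sup>2))" for P
  have hc: "continuous_on K \<phi>" if "\<phi> \<in> tail_hull P" for \<phi> P using that by (simp add: tail_hull_def)
  have sqc: "continuous_on K (\<lambda>z. (\<phi> z)\<^sup>2)" if "\<phi> \<in> tail_hull P" for \<phi> P
    using hc[OF that] by (intro continuous_intros)
  have sqn: "0 \<le> \<sigma> (\<lambda>z. (\<phi> z)\<^sup>2)" if "\<phi> \<in> tail_hull P" for \<phi> P
    by (intro radon_nonneg[OF \<sigma>] sqc[OF that]) simp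
  have bdd: "bdd_below ((\<lambda>\<phi>. \<sigma> (\<lambda>z. (\<phi> z)\<^sup>2)) ` tail_hull P)" for P
    using sqn by (intro bdd_belowI[of _ 0]) auto
  have fhull: "f i \<in> tail_hull P" if "P i" "P \<in> \<P>" for i P
    using that by (auto simp: tail_hull_def \<P>_def Q_def)
  have ex: "\<exists>i. P i" if "P \<in> \<P>" for P
    using that G by (auto simp: \<P>_def dest: eventually_happens')
  have ne: "tail_hull P \<noteq> {}" if "P \<in> \<P>" for P using ex[OF that] fhull that by blast
  have mono: "tail_hull P' \<subseteq> tail_hull P" if "\<And>i. P' i \<Longrightarrow> P i" for P P' using that by (force simp: tail_hull_def)
  have cle: "c P \<le> \<sigma> (\<lambda>z. (\<phi> z)\<^sup>2)" if "\<phi> \<in> tail_hull P" for P \<phi>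
    unfolding c_def by (rule cINF_lower[OF bdd that])
  have cb: "c P \<le> M\<^sup>2 * \<sigma> (\<lambda>z. 1)" if P: "P \<in> \<P>" for P
  proof -
    obtain i where i: "P i" using ex[OF P] by blast
    have "(f i z)\<^sup>2 \<le> M\<^sup>2" if "z \<in> K" for z
    proof -
      have "\<bar>f i z\<bar> \<le> M" using i P that by (simp add: \<P>_def Q_def)
      then show ?thesis using power_mono[of "\<bar>f i z\<bar>" M 2] by simp
    qed
    then have "\<sigma> (\<lambda>z. (f i z)\<^sup>2) \<le> \<sigma> (\<lambda>z. M\<^sup>2)"
      using sqc[OF fhull[OF i P]] by (intro radon_mono[OF \<sigma>]) auto
    then show ?thesis using cle[OF fhull[OF i P]] radon_const[OF \<sigma>, of "M\<^sup>2"] by simp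
  qed
  have Q\<P>: "Q \<in> \<P>" using f by (auto simp: \<P>_def Q_def elim!: eventually_mono)
  \<comment> \<open>\<open>c P\<close> increases as the tail shrinks. Near its supremum
    \<open>S\<close>, elements of almost minimal norm are close to each other.\<close>
  define S where "S = (SUP P\<in>\<P>. c P)"
  have bddc: "bdd_above (c ` \<P>)" using cb by (intro bdd_aboveI) auto
  have cS: "c P \<le> S" if "P \<in> \<P>" for P unfolding S_def by (rule cSUP_upper[OF that bddc])
  have approx: "\<exists>\<phi>. continuous_on K \<phi> \<and> (\<forall>x\<in>N. \<bar>\<kappa> x \<phi> - h x\<bar> \<le> \<eta>)" if \<eta>: "\<eta> > 0" for \<eta>
  proof -
    have s1: "0 \<le> \<sigma> (\<lambda>z. 1)" by (rule radon_nonneg[OF \<sigma>]) auto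
    \<comment> \<open>\<open>a\<close> is the parameter of \<open>abs_le_average\<close> and
      \<open>\<delta>\<close> below is the tolerance for squared norms; they are chosen such that
      each contributes at most \<open>\<eta> / 2\<close> to the final error.\<close>
    define a where "a = \<eta> / (C * \<sigma> (\<lambda>z. 1) + 1)"
    have "0 \<le> C * \<sigma> (\<lambda>z. 1)" using s1 \<open>0 \<le> C\<close> by simp
    then have a: "0 < a" "C * (a / 2 * \<sigma> (\<lambda>z. 1)) \<le> \<eta> / 2" using \<eta>
      by (auto simp: a_def divide_simps)
    define \<delta> where "\<delta> = a * \<eta> / (8 * (C + 1))"
    have \<delta>: "0 < \<delta>" "C * (8 * \<delta> / (2 * a)) \<le> \<eta> / 2"
      using a(1) \<eta> \<open>0 \<le> C\<close> by (auto simp: \<delta>_def divide_simps)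
    obtain P where P: "P \<in> \<P>" "S - \<delta> < c P"
      using less_cSUP_iff[OF _ bddc, of "S - \<delta>"] Q\<P> \<delta>(1) unfolding S_def[symmetric] by auto
    have near: "\<exists>\<phi>\<in>tail_hull P'. \<sigma> (\<lambda>z. (\<phi> z)\<^sup>2) < S + \<delta>" if P': "P' \<in> \<P>" for P'
      using cInf_lessD[of "(\<lambda>\<phi>. \<sigma> (\<lambda>z. (\<phi> z)\<^sup>2)) ` tail_hull P'" "S + \<delta>"] ne[OF P'] cS[OF P'] \<delta>(1)
      by (auto simp: c_def)
    obtain \<phi> where \<phi>: "\<phi> \<in> tail_hull P" "\<sigma> (\<lambda>z. (\<phi> z)\<^sup>2) < S + \<delta>" using near[OF P(1)] by blast
    have "\<bar>\<kappa> x \<phi> - h x\<bar> \<le> \<eta>" if x: "x \<in> N" for x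
    proof (rule field_le_epsilon)
      fix e :: real assume e: "0 < e"
      \<comment> \<open>The smaller tail depends on \<open>x\<close>, but \<open>\<phi>\<close> was
        chosen before \<open>x\<close>; this makes the approximation uniform on
        \<open>N\<close>.\<close>
      define P' where "P' i \<longleftrightarrow> P i \<and> \<bar>\<kappa> x (f i) - h x\<bar> < e" for i
      have "eventually (\<lambda>i. \<bar>\<kappa> x (f i) - h x\<bar> < e) G"
        using tendstoD[OF lim[OF x] e] by (simp add: dist_real_def)
      moreover have "eventually P G" using P(1) by (simp add: \<P>_def)
      ultimately have "eventually P' G" by eventually_elim (simp add: P'_def)
      then have P': "P' \<in> \<P>" using P(1) by (auto simp: \<P>_def P'_def)
      obtain \<psi> where \<psi>: "\<psi> \<in> tail_hull P'" "\<sigma> (\<lambda>z. (\<psi> z)\<^sup>2) < S + \<delta>" using near[OF P'] by blast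
      have \<psi>P: "\<psi> \<in> tail_hull P" using \<psi>(1) mono[of P' P] by (auto simp: P'_def)
      have "\<forall>i. P' i \<longrightarrow> h x - e \<le> \<kappa> x (f i) \<and> \<kappa> x (f i) \<le> h x + e" by (auto simp: P'_def)
      then have \<psi>x: "h x - e \<le> \<kappa> x \<psi>" "\<kappa> x \<psi> \<le> h x + e" using \<psi>(1) x by (auto simp: tail_hull_def)
      note pc = hc[OF \<phi>(1)] hc[OF \<psi>(1)]
      \<comment> \<open>The midpoint lies in the larger hull, so its squared norm exceeds
        \<open>S - \<delta>\<close>. The parallelogram identity bounds the squared distance of
        \<open>\<phi>\<close> and \<open>\<psi>\<close> by \<open>2 (S + \<delta>) + 2 (S +
        \<delta>) - 4 (S - \<delta>) = 8 \<delta>\<close>.\<close>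
      define \<theta> where "\<theta> z = (1/2) * (\<phi> z + \<psi> z)" for z
      have \<theta>: "\<theta> \<in> tail_hull P"
        unfolding tail_hull_def mem_Collect_eq
      proof (intro conjI ballI allI impI)
        show "continuous_on K \<theta>" unfolding \<theta>_def by (intro continuous_intros pc)
        fix x a b assume x: "x \<in> N" and ab: "\<forall>i. P i \<longrightarrow> a \<le> \<kappa> x (f i) \<and> \<kappa> x (f i) \<le> b"
        have "\<kappa> x \<theta> = (1/2) * (\<kappa> x \<phi> + \<kappa> x \<psi>)"
          unfolding \<theta>_def radon_cmult[OF \<kappa>[OF x] continuous_on_add[OF pc]] radon_add[OF \<kappa>[OF x] pc] ..
        moreover have "a \<le> \<kappa> x \<phi> \<and> \<kappa> x \<phi> \<le> b" "a \<le> \<kappa> x \<psi> \<and> \<kappa> x \<psi> \<le> b"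
          using \<phi>(1) \<psi>P ab x unfolding tail_hull_def by blast+
        ultimately show "a \<le> \<kappa> x \<theta>" "\<kappa> x \<theta> \<le> b" by auto
      qed
      have dc: "continuous_on K (\<lambda>z. \<phi> z - \<psi> z)" by (intro continuous_intros pc)
      have "(\<phi> z - \<psi> z)\<^sup>2 = (2 * (\<phi> z)\<^sup>2 + 2 * (\<psi> z)\<^sup>2) - 4 * (\<theta> z)\<^sup>2" for z
        by (simp add: \<theta>_def power2_eq_square algebra_simps)
      then have "\<sigma> (\<lambda>z. (\<phi> z - \<psi> z)\<^sup>2) = \<sigma> (\<lambda>z. (2 * (\<phi> z)\<^sup>2 + 2 * (\<psi> z)\<^sup>2) - 4 * (\<theta> z)\<^sup>2)" by simp
      also have "\<dots> = 2 * \<sigma> (\<lambda>z. (\<phi> z)\<^sup>2) + 2 * \<sigma> (\<lambda>z. (\<psi> z)\<^sup>2) - 4 * \<sigma> (\<lambda>z. (\<theta> z)\<^sup>2)"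
        using sqc[OF \<phi>(1)] sqc[OF \<psi>(1)] sqc[OF \<theta>]
        by (simp add: radon_diff[OF \<sigma>] radon_add[OF \<sigma>] radon_cmult[OF \<sigma>] continuous_on_add continuous_on_mult)
      finally have par: "\<sigma> (\<lambda>z. (\<phi> z - \<psi> z)\<^sup>2) \<le> 8 * \<delta>"
        using \<phi>(2) \<psi>(2) cle[OF \<theta>] P(2) by simp
      have "\<bar>\<kappa> x \<phi> - \<kappa> x \<psi>\<bar> = \<bar>\<kappa> x (\<lambda>z. \<phi> z - \<psi> z)\<bar>" by (simp add: radon_diff[OF \<kappa>[OF x] pc])
      also have "\<dots> \<le> \<kappa> x (\<lambda>z. \<bar>\<phi> z - \<psi> z\<bar>)" by (rule radon_abs_le[OF \<kappa>[OF x] dc])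
      also have "\<dots> \<le> C * \<sigma> (\<lambda>z. \<bar>\<phi> z - \<psi> z\<bar>)" by (intro dom x continuous_intros pc) simp
      also have "\<sigma> (\<lambda>z. \<bar>\<phi> z - \<psi> z\<bar>) \<le> \<sigma> (\<lambda>z. (1 / (2 * a)) * (\<phi> z - \<psi> z)\<^sup>2 + a / 2)"
        using abs_le_average[OF a(1)] by (intro radon_mono[OF \<sigma>] continuous_intros pc) (simp add: add.commute)
      also have "\<dots> = (1 / (2 * a)) * \<sigma> (\<lambda>z. (\<phi> z - \<psi> z)\<^sup>2) + a / 2 * \<sigma> (\<lambda>z. 1)"
        unfolding radon_add_const(1)[OF \<sigma> continuous_on_mult_left[OF continuous_on_power[OF dc]]]
          radon_cmult[OF \<sigma> continuous_on_power[OF dc]] ..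
      also have "\<dots> \<le> (1 / (2 * a)) * (8 * \<delta>) + a / 2 * \<sigma> (\<lambda>z. 1)"
        using par a(1) by (intro add_right_mono mult_left_mono) auto
      finally have "\<bar>\<kappa> x \<phi> - \<kappa> x \<psi>\<bar> \<le> C * (8 * \<delta> / (2 * a)) + C * (a / 2 * \<sigma> (\<lambda>z. 1))"
        using \<open>0 \<le> C\<close> by (simp add: mult_left_mono distrib_left)
      then show "\<bar>\<kappa> x \<phi> - h x\<bar> \<le> \<eta> + e" using a(2) \<delta>(2) \<psi>x by linarith
    qed
    then show ?thesis using hc[OF \<phi>(1)] by blast
  qed
  have "\<exists>\<phi>. continuous_on K \<phi> \<and> (\<forall>x\<in>N. \<bar>\<kappa> x \<phi> - h x\<bar> \<le> inverse (Suc n))" for n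
    by (rule approx) simp
  then obtain \<phi> where \<phi>: "\<And>n. continuous_on K (\<phi> n)"
     "\<And>n x. x \<in> N \<Longrightarrow> \<bar>\<kappa> x (\<phi> n) - h x\<bar> \<le> inverse (real (Suc n))"
    by metis
  show ?thesis
  proof (rule uniform_limit_theorem)
    show "\<forall>\<^sub>F n in sequentially. continuous_on N (\<lambda>x. \<kappa> x (\<phi> n))" by (simp add: cont \<phi>(1))
    show "uniform_limit N (\<lambda>n x. \<kappa> x (\<phi> n)) h sequentially"
    proof (rule uniform_limitI)
      fix e :: real assume "0 < e"
      then have "\<forall>\<^sub>F n in sequentially. inverse (real (Suc n)) < e"
        using order_tendstoD(2)[OF LIMSEQ_inverse_real_of_nat] by blast
      then show "\<forall>\<^sub>F n in sequentially. \<forall>x\<in>N. dist (\<kappa> x (\<phi> n)) (h x) < e"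
        by eventually_elim (use \<phi>(2) in \<open>auto simp: dist_real_def intro: order_le_less_trans\<close>)
    qed
  qed simp
qed

text \<open>Domination of every \<open>\<kappa> x\<close> by the same multiple of
  \<open>\<sigma>\<close> turns dominated convergence for \<open>\<sigma>\<close> into convergence
  uniform in \<open>x\<close>.\<close>

lemma kernel_uniform_limit:
  fixes \<kappa> :: "'a::topological_space \<Rightarrow> ('a \<Rightarrow> real) \<Rightarrow> real"
  assumes "compact K" and \<sigma>: "radon_measure K \<sigma>" and \<kappa>: "\<And>x. x \<in> N \<Longrightarrow> radon_measure K (\<kappa> x)"
    and dom: "\<And>x g. x \<in> N \<Longrightarrow> continuous_on K g \<Longrightarrow> (\<And>z. z \<in> K \<Longrightarrow> 0 \<le> g z) \<Longrightarrow> \<kappa> x g \<le> C * \<sigma> g"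
    and f: "\<forall>\<^sub>F n in sequentially. continuous_on K (f n) \<and> (\<forall>z\<in>K. \<bar>f n z\<bar> \<le> M)"
    and g: "continuous_on K g"
    and lim: "\<And>z. z \<in> K \<Longrightarrow> (\<lambda>n. f n z) \<longlonglongrightarrow> g z"
  shows "uniform_limit N (\<lambda>n x. \<kappa> x (f n)) (\<lambda>x. \<kappa> x g) sequentially"
proof -
  obtain n0 where n0: "\<And>n. n \<ge> n0 \<Longrightarrow> continuous_on K (f n) \<and> (\<forall>z\<in>K. \<bar>f n z\<bar> \<le> M)"
    using f by (auto simp: eventually_sequentially)
  \<comment> \<open>The bound on \<open>f n\<close> holds from \<open>n0\<close> on; shifting the
    index makes it hold throughout, as dominated convergence requires.\<close>
  define d where "d n z = \<bar>f (n + n0) z - g z\<bar>" for n z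
  have gM: "\<bar>g z\<bar> \<le> M" if "z \<in> K" for z
    by (rule tendsto_upperbound[OF tendsto_rabs[OF lim[OF that]]])
       (use n0 that in \<open>auto simp: eventually_sequentially\<close>)
  have dc: "continuous_on K (d n)" for n
    unfolding d_def using n0[of "n + n0"] g by (intro continuous_intros) auto
  have "(\<lambda>n. \<sigma> (d n)) \<longlonglongrightarrow> 0"
  proof (rule radon_dominated_convergence_zero[OF \<open>compact K\<close> \<sigma> dc])
    fix n z assume z: "z \<in> K"
    then have "\<bar>f (n + n0) z\<bar> \<le> M" using n0[of "n + n0"] by simp
    then show "0 \<le> d n z \<and> d n z \<le> 2 * M" using gM[OF z] by (auto simp: d_def)
  next
    fix z assume z: "z \<in> K"
    have "(\<lambda>n. f (n + n0) z - g z) \<longlonglongrightarrow> g z - g z"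
      by (rule tendsto_diff[OF LIMSEQ_ignore_initial_segment[OF lim[OF z], of n0] tendsto_const])
    then show "(\<lambda>n. d n z) \<longlonglongrightarrow> 0" unfolding d_def tendsto_rabs_zero_iff by simp
  qed
  then have lim0: "(\<lambda>n. C * \<sigma> (d n)) \<longlonglongrightarrow> 0" by (simp add: tendsto_mult_right_zero)
  show ?thesis
  proof (rule uniform_limitI)
    fix e :: real assume "0 < e"
    then obtain n1 where n1: "\<And>n. n \<ge> n1 \<Longrightarrow> C * \<sigma> (d n) < e"
      using order_tendstoD(2)[OF lim0] by (auto simp: eventually_sequentially)
    have "dist (\<kappa> x (f n)) (\<kappa> x g) < e" if x: "x \<in> N" and n: "n \<ge> n0 + n1" for x n
    proof -
      have fc: "continuous_on K (f n)" using n0[of n] n by simp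
      have "dist (\<kappa> x (f n)) (\<kappa> x g) = \<bar>\<kappa> x (\<lambda>z. f n z - g z)\<bar>"
        by (simp add: dist_real_def radon_diff[OF \<kappa>[OF x] fc g])
      also have "\<dots> \<le> \<kappa> x (d (n - n0))"
        using radon_abs_le[OF \<kappa>[OF x], of "\<lambda>z. f n z - g z"] fc g n
        by (simp add: d_def[abs_def] continuous_on_diff)
      also have "\<dots> \<le> C * \<sigma> (d (n - n0))" by (intro dom x dc) (simp add: d_def)
      also have "\<dots> < e" using n by (intro n1) simp
      finally show ?thesis .
    qed
    then show "\<forall>\<^sub>F n in sequentially. \<forall>x\<in>N. dist (\<kappa> x (f n)) (\<kappa> x g) < e"
      by (auto simp: eventually_sequentially intro!: exI[of _ "n0 + n1"])
  qed
qed

locale brelot =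
  fixes F :: "'a::t2_space set \<Rightarrow> ('a \<Rightarrow> real) set"
  assumes brelot: "brelot_space F"
begin

lemma locally_compact: "locally compact (UNIV :: 'a set)" and not_compact: "\<not> compact (UNIV :: 'a set)"
  and connected_space: "connected (UNIV :: 'a set)" and locally_connected_space: "locally connected (UNIV :: 'a set)"
  and harmonic_functions: "harmonic_functions F" and sheaf: "is_sheaf F"
  and base: "topological_basis {R. regular F R \<and> connected R}"
  using brelot by (simp_all add: brelot_space_def)

lemma harmonic_continuous: "open U \<Longrightarrow> h \<in> F U \<Longrightarrow> continuous_on U h"
  and harmonic_add: "open U \<Longrightarrow> h \<in> F U \<Longrightarrow> k \<in> F U \<Longrightarrow> (\<lambda>x. h x + k x) \<in> F U"
  and harmonic_cmult: "open U \<Longrightarrow> h \<in> F U \<Longrightarrow> (\<lambda>x. c * h x) \<in> F U"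
  and harmonic_zero: "open U \<Longrightarrow> (\<lambda>x. 0) \<in> F U"
  and harmonic_cong: "open U \<Longrightarrow> h \<in> F U \<Longrightarrow> (\<And>x. x \<in> U \<Longrightarrow> k x = h x) \<Longrightarrow> k \<in> F U"
  using harmonic_functions unfolding harmonic_functions_def by meson+

lemma harmonic_diff: "open U \<Longrightarrow> h \<in> F U \<Longrightarrow> k \<in> F U \<Longrightarrow> (\<lambda>x. h x - k x) \<in> F U"
  using harmonic_add[of U h "\<lambda>x. (-1) * k x"] harmonic_cmult[of U k "-1"] by simp

lemma harmonic_restrict: "open U \<Longrightarrow> open V \<Longrightarrow> V \<subseteq> U \<Longrightarrow> h \<in> F U \<Longrightarrow> h \<in> F V"
  using sheaf_restrict[OF sheaf] .

lemma directed_sup: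
  assumes "open U" "connected U" "G \<noteq> {}" "G \<subseteq> F U"
    and "\<And>f g. f \<in> G \<Longrightarrow> g \<in> G \<Longrightarrow> \<exists>h\<in>G. \<forall>x\<in>U. f x \<le> h x \<and> g x \<le> h x"
  shows "(\<forall>x\<in>U. (SUP g\<in>G. ereal (g x)) = \<infinity>) \<or>
        (\<exists>h\<in>F U. \<forall>x\<in>U. (SUP g\<in>G. ereal (g x)) = ereal (h x))"
proof -
  have "\<forall>U G. open U \<and> connected U \<and> G \<noteq> {} \<and> G \<subseteq> F U \<and>
        (\<forall>f\<in>G. \<forall>g\<in>G. \<exists>h\<in>G. \<forall>x\<in>U. f x \<le> h x \<and> g x \<le> h x) \<longrightarrow>
        (\<forall>x\<in>U. (SUP g\<in>G. ereal (g x)) = \<infinity>) \<or>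
        (\<exists>h\<in>F U. \<forall>x\<in>U. (SUP g\<in>G. ereal (g x)) = ereal (h x))"
    using brelot unfolding brelot_space_def by (elim conjE)
  from this[THEN spec[of _ U], THEN spec[of _ G]] show ?thesis using assms by simp
qed

text \<open>Finiteness at a single point excludes the infinite alternative of the convergence axiom
  on the whole domain.\<close>

lemma increasing_sequence_finite:
  assumes U: "open U" "connected U" and s: "\<And>n. s n \<in> F U" "\<And>n x. x \<in> U \<Longrightarrow> s n x \<le> s (Suc n) x"
    and x0: "x0 \<in> U" "\<And>n. s n x0 \<le> c"
  shows "\<exists>h\<in>F U. \<forall>x\<in>U. (\<lambda>n. s n x) \<longlonglongrightarrow> h x \<and> (\<forall>n. s n x \<le> h x)"
proof -
  have inc: "s m x \<le> s n x" if "m \<le> n" "x \<in> U" for m n x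
    using lift_Suc_mono_le[of "\<lambda>n. s n x" m n] s(2) that by blast
  have "(\<forall>x\<in>U. (SUP g\<in>range s. ereal (g x)) = \<infinity>) \<or>
        (\<exists>h\<in>F U. \<forall>x\<in>U. (SUP g\<in>range s. ereal (g x)) = ereal (h x))"
  proof (rule directed_sup[OF U])
    fix f g assume "f \<in> range s" "g \<in> range s"
    then obtain m n where mn: "f = s m" "g = s n" by blast
    show "\<exists>h\<in>range s. \<forall>x\<in>U. f x \<le> h x \<and> g x \<le> h x"
      using inc by (intro bexI[of _ "s (max m n)"]) (auto simp: mn)
  qed (use s in auto)
  moreover have "(SUP g\<in>range s. ereal (g x0)) \<le> ereal c" using x0 by (intro SUP_least) auto
  ultimately obtain h where h: "h \<in> F U" "\<And>x. x \<in> U \<Longrightarrow> (SUP n. ereal (s n x)) = ereal (h x)"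
    using x0(1) by (force simp: image_image)
  have "(\<lambda>n. s n x) \<longlonglongrightarrow> h x \<and> (\<forall>n. s n x \<le> h x)" if x: "x \<in> U" for x
  proof -
    have "incseq (\<lambda>n. ereal (s n x))" using s(2) x by (auto intro!: incseq_SucI)
    from LIMSEQ_SUP[OF this] have "(\<lambda>n. ereal (s n x)) \<longlonglongrightarrow> ereal (h x)" using h(2)[OF x] by simp
    moreover have "ereal (s n x) \<le> ereal (h x)" for n
      unfolding h(2)[OF x, symmetric] by (rule SUP_upper) simp
    ultimately show ?thesis by simp
  qed
  with h(1) show ?thesis by blast
qed

text \<open>The multiples \<open>n * h\<close> increase and stay 0 at \<open>x0\<close>, so their
  limit is finite at every point of the domain, which a positive value of \<open>h\<close> would
  contradict.\<close>

lemma zero_principle: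
  assumes U: "open U" "connected U" and h: "h \<in> F U" "\<And>x. x \<in> U \<Longrightarrow> 0 \<le> h x"
    and x0: "x0 \<in> U" "h x0 = 0" and x: "x \<in> U"
  shows "h x = 0"
proof (rule ccontr)
  assume "h x \<noteq> 0"
  then have pos: "0 < h x" using h(2)[OF x] by simp
  obtain k where k: "\<forall>x\<in>U. (\<lambda>n. real n * h x) \<longlonglongrightarrow> k x \<and> (\<forall>n. real n * h x \<le> k x)"
    using increasing_sequence_finite[OF U, of "\<lambda>n x. real n * h x" x0 0] x0 h harmonic_cmult[OF U(1) h(1)]
    by (auto simp: distrib_right)
  then have "real n * h x \<le> k x" for n using x by blast
  moreover obtain n where "k x < real n * h x" using reals_Archimedean3[OF pos] by blast
  ultimately show False by (simp add: not_le[symmetric])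
qed

text \<open>If no constant worked, functions violating the bound \<open>2 ^ n\<close> could be
  normalized and summed. The sum is harmonic because it converges at \<open>x0\<close>; by Dini's
  theorem it converges uniformly on \<open>K\<close>, although every summand exceeds 1 somewhere on
  \<open>K\<close>.\<close>

lemma harnack:
  assumes U: "open U" "connected U" and x0: "x0 \<in> U" and K: "compact K" "K \<subseteq> U"
  shows "\<exists>C\<ge>0. \<forall>h\<in>F U. (\<forall>x\<in>U. 0 \<le> h x) \<longrightarrow> (\<forall>x\<in>K. h x \<le> C * h x0)"
proof (rule ccontr)
  assume "\<not> ?thesis"
  then have "\<exists>h. h \<in> F U \<and> (\<forall>x\<in>U. 0 \<le> h x) \<and> (\<exists>x\<in>K. h x > 2 ^ n * h x0)" for n :: nat
    by (meson zero_le_numeral zero_le_power not_le)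
  then obtain h x where h: "\<And>n. h n \<in> F U" "\<And>n z. z \<in> U \<Longrightarrow> 0 \<le> h n z"
    and x: "\<And>n. x n \<in> K" "\<And>n. h n (x n) > 2 ^ n * h n x0"
    by metis
  \<comment> \<open>A zero at \<open>x0\<close> would entail a zero at \<open>x n\<close>, against
    the strict inequality there.\<close>
  have pos: "0 < h n x0" for n
  proof -
    have "h n x0 \<noteq> 0"
    proof
      assume "h n x0 = 0"
      then have "h n (x n) = 0" using zero_principle[OF U h(1) h(2) x0] x(1) K(2) by blast
      then show False using x(2)[of n] \<open>h n x0 = 0\<close> by simp
    qed
    then show ?thesis using h(2)[OF x0, of n] by simp
  qed
  \<comment> \<open>Scaled to the value \<open>(1/2) ^ n\<close> at \<open>x0\<close>, which makes
    the series converge there, while the value at \<open>x n\<close> is still above 1.\<close>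
  define g where "g n z = (1 / (2 ^ n * h n x0)) * h n z" for n z
  have gF: "g n \<in> F U" for n unfolding g_def by (rule harmonic_cmult[OF U(1) h(1)])
  have g: "g n x0 = (1/2) ^ n" "z \<in> U \<Longrightarrow> 0 \<le> g n z" "1 < g n (x n)" for n z
    using pos[of n] x(2)[of n] h(2)[of z n] unfolding g_def
    by (auto simp: power_one_over field_simps)
  define s where "s n z = (\<Sum>i<n. g i z)" for n z
  have s: "s n \<in> F U" for n
    unfolding s_def by (induction n) (auto intro: harmonic_zero harmonic_add U gF)
  have "s n x0 \<le> 2" for n
  proof -
    have "(\<Sum>j<n. (1/2::real) ^ j) = 2 - 2 * (1/2) ^ n" by (induction n) auto
    then show ?thesis by (simp add: s_def g(1))
  qed
  then obtain S where S: "S \<in> F U" "\<forall>z\<in>U. (\<lambda>n. s n z) \<longlonglongrightarrow> S z \<and> (\<forall>n. s n z \<le> S z)"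
    using increasing_sequence_finite[OF U, of s x0 2] s x0 g(2) by (auto simp: s_def)
  have "\<exists>N. \<forall>n\<ge>N. \<forall>z\<in>K. S z - s n z < 1"
  proof (rule dini[OF K(1)])
    show "continuous_on K (\<lambda>z. S z - s n z)" for n
      using harmonic_continuous[OF U(1)] S(1) s K(2) by (intro continuous_intros) (auto intro: continuous_on_subset)
    show "S z - s (Suc n) z \<le> S z - s n z" if "z \<in> K" for n z
      using g(2) K(2) that by (auto simp: s_def)
    show "(\<lambda>n. S z - s n z) \<longlonglongrightarrow> 0" if "z \<in> K" for z
      using tendsto_diff[OF tendsto_const[of "S z"], of "\<lambda>n. s n z" "S z"] S(2) K(2) that by auto
  qed simp
  then obtain N where N: "\<And>z. z \<in> K \<Longrightarrow> S z - s N z < 1" by blast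
  have "s (Suc N) (x N) \<le> S (x N)" using S(2) x(1) K(2) by blast
  then have "g N (x N) < 1" using N[OF x(1)[of N]] by (simp add: s_def)
  then show False using g(3)[of N] by simp
qed

lemma kernel_harmonic:
  assumes "dirichlet_kernel F R \<kappa>" "continuous_on (frontier R) f" "open U" "U \<subseteq> R"
  shows "(\<lambda>x. \<kappa> x f) \<in> F U"
  using assms harmonic_restrict[OF _ assms(3,4)] unfolding dirichlet_kernel_def by blast

lemma kernel_nonneg:
  assumes "dirichlet_kernel F R \<kappa>" "x \<in> R" "continuous_on (frontier R) f" "\<And>z. z \<in> frontier R \<Longrightarrow> 0 \<le> f z"
  shows "0 \<le> \<kappa> x f"
  using assms radon_nonneg[of "frontier R" "\<kappa> x" f] by (auto simp: dirichlet_kernel_def)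

lemma compact_frontier: "compact (closure R) \<Longrightarrow> compact (frontier (R :: 'a set))"
  unfolding frontier_closures by (rule compact_Int_closed) simp_all

lemma frontier_nonempty:
  fixes U :: "'a set"
  assumes "U \<noteq> {}" "U \<noteq> UNIV"
  shows "frontier U \<noteq> {}"
  using connected_Int_frontier[OF connected_space, of U] assms by auto

text \<open>A relatively compact set cannot be dense in a noncompact space, and connectedness then
  yields a boundary point, at which the contradictions below are derived.\<close>

lemma frontier_nonempty_compact: "U \<noteq> {} \<Longrightarrow> compact (closure U) \<Longrightarrow> frontier (U :: 'a set) \<noteq> {}"
  using frontier_nonempty[of U] not_compact by (cases "U = UNIV") auto

text \<open>If \<open>s\<close> had a negative minimum, attained on the compact set \<open>A\<close>, take a component \<open>C\<close> of the
  complement of \<open>A\<close> and a boundary point \<open>x\<close> of \<open>C\<close>. For a small solvable neighbourhood \<open>R\<close> of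
  \<open>x\<close>, the connected set \<open>C\<close> meets the boundary of the component of \<open>R\<close> that contains \<open>x\<close>, whereas
  the mean value inequality at \<open>x\<close> forces this boundary to lie in \<open>A\<close>.\<close>

lemma minimum_principle:
  assumes W: "open W" "compact (closure W)" and s: "lsc_on W s" "\<And>x. x \<in> W \<Longrightarrow> s x \<noteq> - \<infinity>"
    and mean: "\<And>x N. x \<in> W \<Longrightarrow> open N \<Longrightarrow> x \<in> N \<Longrightarrow> \<exists>R \<kappa>. dirichlet_kernel F R \<kappa> \<and> x \<in> R \<and>
       R \<subseteq> N \<and> closure R \<subseteq> W \<and> \<kappa> x (\<lambda>z. 1) \<le> 1 \<and> upper_integral (frontier R) (\<kappa> x) s \<le> s x"
    and bdry: "\<And>z t. z \<in> frontier W \<Longrightarrow> t < 0 \<Longrightarrow> \<forall>\<^sub>F x in at z within W. ereal t < s x"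
    and "x1 \<in> W"
  shows "0 \<le> s x1"
proof (rule ccontr)
  assume "\<not> ?thesis"
  then have "s x1 < 0" by simp
  \<comment> \<open>The boundary condition keeps sublevel sets of negative levels away from the
    boundary of \<open>W\<close>; they are therefore closed in the whole space and, lying in
    \<open>closure W\<close>, compact.\<close>
  have cl: "closed {x \<in> W. s x \<le> ereal t}" if "t < 0" for t
  proof -
    have "open (- {x \<in> W. s x \<le> ereal t})"
    proof (subst open_subopen, intro ballI)
      fix z assume z: "z \<in> - {x \<in> W. s x \<le> ereal t}"
      have "eventually (\<lambda>x. x \<in> - {x \<in> W. s x \<le> ereal t}) (nhds z)"
      proof (cases "z \<in> W")
        case True
        then have "eventually (\<lambda>x. x \<in> W \<longrightarrow> ereal t < s x) (nhds z)" using z by (intro lsc_onD[OF s(1)]) auto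
        then show ?thesis by eventually_elim auto
      next
        case nW: False
        show ?thesis
        proof (cases "z \<in> closure W")
          case True
          then have "z \<in> frontier W" using nW W(1) by (simp add: frontier_def interior_open)
          from bdry[OF this that] have "\<forall>\<^sub>F x in nhds z. x \<noteq> z \<longrightarrow> x \<in> W \<longrightarrow> ereal t < s x"
            by (simp add: eventually_at_filter)
          then show ?thesis by eventually_elim (use nW in auto)
        next
          case False
          then have "eventually (\<lambda>x. x \<in> - closure W) (nhds z)"
            by (intro eventually_nhds_in_open) auto
          then show ?thesis by eventually_elim (use closure_subset[of W] in auto)
        qed
      qed
      then show "\<exists>T. open T \<and> z \<in> T \<and> T \<subseteq> - {x \<in> W. s x \<le> ereal t}"
        unfolding eventually_nhds by blast
    qed
    then show ?thesis by (simp add: closed_def)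
  qed
  obtain t where t: "s x1 = ereal t" "t < 0"
    using \<open>s x1 < 0\<close> s(2)[OF \<open>x1 \<in> W\<close>] by (cases "s x1") auto
  define L where "L = {x \<in> W. s x \<le> ereal t}"
  have "compact L"
    using compact_Int_closed[OF W(2) cl[OF t(2)]] closure_subset[of W]
    unfolding L_def by (simp add: inf_absorb2 subset_iff)
  have "x1 \<in> L" using t \<open>x1 \<in> W\<close> by (simp add: L_def)
  \<comment> \<open>Without a minimum the open sets \<open>{z \<in> W. s x < s z}\<close> with
    \<open>x \<in> L\<close> would cover \<open>L\<close>; the smallest of finitely many values
    \<open>s x\<close> then contradicts the finite subcover.\<close>
  have "\<exists>x\<in>L. \<forall>x'\<in>L. s x \<le> s x'"
  proof (rule ccontr)
    assume no: "\<not> ?thesis"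
    have op: "open {z \<in> W. s x < s z}" for x
      using s(1) W(1) unfolding lsc_on_def by (metis openin_open_trans)
    have cov: "L \<subseteq> (\<Union>x\<in>L. {z \<in> W. s x < s z})"
    proof
      fix z assume z: "z \<in> L"
      then obtain x where "x \<in> L" "s x < s z" using no by (auto simp: not_le)
      then show "z \<in> (\<Union>x\<in>L. {z \<in> W. s x < s z})" using z by (auto simp: L_def)
    qed
    obtain D where D: "D \<subseteq> L" "finite D" "L \<subseteq> (\<Union>x\<in>D. {z \<in> W. s x < s z})"
      using compactE_image[OF \<open>compact L\<close> op cov] by blast
    then have "D \<noteq> {}" using \<open>x1 \<in> L\<close> by auto
    then obtain d where d: "d \<in> D" "\<And>x. x \<in> D \<Longrightarrow> s d \<le> s x"
      using D(2) by (metis arg_min_if_finite(1) arg_min_least)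
    then show False using D by force
  qed
  then obtain x2 where x2: "x2 \<in> L" "\<And>x. x \<in> L \<Longrightarrow> s x2 \<le> s x" by blast
  have x2W: "x2 \<in> W" "s x2 \<le> ereal t" using x2(1) by (auto simp: L_def)
  obtain m where m: "s x2 = ereal (- m)" "0 < m"
  proof (cases "s x2")
    case (real r)
    then show ?thesis using that[of "- r"] x2W t(2) by simp
  qed (use x2W s(2) in auto)
  have min: "ereal (- m) \<le> s x" if "x \<in> W" for x
  proof (cases "x \<in> L")
    case True then show ?thesis using x2(2) m by simp
  next
    case False
    then have "ereal t < s x" using that by (auto simp: L_def)
    then show ?thesis using x2W(2) m by (metis order_less_imp_le order_trans)
  qed
  define A where "A = {x \<in> W. s x \<le> ereal (- m)}"
  have A: "closed A" "x2 \<in> A" "A \<subseteq> W" using cl[of "- m"] m x2W by (auto simp: A_def)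
  have "A \<noteq> UNIV"
  proof
    assume "A = UNIV"
    then have "closure W = UNIV" using A(3) closure_subset[of W] by auto
    then show False using W(2) not_compact by simp
  qed
  then obtain c where c: "c \<notin> A" by auto
  define C where "C = connected_component_set (- A) c"
  have C: "open C" "connected C" "c \<in> C" "C \<subseteq> - A" "frontier C \<subseteq> frontier (- A)"
    using component_facts[OF locally_connected_space, of "- A" c] A(1) c by (auto simp: C_def)
  have "x2 \<notin> C" using C(4) A(2) by auto
  then obtain x where x: "x \<in> frontier C" using frontier_nonempty[of C] C(3) by blast
  have xA: "x \<in> A"
    using C(5) x A(1) by (auto simp: frontier_def interior_open open_Compl)
  \<comment> \<open>\<open>R\<close> omits \<open>c\<close>, so the connected set \<open>C\<close>
    is not contained in a component of \<open>R\<close> and has to cross its boundary.\<close>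
  obtain R \<kappa> where R: "dirichlet_kernel F R \<kappa>" "x \<in> R" "R \<subseteq> - {c}" "closure R \<subseteq> W"
      "\<kappa> x (\<lambda>z. 1) \<le> 1" "upper_integral (frontier R) (\<kappa> x) s \<le> s x"
    using mean[of x "- {c}"] xA A(3) c by auto
  have Ro: "open R" "compact (frontier R)" and rad: "radon_measure (frontier R) (\<kappa> x)"
    using R(1,2) compact_frontier by (auto simp: dirichlet_kernel_def)
  define U where "U = connected_component_set R x"
  have U: "open U" "connected U" "x \<in> U" "U \<subseteq> R" "frontier U \<subseteq> frontier R"
    using component_facts[OF locally_connected_space Ro(1) R(2)] by (auto simp: U_def)
  have "C \<inter> U \<noteq> {}"
    using x U(1,3) open_Int_closure_eq_empty[OF U(1), of C] by (auto simp: frontier_def)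
  moreover have "c \<in> C - U" using C(3) U(4) R(3) by auto
  ultimately obtain z where z: "z \<in> C" "z \<in> frontier U"
    using connected_Int_frontier[OF C(2), of U] by blast
  have zR: "z \<in> frontier R" using z U(5) by auto
  have fW: "frontier R \<subseteq> W" using R(4) by (auto simp: frontier_def)
  have zpos: "0 < s z + ereal m"
  proof -
    have "ereal (- m) < s z" using z C(4) zR fW by (auto simp: A_def not_le)
    then show ?thesis by (cases "s z") auto
  qed
  \<comment> \<open>Adding \<open>m\<close> makes \<open>s\<close> nonnegative, as
    \<open>lsc_bump\<close> requires, and positive at \<open>z\<close>, which lies in
    \<open>C\<close> and so outside \<open>A\<close>.\<close>
  have "lsc_on (frontier R) (\<lambda>x. s x + ereal m)"
    unfolding lsc_on_def
  proof
    fix a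
    have "(a < s x + ereal m) = (a - ereal m < s x)" for x
      by (cases a; cases "s x") auto
    then show "openin (top_of_set (frontier R)) {x \<in> frontier R. a < s x + ereal m}"
      using lsc_on_subset[OF s(1) fW] by (simp add: lsc_on_def)
  qed
  moreover have "0 \<le> s y + ereal m" if "y \<in> frontier R" for y
    using min[of y] fW that by (cases "s y") auto
  moreover obtain e where e: "0 < e" "ereal e < s z + ereal m"
    using zpos by (metis ereal_dense2 less_ereal.simps(1) zero_ereal_def)
  ultimately obtain f where f: "continuous_on (frontier R) f"
      "\<And>y. y \<in> frontier R \<Longrightarrow> 0 \<le> f y \<and> ereal (f y) \<le> s y + ereal m" "f z = e"
    using lsc_bump[OF Ro(2), of "\<lambda>x. s x + ereal m" z e] zR by (metis less_imp_le)
  have "ereal (\<kappa> x (\<lambda>y. f y - m)) \<le> upper_integral (frontier R) (\<kappa> x) s"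
  proof (rule upper_integralI)
    show "continuous_on (frontier R) (\<lambda>y. f y - m)" by (intro continuous_intros f)
    show "ereal (f y - m) \<le> s y" if "y \<in> frontier R" for y
      using f(2)[OF that] by (cases "s y") auto
  qed
  also have "\<dots> \<le> ereal (- m)" using R(6) xA unfolding A_def by (metis (mono_tags, lifting) mem_Collect_eq order_trans)
  finally have "\<kappa> x f \<le> m * (\<kappa> x (\<lambda>z. 1) - 1)"
    using radon_add_const(2)[OF rad f(1), of m] by (simp add: algebra_simps)
  \<comment> \<open>Total mass at most 1 and \<open>m > 0\<close> decide the sign.\<close>
  also have "\<dots> \<le> 0" using R(5) m(2) by (simp add: mult_le_0_iff)
  finally have "\<kappa> x f \<le> 0" .
  moreover have kn: "0 \<le> \<kappa> y f" if "y \<in> R" for y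
    by (rule kernel_nonneg[OF R(1) that f(1)]) (use f(2) in blast)
  ultimately have zero: "\<kappa> x f = 0" using R(2) by (intro order_antisym)
  have hF: "(\<lambda>y. \<kappa> y f) \<in> F U"
    by (rule kernel_harmonic[OF R(1) f(1) U(1,4)])
  have "\<kappa> y f = 0" if "y \<in> U" for y
    by (rule zero_principle[OF U(1,2) hF _ U(3) zero that]) (use kn U(4) in blast)
  then have "((\<lambda>y. \<kappa> y f) \<longlongrightarrow> 0) (at z within U)"
    by (intro tendsto_eventually) (auto simp: eventually_at_filter)
  moreover have "((\<lambda>y. \<kappa> y f) \<longlongrightarrow> f z) (at z within U)"
    using R(1) f(1) by (intro boundary_subset_tendsto[OF _ U(4) zR]) (simp add: dirichlet_kernel_def)
  ultimately have "f z = 0" using tendsto_unique[OF frontier_nontrivial[OF U(1) z(2)]] by blast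
  then show False using f(3) e(1) by simp
qed

text \<open>For fixed \<open>g\<close> the function \<open>x \<mapsto> \<kappa> x g\<close> is
  nonnegative and harmonic, and the constant of Harnack's inequality does not depend on
  \<open>g\<close>. This is the domination required by \<open>weak_limit_continuous\<close> and
  \<open>kernel_uniform_limit\<close>.\<close>

lemma kernel_harnack:
  assumes D: "dirichlet_kernel F R \<kappa>" and x0: "x0 \<in> R"
  shows "\<exists>N C. open N \<and> x0 \<in> N \<and> N \<subseteq> R \<and> 0 \<le> C \<and>
    (\<forall>x\<in>N. \<forall>g. continuous_on (frontier R) g \<and> (\<forall>z\<in>frontier R. 0 \<le> g z) \<longrightarrow> \<kappa> x g \<le> C * \<kappa> x0 g)"
proof -
  have R: "open R" using D by (simp add: dirichlet_kernel_def)
  define U where "U = connected_component_set R x0"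
  have U: "open U" "connected U" "x0 \<in> U" "U \<subseteq> R"
    using component_facts[OF locally_connected_space R x0] by (auto simp: U_def)
  obtain N where N: "open N" "x0 \<in> N" "compact (closure N)" "closure N \<subseteq> U"
    using locally_compact_nhd[OF locally_compact U(1,3)] by blast
  obtain C where C: "C \<ge> 0" "\<And>h x. h \<in> F U \<Longrightarrow> (\<forall>x\<in>U. 0 \<le> h x) \<Longrightarrow> x \<in> closure N \<Longrightarrow> h x \<le> C * h x0"
    using harnack[OF U(1,2,3) N(3,4)] by blast
  have "\<kappa> x g \<le> C * \<kappa> x0 g" if "x \<in> N" "continuous_on (frontier R) g" "\<forall>z\<in>frontier R. 0 \<le> g z" for x g
  proof (rule C(2))
    show "(\<lambda>x. \<kappa> x g) \<in> F U"
      by (rule kernel_harmonic[OF D that(2) U(1,4)])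
    show "\<forall>x\<in>U. 0 \<le> \<kappa> x g" using kernel_nonneg[OF D _ that(2)] that(3) U(4) by blast
    show "x \<in> closure N" using that closure_subset by blast
  qed
  then show ?thesis using N C(1) U(4) closure_subset[of N] by (intro exI[of _ N] exI[of _ C]) blast
qed

lemma kernel_continuous:
  assumes "dirichlet_kernel F R \<kappa>" "continuous_on (frontier R) f"
  shows "continuous_on R (\<lambda>x. \<kappa> x f)"
  using assms harmonic_continuous[of R] by (simp add: dirichlet_kernel_def)

text \<open>Constants need not be harmonic; the substitute is the solution for the boundary function
  1 on a regular domain. It tends to 1 at a boundary point, so it does not vanish identically, and
  \<open>zero_principle\<close> makes it positive everywhere.\<close>

lemma positive_harmonic_exists:
  "\<exists>\<delta> h. open \<delta> \<and> connected \<delta> \<and> x0 \<in> \<delta> \<and> h \<in> F \<delta> \<and> (\<forall>x\<in>\<delta>. 0 < h x)"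
proof -
  obtain \<delta> where \<delta>: "regular F \<delta>" "connected \<delta>" "x0 \<in> \<delta>"
    by (rule topological_basisE[OF base open_UNIV UNIV_I[of x0]]) blast
  have o: "open \<delta>" "compact (closure \<delta>)" using \<delta>(1) by (auto simp: regular_def)
  obtain h where h: "h \<in> F \<delta>" "has_boundary_values \<delta> h (\<lambda>x. 1)" "\<And>x. x \<in> \<delta> \<Longrightarrow> 0 \<le> h x"
  proof -
    have "continuous_on (frontier \<delta>) (\<lambda>x. 1 :: real)" by simp
    then have "(\<exists>u\<in>F \<delta>. has_boundary_values \<delta> u (\<lambda>x. 1)) \<and>
        (\<forall>u\<in>F \<delta>. has_boundary_values \<delta> u (\<lambda>x. 1) \<longrightarrow> (\<forall>x\<in>\<delta>. 0 \<le> u x))"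
      using \<delta>(1)[unfolded regular_def, THEN conjunct2, THEN conjunct2, THEN spec[of _ "\<lambda>x. 1"]] by simp
    then show ?thesis using that by blast
  qed
  obtain z where z: "z \<in> frontier \<delta>" using frontier_nonempty_compact[OF _ o(2)] \<delta>(3) by blast
  have "\<forall>\<^sub>F x in at z within \<delta>. 0 < h x"
    using h(2) z order_tendstoD(1)[of h 1 "at z within \<delta>" 0] by (simp add: has_boundary_values_def)
  then have "\<forall>\<^sub>F x in at z within \<delta>. 0 < h x \<and> x \<in> \<delta>" by (simp add: eventually_at_filter)
  then obtain x1 where x1: "0 < h x1" "x1 \<in> \<delta>"
    using eventually_happens'[OF frontier_nontrivial[OF o(1) z]] by blast
  have "0 < h x" if "x \<in> \<delta>" for x
    using zero_principle[OF o(1) \<delta>(2) h(1) h(3) that _ x1(2)] x1(1) h(3)[OF that] by force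
  then show ?thesis using o \<delta> h by blast
qed

end

section \<open>Biharmonic spaces\<close>

text \<open>\<open>one\<close> is the source of the bound 1 for total masses, see
  \<open>kernel_one\<close>.\<close>

locale biharmonic =
  fixes H :: "'a::{t2_space, second_countable_topology} pair_sheaf"
  assumes bispace: "biharmonic_space H"
    and brelot1: "brelot_space (harmonic1 H)" and brelot2: "brelot_space (harmonic2 H)"
    and one: "(\<lambda>x. 1, \<lambda>x. 1) \<in> hyperharmonic_pairs H UNIV"

sublocale biharmonic \<subseteq> B1: brelot "harmonic1 H" by (rule brelot.intro[OF brelot1])
sublocale biharmonic \<subseteq> B2: brelot "harmonic2 H" by (rule brelot.intro[OF brelot2])

lemma boundary_values_self:
  fixes u :: "'a::t2_space \<Rightarrow> real"
  assumes "continuous_on U u" "open U" "closure R \<subseteq> U"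
  shows "has_boundary_values R u u"
  unfolding has_boundary_values_def
proof
  fix y assume "y \<in> frontier R"
  then have "y \<in> U" using assms(3) by (auto simp: frontier_def)
  then have "isCont u y" using assms(1,2) continuous_on_eq_continuous_at by blast
  then show "(u \<longlongrightarrow> u y) (at y within R)"
    unfolding isCont_def by (rule tendsto_within_subset) simp
qed

lemma boundary_values_add:
  "has_boundary_values R u f \<Longrightarrow> has_boundary_values R v g \<Longrightarrow>
    has_boundary_values R (\<lambda>x. u x + v x) (\<lambda>x. f x + g x)"
  by (auto simp: has_boundary_values_def intro: tendsto_add)

lemma boundary_values_cmult:
  "has_boundary_values R u f \<Longrightarrow> has_boundary_values R (\<lambda>x. c * u x) (\<lambda>x. c * f x)"
  by (auto simp: has_boundary_values_def intro: tendsto_mult_left)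

lemma radon_measureI:
  assumes "\<And>f g. continuous_on K f \<Longrightarrow> continuous_on K g \<Longrightarrow> \<mu> (\<lambda>x. f x + g x) = \<mu> f + \<mu> g"
    and "\<And>c f. continuous_on K f \<Longrightarrow> \<mu> (\<lambda>x. c * f x) = c * \<mu> f"
    and "\<And>f. continuous_on K f \<Longrightarrow> (\<And>x. x \<in> K \<Longrightarrow> 0 \<le> f x) \<Longrightarrow> 0 \<le> \<mu> f"
  shows "radon_measure K \<mu>"
  unfolding radon_measure_def using assms by blast

context biharmonic
begin

lemma pairs: "biharmonic_pairs H" and pair_sheaf: "is_sheaf H"
  and biregular_base: "topological_basis {R. biregular H R}"
  using bispace by (simp_all add: biharmonic_space_def)

lemma pair_facts:
  assumes "open U"
  shows "\<forall>(u,v)\<in>H U. continuous_on U u \<and> continuous_on U v"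
    "\<forall>(u,v)\<in>H U. \<forall>(u',v')\<in>H U. (\<lambda>x. u x + u' x, \<lambda>x. v x + v' x) \<in> H U"
    "\<forall>c. \<forall>(u,v)\<in>H U. (\<lambda>x. c * u x, \<lambda>x. c * v x) \<in> H U"
  using pairs[unfolded biharmonic_pairs_def, THEN spec[of _ U], THEN mp, OF assms] by simp_all

lemma pair_continuous: "open U \<Longrightarrow> (u, v) \<in> H U \<Longrightarrow> continuous_on U u \<and> continuous_on U v"
  using pair_facts(1) by blast

lemma pair_add:
  "open U \<Longrightarrow> (u, v) \<in> H U \<Longrightarrow> (u', v') \<in> H U \<Longrightarrow> (\<lambda>x. u x + u' x, \<lambda>x. v x + v' x) \<in> H U"
  using pair_facts(2)[of U, THEN bspec[of _ _ "(u, v)"]] by (auto dest: bspec[of _ _ "(u', v')"])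

lemma pair_cmult: "open U \<Longrightarrow> (u, v) \<in> H U \<Longrightarrow> (\<lambda>x. c * u x, \<lambda>x. c * v x) \<in> H U"
  using pair_facts(3)[of U, THEN spec[of _ c]] by (auto dest!: bspec)

lemma pair_restrict: "open U \<Longrightarrow> open V \<Longrightarrow> V \<subseteq> U \<Longrightarrow> p \<in> H U \<Longrightarrow> p \<in> H V"
  using sheaf_restrict[OF pair_sheaf] .

lemma biregular_open: "biregular H R \<Longrightarrow> open R"
  and biregular_compact: "biregular H R \<Longrightarrow> compact (closure R)"
  by (simp_all add: biregular_def)

lemma biregular_compact_frontier: "biregular H R \<Longrightarrow> compact (frontier R)"
  using B1.compact_frontier biregular_compact by blast

lemma biregular_nhd:
  assumes "open N" "x \<in> N"
  shows "\<exists>R. biregular H R \<and> x \<in> R \<and> closure R \<subseteq> N"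
proof -
  obtain V where V: "open V" "x \<in> V" "closure V \<subseteq> N" using locally_compact_nhd[OF B1.locally_compact assms] by blast
  obtain R where "R \<in> {R. biregular H R}" "x \<in> R" "R \<subseteq> V"
    by (rule topological_basisE[OF biregular_base V(1,2)])
  then show ?thesis using closure_mono[of R V] V(3) by blast
qed

lemma biregular_nonneg:
  assumes "biregular H R" "(u, v) \<in> H R" "has_boundary_values R u f" "has_boundary_values R v g"
    and "continuous_on (frontier R) f" "continuous_on (frontier R) g"
    and "\<And>y. y \<in> frontier R \<Longrightarrow> 0 \<le> f y" "\<And>y. y \<in> frontier R \<Longrightarrow> 0 \<le> g y" "x \<in> R"
  shows "0 \<le> u x" "0 \<le> v x"
proof -
  have "\<forall>(u,v)\<in>H R. has_boundary_values R u f \<and> has_boundary_values R v g \<longrightarrow>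
              (\<forall>x\<in>R. 0 \<le> u x \<and> 0 \<le> v x)"
    using assms(1)[unfolded biregular_def, THEN conjunct2, THEN conjunct2, THEN spec[of _ f], THEN spec[of _ g]]
      assms(5-8) by blast
  then show "0 \<le> u x" "0 \<le> v x" using assms(2-4,9) by blast+
qed

text \<open>The choice does not affect values on \<open>R\<close>: nonnegativity of solutions with
  nonnegative data, applied to differences, makes them unique (\<open>sol_unique\<close>).\<close>

definition sol :: "'a set \<Rightarrow> ('a \<Rightarrow> real) \<Rightarrow> ('a \<Rightarrow> real) \<Rightarrow> ('a \<Rightarrow> real) \<times> ('a \<Rightarrow> real)" where
  "sol R f g = (SOME p. p \<in> H R \<and> has_boundary_values R (fst p) f \<and> has_boundary_values R (snd p) g)"

lemma sol:
  assumes "biregular H R" "continuous_on (frontier R) f" "continuous_on (frontier R) g"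
  shows "sol R f g \<in> H R" "has_boundary_values R (fst (sol R f g)) f" "has_boundary_values R (snd (sol R f g)) g"
proof -
  have "\<exists>(u,v)\<in>H R. has_boundary_values R u f \<and> has_boundary_values R v g"
    using assms(1)[unfolded biregular_def, THEN conjunct2, THEN conjunct2, THEN spec[of _ f], THEN spec[of _ g]]
      assms(2,3) by blast
  then have "\<exists>p. p \<in> H R \<and> has_boundary_values R (fst p) f \<and> has_boundary_values R (snd p) g"
    by (auto split: prod.splits)
  from someI_ex[OF this] show "sol R f g \<in> H R" "has_boundary_values R (fst (sol R f g)) f"
      "has_boundary_values R (snd (sol R f g)) g"
    unfolding sol_def by blast+
qed

lemma sol_unique:
  assumes R: "biregular H R" and fg: "continuous_on (frontier R) f" "continuous_on (frontier R) g"
    and uv: "(u, v) \<in> H R" "has_boundary_values R u f" "has_boundary_values R v g" and x: "x \<in> R"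
  shows "fst (sol R f g) x = u x" "snd (sol R f g) x = v x"
proof -
  obtain u' v' where s: "sol R f g = (u', v')" by (rule prod.exhaust)
  note s' = sol[OF R fg, unfolded s fst_conv snd_conv]
  note o = biregular_open[OF R]
  have le: "0 \<le> a x + (-1) * a' x" "0 \<le> b x + (-1) * b' x"
    if "(a, b) \<in> H R" "has_boundary_values R a f" "has_boundary_values R b g"
      "(a', b') \<in> H R" "has_boundary_values R a' f" "has_boundary_values R b' g" for a b a' b'
    using biregular_nonneg[OF R pair_add[OF o that(1) pair_cmult[OF o that(4), of "-1"]]
       boundary_values_add[OF that(2) boundary_values_cmult[OF that(5)]]
       boundary_values_add[OF that(3) boundary_values_cmult[OF that(6)]] _ _ _ _ x] fg
    by (simp_all add: continuous_on_diff)
  show "fst (sol R f g) x = u x" "snd (sol R f g) x = v x"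
    using le[OF uv s'] le[OF s' uv] by (simp_all add: s)
qed

lemma sol_add:
  assumes "biregular H R" "continuous_on (frontier R) f" "continuous_on (frontier R) g"
    "continuous_on (frontier R) f'" "continuous_on (frontier R) g'" "x \<in> R"
  shows "fst (sol R (\<lambda>x. f x + f' x) (\<lambda>x. g x + g' x)) x = fst (sol R f g) x + fst (sol R f' g') x"
    "snd (sol R (\<lambda>x. f x + f' x) (\<lambda>x. g x + g' x)) x = snd (sol R f g) x + snd (sol R f' g') x"
proof -
  obtain u v where s1: "sol R f g = (u, v)" by (rule prod.exhaust)
  obtain u' v' where s2: "sol R f' g' = (u', v')" by (rule prod.exhaust)
  note s = s1 s2
  note p = sol[OF assms(1-3), unfolded s fst_conv snd_conv] and p' = sol[OF assms(1,4,5), unfolded s fst_conv snd_conv]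
  note r = sol_unique[OF assms(1) continuous_on_add[OF assms(2,4)] continuous_on_add[OF assms(3,5)]
      pair_add[OF biregular_open[OF assms(1)] p(1) p'(1)] boundary_values_add[OF p(2) p'(2)]
      boundary_values_add[OF p(3) p'(3)] assms(6)]
  show "fst (sol R (\<lambda>x. f x + f' x) (\<lambda>x. g x + g' x)) x = fst (sol R f g) x + fst (sol R f' g') x"
    "snd (sol R (\<lambda>x. f x + f' x) (\<lambda>x. g x + g' x)) x = snd (sol R f g) x + snd (sol R f' g') x"
    using r by (simp_all add: s)
qed

lemma sol_cmult:
  assumes "biregular H R" "continuous_on (frontier R) f" "continuous_on (frontier R) g" "x \<in> R"
  shows "fst (sol R (\<lambda>x. c * f x) (\<lambda>x. c * g x)) x = c * fst (sol R f g) x"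
    "snd (sol R (\<lambda>x. c * f x) (\<lambda>x. c * g x)) x = c * snd (sol R f g) x"
proof -
  obtain u v where s: "sol R f g = (u, v)" by (rule prod.exhaust)
  note p = sol[OF assms(1-3), unfolded s fst_conv snd_conv]
  note r = sol_unique[OF assms(1) continuous_on_mult_left[OF assms(2)] continuous_on_mult_left[OF assms(3)]
      pair_cmult[OF biregular_open[OF assms(1)] p(1)] boundary_values_cmult[OF p(2)] boundary_values_cmult[OF p(3)] assms(4)]
  show "fst (sol R (\<lambda>x. c * f x) (\<lambda>x. c * g x)) x = c * fst (sol R f g) x"
    "snd (sol R (\<lambda>x. c * f x) (\<lambda>x. c * g x)) x = c * snd (sol R f g) x"
    using r by (simp_all add: s)
qed

lemma sol_nonneg:
  assumes "biregular H R" "continuous_on (frontier R) f" "continuous_on (frontier R) g" "x \<in> R"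
    and "\<And>y. y \<in> frontier R \<Longrightarrow> 0 \<le> f y" "\<And>y. y \<in> frontier R \<Longrightarrow> 0 \<le> g y"
  shows "0 \<le> fst (sol R f g) x" "0 \<le> snd (sol R f g) x"
  using biregular_nonneg[OF assms(1) _ _ _ assms(2,3,5,6,4), of "fst (sol R f g)" "snd (sol R f g)"]
    sol[OF assms(1-3)] by simp_all

text \<open>The measures \<open>\<mu>\<close>, \<open>\<nu>\<close>, \<open>\<lambda>\<close> of \<open>R\<close> at \<open>x\<close>, and then their upper integrals.\<close>

definition kmu where "kmu R x f = fst (sol R f (\<lambda>z. 0)) x"
definition knu where "knu R x g = fst (sol R (\<lambda>z. 0) g) x"
definition kka where "kka R x g = snd (sol R (\<lambda>z. 0) g) x"

abbreviation "imu R x \<equiv> upper_integral (frontier R) (kmu R x)"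
abbreviation "inu R x \<equiv> upper_integral (frontier R) (knu R x)"
abbreviation "ika R x \<equiv> upper_integral (frontier R) (kka R x)"

lemma radon_kernels:
  assumes "biregular H R" "x \<in> R"
  shows "radon_measure (frontier R) (kmu R x)" "radon_measure (frontier R) (knu R x)"
    "radon_measure (frontier R) (kka R x)"
proof -
  have c0: "continuous_on (frontier R) (\<lambda>z. 0 :: real)" by simp
  note a1 = sol_add[OF assms(1) _ c0 _ c0 assms(2), unfolded add_0_right]
    and a2 = sol_add[OF assms(1) c0 _ c0 _ assms(2), unfolded add_0_right]
    and m1 = sol_cmult[OF assms(1) _ c0 assms(2), unfolded mult_zero_right]
    and m2 = sol_cmult[OF assms(1) c0 _ assms(2), unfolded mult_zero_right]
  note n1 = sol_nonneg[OF assms(1) _ c0 assms(2)] and n2 = sol_nonneg[OF assms(1) c0 _ assms(2)]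
  show "radon_measure (frontier R) (kmu R x)" "radon_measure (frontier R) (knu R x)"
    "radon_measure (frontier R) (kka R x)"
    unfolding kmu_def knu_def kka_def
    by (rule radon_measureI, erule (1) a1 a2, erule m1 m2, rule n1 n2; simp)+
qed

lemma measures_mean:
  assumes "biharmonic_measures H R x \<mu> \<nu> \<kappa>" "open U" "open R" "closure R \<subseteq> U" "(u, v) \<in> H U"
  shows "u x = \<mu> u + \<nu> v" "v x = \<kappa> v"
proof -
  have c: "continuous_on U u" "continuous_on U v" using pair_continuous[OF assms(2,5)] by auto
  have "frontier R \<subseteq> U" "R \<subseteq> U" using assms(4) closure_subset[of R] by (auto simp: frontier_def)
  then have cf: "continuous_on (frontier R) u" "continuous_on (frontier R) v" and "(u, v) \<in> H R"
    using c continuous_on_subset pair_restrict[OF assms(2,3) _ assms(5)] by blast+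
  moreover have "has_boundary_values R u u" "has_boundary_values R v v"
    using boundary_values_self c assms(2,4) by blast+
  moreover have "\<forall>(u',v')\<in>H R. has_boundary_values R u' u \<and> has_boundary_values R v' v \<longrightarrow>
           u' x = \<mu> u + \<nu> v \<and> v' x = \<kappa> v"
    using assms(1) cf unfolding biharmonic_measures_def by blast
  ultimately show "u x = \<mu> u + \<nu> v" "v x = \<kappa> v" by blast+
qed

lemma measures_radon:
  assumes "biharmonic_measures H R x \<mu> \<nu> \<kappa>"
  shows "radon_measure (frontier R) \<mu>" "radon_measure (frontier R) \<nu>" "radon_measure (frontier R) \<kappa>"
  using assms by (simp_all add: biharmonic_measures_def)

lemma lsc_real: "continuous_on U u \<Longrightarrow> lsc_on U (\<lambda>x. ereal (u x))"
  by (intro lsc_on_continuous continuous_on_ereal)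

text \<open>A harmonic pair solves the Dirichlet problem for its own boundary values, so the mean
  value inequality holds with equality in the second component; the first component is infinite and
  imposes nothing.\<close>

lemma pair_hyperharmonic2:
  assumes "open U" "(u, v) \<in> H U"
  shows "(\<lambda>x. ereal (v x)) \<in> hyperharmonic2 H U"
  unfolding hyperharmonic2_def hyperharmonic_pairs_def mem_Collect_eq prod.case
proof (intro conjI ballI allI impI)
  show "lsc_on U (\<lambda>x. \<infinity>)" by (intro lsc_on_continuous) simp
  show "lsc_on U (\<lambda>x. ereal (v x))" using pair_continuous[OF assms] lsc_real by blast
  fix R x \<mu> \<nu> \<kappa> assume a: "biregular H R \<and> closure R \<subseteq> U \<and> x \<in> R \<and> biharmonic_measures H R x \<mu> \<nu> \<kappa>"
  then have m: "v x = \<kappa> v" and "frontier R \<subseteq> U"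
    using measures_mean(2)[OF _ assms(1) biregular_open _ assms(2)] by (auto simp: frontier_def)
  then have "continuous_on (frontier R) v" using pair_continuous[OF assms] continuous_on_subset by blast
  then show "upper_integral (frontier R) \<kappa> (\<lambda>x. ereal (v x)) \<le> ereal (v x)"
    using upper_integral_real[OF measures_radon(3), of R x \<mu> \<nu> \<kappa> v] a m by simp
qed auto

lemma pair_harmonic2:
  assumes "open U" "(u, v) \<in> H U"
  shows "v \<in> harmonic2 H U"
  using pair_hyperharmonic2[OF assms] pair_hyperharmonic2[OF assms(1) pair_cmult[OF assms, of "-1"]]
  by (simp add: harmonic2_def)

lemma pair_hyperharmonic1:
  assumes "open U" "(u, v) \<in> H U" and v: "\<And>x. x \<in> U \<Longrightarrow> v x = 0"
  shows "(\<lambda>x. ereal (u x)) \<in> hyperharmonic1 H U"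
  unfolding hyperharmonic1_def hyperharmonic_pairs_def mem_Collect_eq prod.case
proof (intro conjI ballI allI impI)
  show "lsc_on U (\<lambda>x. 0)" by (intro lsc_on_continuous) simp
  show "lsc_on U (\<lambda>x. ereal (u x))" using pair_continuous[OF assms(1,2)] lsc_real by blast
  fix R x \<mu> \<nu> \<kappa> assume a: "biregular H R \<and> closure R \<subseteq> U \<and> x \<in> R \<and> biharmonic_measures H R x \<mu> \<nu> \<kappa>"
  then have m: "u x = \<mu> u + \<nu> v" and f: "frontier R \<subseteq> U"
    using measures_mean(1)[OF _ assms(1) biregular_open _ assms(2)] by (auto simp: frontier_def)
  have cu: "continuous_on (frontier R) u" and cv: "continuous_on (frontier R) v"
    using pair_continuous[OF assms(1,2)] continuous_on_subset f by blast+
  have c0: "continuous_on (frontier R) (\<lambda>z. 0 :: real)" by simp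
  have r: "radon_measure (frontier R) \<mu>" "radon_measure (frontier R) \<nu>" "radon_measure (frontier R) \<kappa>"
    using a measures_radon by blast+
  have "\<nu> v = \<nu> (\<lambda>z. 0)" using v f by (intro radon_cong[OF r(2) cv]) auto
  then have "\<nu> v = 0" using radon_const[OF r(2), of 0] by simp
  then show "upper_integral (frontier R) \<mu> (\<lambda>x. ereal (u x)) + upper_integral (frontier R) \<nu> (\<lambda>x. 0) \<le> ereal (u x)"
    using m upper_integral_real[OF r(1) cu] upper_integral_real[OF r(2) c0] radon_const[OF r(2), of 0]
    by (simp add: zero_ereal_def)
  show "upper_integral (frontier R) \<kappa> (\<lambda>x. 0) \<le> 0"
    using upper_integral_real[OF r(3) c0] radon_const[OF r(3), of 0] by (simp add: zero_ereal_def)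
qed auto

lemma pair_harmonic1:
  assumes "open U" "(u, v) \<in> H U" "\<And>x. x \<in> U \<Longrightarrow> v x = 0"
  shows "u \<in> harmonic1 H U"
  using pair_hyperharmonic1[OF assms] pair_hyperharmonic1[OF assms(1) pair_cmult[OF assms(1,2), of "-1"]] assms(3)
  by (simp add: harmonic1_def)

text \<open>The second component of a solution with boundary values \<open>(f, 0)\<close> vanishes. This is not part of the
  definition of regularity; without it there would be no harmonic measures. For small sets it follows by
  comparison with a positive harmonic function, in general from the minimum principle, which
  only needs small sets.\<close>

lemma harmonic2_maximum_small:
  assumes h: "open \<delta>" "h \<in> harmonic2 H \<delta>" "\<And>x. x \<in> \<delta> \<Longrightarrow> 0 < h x"
    and R: "open R" "compact (closure R)" "closure R \<subseteq> \<delta>"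
    and v: "v \<in> harmonic2 H R" "has_boundary_values R v (\<lambda>z. 0)" and x1: "x1 \<in> R"
  shows "v x1 \<le> 0"
proof (rule ccontr)
  assume "\<not> ?thesis"
  then have pos: "0 < v x1" by simp
  have hc: "continuous_on (closure R) h"
    using B2.harmonic_continuous[OF h(1,2)] R(3) continuous_on_subset by blast
  \<comment> \<open>The continuous extension of \<open>v\<close> by its boundary values, so that
    \<open>b / h\<close> attains a maximum on the compact closure.\<close>
  define b where "b z = (if z \<in> R then v z else 0)" for z
  have bc: "continuous_on (closure R) b"
    unfolding continuous_on_def
  proof
    fix z assume z: "z \<in> closure R"
    show "(b \<longlongrightarrow> b z) (at z within closure R)"
    proof (cases "z \<in> R")
      case True
      then have "isCont v z"
        using B2.harmonic_continuous[OF R(1) v(1)] R(1) continuous_on_eq_continuous_at by blast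
      then have "(v \<longlongrightarrow> v z) (at z within closure R)"
        unfolding isCont_def by (rule tendsto_within_subset) simp
      moreover have "eventually (\<lambda>y. v y = b y) (at z within closure R)"
        using eventually_nhds_in_open[OF R(1) True] unfolding eventually_at_filter
        by eventually_elim (simp add: b_def)
      ultimately have "(b \<longlongrightarrow> v z) (at z within closure R)" using tendsto_cong by blast
      then show ?thesis using True by (simp add: b_def[of z])
    next
      case False
      then have "z \<in> frontier R" using z R(1) by (simp add: frontier_def interior_open)
      then have l: "(v \<longlongrightarrow> 0) (at z within R)" using v(2) by (simp add: has_boundary_values_def)
      have "(b \<longlongrightarrow> 0) (at z within closure R)"
      proof (rule tendstoI)
        fix e :: real assume e: "0 < e"
        from tendstoD[OF l e] show "\<forall>\<^sub>F x in at z within closure R. dist (b x) 0 < e"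
          unfolding eventually_at_filter by eventually_elim (use e in \<open>auto simp: b_def\<close>)
      qed
      then show ?thesis using False by (simp add: b_def)
    qed
  qed
  have "continuous_on (closure R) (\<lambda>z. b z / h z)"
  proof (intro continuous_on_divide bc hc ballI)
    fix z assume "z \<in> closure R"
    then show "h z \<noteq> 0" using h(3)[of z] R(3) by auto
  qed
  then obtain y where y: "y \<in> closure R" "\<And>z. z \<in> closure R \<Longrightarrow> b z / h z \<le> b y / h y"
    using continuous_attains_sup[OF R(2), of "\<lambda>z. b z / h z"] x1 closure_subset[of R] by blast
  define m where "m = b y / h y"
  have in\<delta>: "z \<in> \<delta>" if "z \<in> R" for z using that R(3) closure_subset[of R] by blast
  have "0 < v x1 / h x1" using pos h(3)[OF in\<delta>[OF x1]] by simp
  also have "\<dots> \<le> m" using y(2)[of x1] x1 closure_subset[of R] by (auto simp: b_def m_def)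
  finally have m: "0 < m" .
  then have yR: "y \<in> R" unfolding m_def b_def by (metis div_0 less_irrefl)
  \<comment> \<open>\<open>k\<close> is nonnegative and vanishes at the maximum point
    \<open>y\<close>, hence on a whole component; at the boundary, however, it tends to
    \<open>m * h z > 0\<close>.\<close>
  define k where "k z = m * h z - v z" for z
  have k: "k \<in> harmonic2 H R"
    unfolding k_def using in\<delta>
    by (intro B2.harmonic_diff[OF R(1) B2.harmonic_cmult[OF R(1) B2.harmonic_restrict[OF h(1) R(1) _ h(2)]] v(1)]) auto
  have kn: "0 \<le> k z" if "z \<in> R" for z
    using y(2)[of z, folded m_def] that h(3)[OF in\<delta>[OF that]] closure_subset[of R]
    by (auto simp: k_def b_def pos_divide_le_eq)
  have ky: "k y = 0" using yR h(3)[OF in\<delta>[OF yR]] by (simp add: k_def m_def b_def)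
  define U where "U = connected_component_set R y"
  have U: "open U" "connected U" "y \<in> U" "U \<subseteq> R" "frontier U \<subseteq> frontier R"
    using component_facts[OF B2.locally_connected_space R(1) yR] by (auto simp: U_def)
  have "compact (closure U)"
    using compact_Int_closed[OF R(2) closed_closure, of U] closure_mono[OF U(4)] by (simp add: inf_absorb2)
  then obtain z where z: "z \<in> frontier U" using B2.frontier_nonempty_compact[of U] U(3) by blast
  have zw: "z \<in> frontier R" "z \<in> \<delta>" using z U(5) R(3) by (auto simp: frontier_def)
  have "k x = 0" if "x \<in> U" for x
    by (rule B2.zero_principle[OF U(1,2) B2.harmonic_restrict[OF R(1) U(1,4) k] _ U(3) ky that])
      (use kn U(4) in blast)
  then have "(k \<longlongrightarrow> 0) (at z within U)"
    by (intro tendsto_eventually) (auto simp: eventually_at_filter)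
  moreover have "(k \<longlongrightarrow> m * h z - 0) (at z within U)"
  proof -
    have "isCont h z"
      using B2.harmonic_continuous[OF h(1,2)] h(1) zw(2) continuous_on_eq_continuous_at by blast
    then have "(h \<longlongrightarrow> h z) (at z within U)"
      unfolding isCont_def by (rule tendsto_within_subset) simp
    then show ?thesis unfolding k_def
      by (intro tendsto_diff tendsto_mult_left boundary_subset_tendsto[OF v(2) U(4) zw(1)])
  qed
  ultimately have "m * h z = 0" using tendsto_unique[OF frontier_nontrivial[OF U(1) z]] by fastforce
  then show False using m h(3)[OF zw(2)] by simp
qed

definition decoupled where
  "decoupled R \<longleftrightarrow> (\<forall>(f :: 'a \<Rightarrow> real) x. continuous_on (frontier R) f \<and> x \<in> R \<longrightarrow> snd (sol R f (\<lambda>z. 0)) x = 0)"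

lemma sol_harmonic2:
  assumes "biregular H R" "continuous_on (frontier R) f" "continuous_on (frontier R) g"
  shows "snd (sol R f g) \<in> harmonic2 H R"
  using pair_harmonic2[OF biregular_open[OF assms(1)], of "fst (sol R f g)" "snd (sol R f g)"] sol(1)[OF assms] by simp

lemma decoupled_small:
  assumes h: "open \<delta>" "h \<in> harmonic2 H \<delta>" "\<And>x. x \<in> \<delta> \<Longrightarrow> 0 < h x"
    and R: "biregular H R" "closure R \<subseteq> \<delta>"
  shows "decoupled R"
  unfolding decoupled_def
proof (intro allI impI)
  fix f :: "'a \<Rightarrow> real" and x assume "continuous_on (frontier R) f \<and> x \<in> R"
  then have f: "continuous_on (frontier R) f" and x: "x \<in> R" by auto
  note o = biregular_open[OF R(1)] and c = biregular_compact[OF R(1)]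
  define v where "v = snd (sol R f (\<lambda>z. 0))"
  have v: "v \<in> harmonic2 H R" "has_boundary_values R v (\<lambda>z. 0)"
    using sol_harmonic2[OF R(1) f] sol(3)[OF R(1) f] by (auto simp: v_def)
  have "v x \<le> 0" by (rule harmonic2_maximum_small[OF h o c R(2) v x])
  moreover have "(-1) * v x \<le> 0"
    by (rule harmonic2_maximum_small[OF h o c R(2) B2.harmonic_cmult[OF o v(1)]
          boundary_values_cmult[OF v(2), of "-1", unfolded mult_zero_right] x])
  ultimately show "snd (sol R f (\<lambda>z. 0)) x = 0" by (simp add: v_def)
qed

lemma decoupled_solution:
  assumes "decoupled R" "biregular H R" "continuous_on (frontier R) f" "continuous_on (frontier R) g"
    "(u, v) \<in> H R" "has_boundary_values R u f" "has_boundary_values R v g" "x \<in> R"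
  shows "u x = kmu R x f + knu R x g" "v x = kka R x g"
proof -
  have c0: "continuous_on (frontier R) (\<lambda>z. 0 :: real)" by simp
  note a = sol_add[OF assms(2,3) c0 c0 assms(4,8), unfolded add_0_right add_0_left]
  show "u x = kmu R x f + knu R x g" "v x = kka R x g"
    using sol_unique[OF assms(2-8)] a assms(1,3,8) by (simp_all add: kmu_def knu_def kka_def decoupled_def)
qed

lemma decoupled_measures:
  assumes "decoupled R" "biregular H R" "x \<in> R"
  shows "biharmonic_measures H R x (kmu R x) (knu R x) (kka R x)"
  unfolding biharmonic_measures_def
  using radon_kernels[OF assms(2,3)] decoupled_solution[OF assms(1,2) _ _ _ _ _ assms(3)] by auto

lemma kka_kernel:
  assumes "biregular H R"
  shows "dirichlet_kernel (harmonic2 H) R (kka R)"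
  unfolding dirichlet_kernel_def
  using assms biregular_open biregular_compact radon_kernels sol_harmonic2[OF assms, of "\<lambda>z. 0"]
    sol(3)[OF assms, of "\<lambda>z. 0"]
  by (simp add: kka_def[abs_def])

lemma kernel_one:
  assumes "decoupled R" "biregular H R" "x \<in> R"
  shows "kmu R x (\<lambda>z. 1) + knu R x (\<lambda>z. 1) \<le> 1" "kka R x (\<lambda>z. 1) \<le> 1"
proof -
  have "imu R x (\<lambda>x. 1) + inu R x (\<lambda>x. 1) \<le> 1 \<and>
        ika R x (\<lambda>x. 1) \<le> 1"
    using one decoupled_measures[OF assms] assms(2,3) unfolding hyperharmonic_pairs_def by blast
  then show "kmu R x (\<lambda>z. 1) + knu R x (\<lambda>z. 1) \<le> 1" "kka R x (\<lambda>z. 1) \<le> 1"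
    using radon_kernels[OF assms(2,3), THEN upper_integral_real, of "\<lambda>x. 1"]
    by (simp_all add: one_ereal_def)
qed

text \<open>\<open>harmonic2\<close> demands the supermean inequality of both \<open>h\<close> and
  \<open>- h\<close>. For real continuous functions upper integrals are integrals, so together these
  are an equality.\<close>

lemma harmonic2_mean:
  assumes "open U" "h \<in> harmonic2 H U" "decoupled R" "biregular H R" "closure R \<subseteq> U" "x \<in> R"
  shows "kka R x h = h x"
proof -
  note r = radon_kernels(3)[OF assms(4,6)]
  have "frontier R \<subseteq> U" using assms(5) by (auto simp: frontier_def)
  then have hc: "continuous_on (frontier R) h"
    using B2.harmonic_continuous[OF assms(1,2)] continuous_on_subset by blast
  have "ika R x (\<lambda>x. ereal (h x)) \<le> ereal (h x)"
    "ika R x (\<lambda>x. ereal (- h x)) \<le> ereal (- h x)"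
    using assms(2) decoupled_measures[OF assms(3,4,6)] assms(4,5,6)
    unfolding harmonic2_def hyperharmonic2_def hyperharmonic_pairs_def by blast+
  moreover have "kka R x (\<lambda>x. - h x) = - kka R x h" using radon_cmult[OF r hc, of "-1"] by simp
  ultimately show ?thesis
    using upper_integral_real[OF r hc] upper_integral_real[OF r continuous_on_minus[OF hc]] by simp
qed

lemma decoupled_nhd:
  assumes "open N" "x \<in> N"
  shows "\<exists>R. decoupled R \<and> biregular H R \<and> x \<in> R \<and> closure R \<subseteq> N"
proof -
  obtain \<delta> h where \<delta>: "open \<delta>" "x \<in> \<delta>" "h \<in> harmonic2 H \<delta>" "\<forall>x\<in>\<delta>. 0 < h x"
    using B2.positive_harmonic_exists by blast
  then obtain R where "biregular H R" "x \<in> R" "closure R \<subseteq> N \<inter> \<delta>"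
    using biregular_nhd[of "N \<inter> \<delta>" x] assms by blast
  then show ?thesis using decoupled_small[OF \<delta>(1,3)] \<delta>(4) by blast
qed

lemma decoupled:
  assumes R: "biregular H R"
  shows "decoupled R"
  unfolding decoupled_def
proof (intro allI impI)
  fix f :: "'a \<Rightarrow> real" and x assume "continuous_on (frontier R) f \<and> x \<in> R"
  then have f: "continuous_on (frontier R) f" and x: "x \<in> R" by auto
  note o = biregular_open[OF R] and c = biregular_compact[OF R]
  have ge: "0 \<le> v x" if v: "v \<in> harmonic2 H R" "has_boundary_values R v (\<lambda>z. 0)" for v
  proof -
    have vc: "continuous_on R v" using B2.harmonic_continuous[OF o v(1)] .
    have "0 \<le> ereal (v x)"
    proof (rule B2.minimum_principle[OF o c _ _ _ _ x])
      show "lsc_on R (\<lambda>x. ereal (v x))" using lsc_real[OF vc] .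
      fix y N assume y: "y \<in> R" "open N" "y \<in> N"
      then obtain R' where w: "decoupled R'" "biregular H R'" "y \<in> R'" "closure R' \<subseteq> N \<inter> R"
        using decoupled_nhd[of "N \<inter> R" y] o by blast
      then have "frontier R' \<subseteq> R" by (auto simp: frontier_def)
      then have "continuous_on (frontier R') v" using vc continuous_on_subset by blast
      then have "ika R' y (\<lambda>x. ereal (v x)) = ereal (v y)"
        using upper_integral_real[OF radon_kernels(3)[OF w(2,3)]] harmonic2_mean[OF o v(1) w(1,2) _ w(3)] w(4) by simp
      then show "\<exists>R' \<kappa>. dirichlet_kernel (harmonic2 H) R' \<kappa> \<and> y \<in> R' \<and> R' \<subseteq> N \<and> closure R' \<subseteq> R \<and>
          \<kappa> y (\<lambda>z. 1) \<le> 1 \<and> upper_integral (frontier R') (\<kappa> y) (\<lambda>x. ereal (v x)) \<le> ereal (v y)"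
        using w kka_kernel[OF w(2)] kernel_one(2)[OF w(1-3)] closure_subset[of R']
        by (intro exI[of _ R'] exI[of _ "kka R'"]) auto
    next
      fix z and t :: real assume "z \<in> frontier R" "t < 0"
      then show "\<forall>\<^sub>F x in at z within R. ereal t < ereal (v x)"
        using v(2) order_tendstoD(1)[of v 0 "at z within R" t] by (simp add: has_boundary_values_def)
    qed simp
    then show ?thesis by simp
  qed
  define v where "v = snd (sol R f (\<lambda>z. 0))"
  have v: "v \<in> harmonic2 H R" "has_boundary_values R v (\<lambda>z. 0)"
    using sol_harmonic2[OF R f] sol(3)[OF R f] by (auto simp: v_def)
  have "0 \<le> v x" "0 \<le> (-1) * v x"
    using ge[OF v] ge[OF B2.harmonic_cmult[OF o v(1), of "-1"]] boundary_values_cmult[OF v(2), of "-1"] by simp_all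
  then show "snd (sol R f (\<lambda>z. 0)) x = 0" by (simp add: v_def)
qed

lemmas measures = decoupled_measures[OF decoupled]

end

section \<open>Hyperharmonic pairs and the Poisson modification\<close>

lemma lsc_SUP:
  assumes "\<And>f. f \<in> A \<Longrightarrow> continuous_on U (F f)"
  shows "lsc_on U (\<lambda>z. SUP f\<in>A. ereal (F f z))"
  unfolding lsc_on_def
proof
  fix a
  have "{z \<in> U. a < (SUP f\<in>A. ereal (F f z))} = (\<Union>f\<in>A. {z \<in> U. a < ereal (F f z)})"
    by (auto simp: less_SUP_iff)
  moreover have "openin (top_of_set U) {z \<in> U. a < ereal (F f z)}" if "f \<in> A" for f
    using lsc_on_continuous[OF continuous_on_ereal[OF assms[OF that]]] by (simp add: lsc_on_def)
  ultimately show "openin (top_of_set U) {z \<in> U. a < (SUP f\<in>A. ereal (F f z))}"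
    by (metis (no_types, lifting) openin_Union imageE)
qed

context biharmonic
begin

lemma pair_cong:
  assumes "open U" "(u, v) \<in> H U" "\<And>x. x \<in> U \<Longrightarrow> u' x = u x" "\<And>x. x \<in> U \<Longrightarrow> v' x = v x"
  shows "(u', v') \<in> H U"
proof -
  have "\<forall>(u,v)\<in>H U. \<forall>u' v'. (\<forall>x\<in>U. u' x = u x \<and> v' x = v x) \<longrightarrow> (u',v') \<in> H U"
    using pairs[unfolded biharmonic_pairs_def, THEN spec[of _ U], THEN mp, OF assms(1)] by simp
  then show ?thesis using assms(2-4) by blast
qed

lemma solution:
  assumes "biregular H R" "continuous_on (frontier R) f" "continuous_on (frontier R) g"
  shows "(\<lambda>x. kmu R x f + knu R x g, \<lambda>x. kka R x g) \<in> H R"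
    "has_boundary_values R (\<lambda>x. kmu R x f + knu R x g) f"
    "continuous_on R (\<lambda>x. kmu R x f + knu R x g)"
proof -
  have c0: "continuous_on (frontier R) (\<lambda>z. 0 :: real)" by simp
  obtain u v where s: "sol R f g = (u, v)" by (rule prod.exhaust)
  note p = sol[OF assms, unfolded s fst_conv snd_conv]
  have eq: "kmu R x f + knu R x g = u x" "kka R x g = v x" if "x \<in> R" for x
    using decoupled_solution[OF decoupled[OF assms(1)] assms p that] by simp_all
  show m: "(\<lambda>x. kmu R x f + knu R x g, \<lambda>x. kka R x g) \<in> H R"
    by (rule pair_cong[OF biregular_open[OF assms(1)] p(1)]) (use eq in auto)
  show "has_boundary_values R (\<lambda>x. kmu R x f + knu R x g) f"
    using boundary_values_add[OF sol(2)[OF assms(1,2) c0] sol(2)[OF assms(1) c0 assms(3)]]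
    by (simp add: kmu_def knu_def)
  show "continuous_on R (\<lambda>x. kmu R x f + knu R x g)"
    using pair_continuous[OF biregular_open[OF assms(1)] m] by simp
qed

lemma kernel_zero:
  assumes "biregular H R" "x \<in> R"
  shows "kmu R x (\<lambda>z. 0) = 0" "knu R x (\<lambda>z. 0) = 0" "kka R x (\<lambda>z. 0) = 0"
  using radon_const[OF radon_kernels(1)[OF assms], of 0] radon_const[OF radon_kernels(2)[OF assms], of 0]
    radon_const[OF radon_kernels(3)[OF assms], of 0] by simp_all

lemma kmu_kernel:
  assumes "biregular H R"
  shows "dirichlet_kernel (harmonic1 H) R (kmu R)"
  unfolding dirichlet_kernel_def
proof (intro conjI ballI allI impI)
  have c0: "continuous_on (frontier R) (\<lambda>z. 0 :: real)" by simp
  note o = biregular_open[OF assms]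
  fix f :: "'a \<Rightarrow> real" assume f: "continuous_on (frontier R) f"
  show "has_boundary_values R (\<lambda>x. kmu R x f) f" using sol(2)[OF assms f c0] by (simp add: kmu_def)
  have "sol R f (\<lambda>z. 0) \<in> H R" using sol(1)[OF assms f c0] .
  then have "fst (sol R f (\<lambda>z. 0)) \<in> harmonic1 H R"
    using pair_harmonic1[OF o, of "fst (sol R f (\<lambda>z. 0))" "snd (sol R f (\<lambda>z. 0))"] decoupled[OF assms] f
    by (simp add: decoupled_def)
  then show "(\<lambda>x. kmu R x f) \<in> harmonic1 H R" by (simp add: kmu_def[abs_def])
qed (use assms biregular_open biregular_compact radon_kernels in auto)

lemma knu_continuous:
  assumes "biregular H R" "continuous_on (frontier R) g"
  shows "continuous_on R (\<lambda>x. knu R x g)"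
  using solution(3)[OF assms(1) _ assms(2), of "\<lambda>z. 0"] kernel_zero(1)[OF assms(1)]
  by (simp cong: continuous_on_cong)

lemma kmu_one: "biregular H R \<Longrightarrow> x \<in> R \<Longrightarrow> kmu R x (\<lambda>z. 1) \<le> 1"
  and knu_one: "biregular H R \<Longrightarrow> x \<in> R \<Longrightarrow> knu R x (\<lambda>z. 1) \<le> 1"
  using kernel_one(1)[OF decoupled, of R x] radon_nonneg[OF radon_kernels(1), of R x "\<lambda>z. 1"]
    radon_nonneg[OF radon_kernels(2), of R x "\<lambda>z. 1"] by simp_all

lemma solution_mean:
  assumes "open U" "(u, v) \<in> H U" "biregular H R" "closure R \<subseteq> U" "x \<in> R"
  shows "u x = kmu R x u + knu R x v" "v x = kka R x v"
  using measures_mean[OF measures[OF assms(3,3,5)] assms(1) biregular_open[OF assms(3)] assms(4,2)] by simp_all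

text \<open>The data \<open>(f, 0)\<close> and \<open>(0, f)\<close> separate the measures.
  Hyperharmonicity quantifies over all triples of measures; by uniqueness it can be checked on the
  concrete ones.\<close>

lemma measures_agree:
  assumes "biharmonic_measures H R x \<mu> \<nu> \<kappa>" "biregular H R" "x \<in> R" "continuous_on (frontier R) f"
  shows "\<mu> f = kmu R x f" "\<nu> f = knu R x f" "\<kappa> f = kka R x f"
proof -
  have c0: "continuous_on (frontier R) (\<lambda>z. 0 :: real)" by simp
  have m: "fst (sol R f g) x = \<mu> f + \<nu> g \<and> snd (sol R f g) x = \<kappa> g"
    if "continuous_on (frontier R) f" "continuous_on (frontier R) g" for f g
  proof -
    obtain u v where s: "sol R f g = (u, v)" by (rule prod.exhaust)
    note p = sol[OF assms(2) that, unfolded s fst_conv snd_conv]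
    have "\<forall>(u',v')\<in>H R. has_boundary_values R u' f \<and> has_boundary_values R v' g \<longrightarrow>
             u' x = \<mu> f + \<nu> g \<and> v' x = \<kappa> g"
      using assms(1) that unfolding biharmonic_measures_def by blast
    then show ?thesis using p s by auto
  qed
  have z: "\<mu> (\<lambda>z. 0) = 0" "\<nu> (\<lambda>z. 0) = 0"
    using measures_radon[OF assms(1)] radon_const[of "frontier R" \<mu> 0] radon_const[of "frontier R" \<nu> 0] by simp_all
  show "\<mu> f = kmu R x f" "\<nu> f = knu R x f" "\<kappa> f = kka R x f"
    using m[OF assms(4) c0] m[OF c0 assms(4)] z by (simp_all add: kmu_def knu_def kka_def)
qed

lemma upper_integral_cong_measure:
  "(\<And>f. continuous_on K f \<Longrightarrow> \<mu> f = \<nu> f) \<Longrightarrow> upper_integral K \<mu> u = upper_integral K \<nu> u"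
  unfolding upper_integral_def by (rule SUP_cong) auto

lemma hyperharmonic_pairD:
  assumes "(u, v) \<in> hyperharmonic_pairs H U" "biregular H R" "closure R \<subseteq> U" "x \<in> R"
  shows "imu R x u + inu R x v \<le> u x"
    "ika R x v \<le> v x"
  using assms measures[OF assms(2,2,4)] unfolding hyperharmonic_pairs_def by blast+

lemma hyperharmonic_pairI:
  assumes "lsc_on U u" "lsc_on U v" "\<And>x. x \<in> U \<Longrightarrow> u x \<noteq> -\<infinity>" "\<And>x. x \<in> U \<Longrightarrow> v x \<noteq> -\<infinity>"
    and "\<And>R x. biregular H R \<Longrightarrow> closure R \<subseteq> U \<Longrightarrow> x \<in> R \<Longrightarrow>
      imu R x u + inu R x v \<le> u x"
    and "\<And>R x. biregular H R \<Longrightarrow> closure R \<subseteq> U \<Longrightarrow> x \<in> R \<Longrightarrow>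
      ika R x v \<le> v x"
  shows "(u, v) \<in> hyperharmonic_pairs H U"
  unfolding hyperharmonic_pairs_def mem_Collect_eq prod.case
proof (intro conjI ballI allI impI)
  fix R x \<mu> \<nu> \<kappa>
  assume a: "biregular H R \<and> closure R \<subseteq> U \<and> x \<in> R \<and> biharmonic_measures H R x \<mu> \<nu> \<kappa>"
  then have "upper_integral (frontier R) \<mu> u = imu R x u"
    "upper_integral (frontier R) \<nu> v = inu R x v"
    "upper_integral (frontier R) \<kappa> v = ika R x v"
    using measures_agree[of R x \<mu> \<nu> \<kappa>] by (intro upper_integral_cong_measure; blast)+
  then show "upper_integral (frontier R) \<mu> u + upper_integral (frontier R) \<nu> v \<le> u x"
    "upper_integral (frontier R) \<kappa> v \<le> v x"
    using assms(5,6)[of R x] a by simp_all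
qed (use assms in auto)

text \<open>The \<open>\<nu>\<close>-integral of the nonnegative \<open>v\<close> may be dropped.
  Competitors in the minimum problem for a pure function must belong to
  \<open>hyperharmonic1\<close>, and this provides it.\<close>

lemma hyperharmonic_pair_hyperharmonic1:
  assumes "(u, v) \<in> hyperharmonic_pairs H UNIV" "\<And>x. 0 \<le> v x"
  shows "u \<in> hyperharmonic1 H UNIV"
  unfolding hyperharmonic1_def mem_Collect_eq
proof (rule hyperharmonic_pairI)
  show "lsc_on UNIV u" "u x \<noteq> -\<infinity>" for x using assms(1) by (auto simp: hyperharmonic_pairs_def)
  show "lsc_on UNIV (\<lambda>x::'a. 0::ereal)" by (intro lsc_on_continuous) simp
  fix R x assume R: "biregular H R" "closure R \<subseteq> UNIV" "x \<in> R"
  have "imu R x u + inu R x (\<lambda>x. 0)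
      \<le> imu R x u + inu R x v"
    by (intro add_left_mono upper_integral_mono assms(2))
  also have "\<dots> \<le> u x" by (rule hyperharmonic_pairD(1)[OF assms(1) R])
  finally show "imu R x u + inu R x (\<lambda>x. 0) \<le> u x" .
  show "ika R x (\<lambda>x. 0) \<le> 0"
    using upper_integral_real[OF radon_kernels(3)[OF R(1,3)], of "\<lambda>x. 0"] kernel_zero(3)[OF R(1,3)]
    by (simp add: zero_ereal_def)
qed simp

lemma minimum1:
  assumes W: "open W" "compact (closure W)" and s: "lsc_on W s" "\<And>x. x \<in> W \<Longrightarrow> s x \<noteq> - \<infinity>"
    and mean: "\<And>R x. biregular H R \<Longrightarrow> closure R \<subseteq> W \<Longrightarrow> x \<in> R \<Longrightarrow>
      imu R x s \<le> s x"
    and bdry: "\<And>z t. z \<in> frontier W \<Longrightarrow> t < 0 \<Longrightarrow> \<forall>\<^sub>F x in at z within W. ereal t < s x"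
    and "x1 \<in> W"
  shows "0 \<le> s x1"
proof (rule B1.minimum_principle[OF W s _ bdry \<open>x1 \<in> W\<close>])
  fix x N assume x: "x \<in> W" "open N" "x \<in> N"
  then obtain R where R: "biregular H R" "x \<in> R" "closure R \<subseteq> N \<inter> W"
    using biregular_nhd[of "N \<inter> W" x] W(1) by blast
  then show "\<exists>R \<kappa>. dirichlet_kernel (harmonic1 H) R \<kappa> \<and> x \<in> R \<and> R \<subseteq> N \<and> closure R \<subseteq> W \<and>
      \<kappa> x (\<lambda>z. 1) \<le> 1 \<and> upper_integral (frontier R) (\<kappa> x) s \<le> s x"
    using kmu_kernel[OF R(1)] kmu_one[OF R(1,2)] mean[OF R(1) _ R(2)] closure_subset[of R]
    by (intro exI[of _ R] exI[of _ "kmu R"]) auto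
qed

text \<open>The index set of the supremum in \<open>upper_integral\<close>, made explicit because
  each member has a continuous Poisson integral and pointwise maxima make these integrals a directed
  family.\<close>

definition minorants :: "'a set \<Rightarrow> ('a \<Rightarrow> ereal) \<Rightarrow> ('a \<Rightarrow> real) set" where
  "minorants K p = {f. continuous_on K f \<and> (\<forall>z\<in>K. ereal (f z) \<le> p z)}"

lemma minorants_directed:
  assumes "biregular H R"
    and "f1 \<in> minorants (frontier R) p" "f2 \<in> minorants (frontier R) p"
  shows "\<exists>f\<in>minorants (frontier R) p. \<forall>z\<in>R. kmu R z f1 \<le> kmu R z f \<and> kmu R z f2 \<le> kmu R z f"
proof (intro bexI conjI ballI)
  let ?f = "\<lambda>z. max (f1 z) (f2 z)"
  have c: "continuous_on (frontier R) ?f" using assms(2,3) by (auto simp: minorants_def intro: continuous_on_max)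
  then show "?f \<in> minorants (frontier R) p" using assms(2,3) by (auto simp: minorants_def max_def)
  fix z assume "z \<in> R"
  then show "kmu R z f1 \<le> kmu R z ?f" "kmu R z f2 \<le> kmu R z ?f"
    using assms by (auto simp: minorants_def intro!: radon_mono[OF radon_kernels(1)] c)
qed

text \<open>The competitor \<open>w\<close> below is the Poisson modification of \<open>p\<close> in \<open>R\<close>.\<close>

lemma pure_poisson:
  assumes pq: "(p, q) \<in> hyperharmonic_pairs H UNIV" "\<And>x. 0 \<le> p x" "\<And>x. 0 \<le> q x"
    and min: "\<And>w x. (w, q) \<in> hyperharmonic_pairs H UNIV \<Longrightarrow> (\<And>z. 0 \<le> w z) \<Longrightarrow> p x \<le> w x"
    and R: "biregular H R"
    and qr: "continuous_on (frontier R) qr" "\<And>z. z \<in> closure R \<Longrightarrow> q z = ereal (qr z)"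
      "\<And>z. z \<in> R \<Longrightarrow> kka R z qr = qr z"
  defines "A \<equiv> minorants (frontier R) p"
  assumes xR: "x0 \<in> R"
  shows "p x0 = (SUP f\<in>A. ereal (kmu R x0 f + knu R x0 qr))"
proof -
  note o = biregular_open[OF R]
  have cl: "z \<in> closure R" if "z \<in> frontier R \<or> z \<in> R" for z
    using that closure_subset[of R] by (auto simp: frontier_def)
  define U where "U f z = kmu R z f + knu R z qr" for f z
  define P where "P z = (SUP f\<in>A. ereal (U f z))" for z
  define w where "w z = (if z \<in> R then P z else p z)" for z
  have Ac: "continuous_on (frontier R) f" if "f \<in> A" for f using that by (simp add: A_def minorants_def)
  have A0: "(\<lambda>z. 0) \<in> A" using pq(2) by (auto simp: A_def minorants_def zero_ereal_def[symmetric])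
  have qrn: "0 \<le> qr z" if "z \<in> frontier R" for z using pq(3)[of z] qr(2)[of z] cl that by auto
  have P0: "0 \<le> P z" if "z \<in> R" for z
  proof -
    have "0 \<le> knu R z qr" using radon_nonneg[OF radon_kernels(2)[OF R that] qr(1)] qrn by blast
    then have "0 \<le> ereal (U (\<lambda>z. 0) z)" using kernel_zero(1)[OF R that] by (simp add: U_def)
    also have "\<dots> \<le> P z" unfolding P_def by (rule SUP_upper[OF A0])
    finally show ?thesis .
  qed
  have Pp: "P z \<le> p z" if z: "z \<in> R" for z
    unfolding P_def
  proof (rule SUP_least)
    fix f assume f: "f \<in> A"
    have "ereal (U f z) = ereal (kmu R z f) + ereal (knu R z qr)" by (simp add: U_def)
    also have "\<dots> \<le> imu R z p + inu R z q"
      using f qr cl by (intro add_mono upper_integralI) (auto simp: A_def minorants_def)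
    also have "\<dots> \<le> p z" by (rule hyperharmonic_pairD(1)[OF pq(1) R _ z]) simp
    finally show "ereal (U f z) \<le> p z" .
  qed
  have wp: "w z \<le> p z" for z using Pp by (simp add: w_def)
  have w0: "0 \<le> w z" for z using P0 pq(2) by (simp add: w_def)
  have Uc: "continuous_on R (U f)" if "f \<in> A" for f
    using solution(3)[OF R Ac[OF that] qr(1)] by (simp add: U_def)
  have plsc: "lsc_on UNIV p" and qlsc: "lsc_on UNIV q" using pq(1) by (auto simp: hyperharmonic_pairs_def)
  \<comment> \<open>The boundary of \<open>R\<close> is the delicate place. From inside, the
    solution for a bump with value \<open>e\<close> at \<open>x\<close>, where \<open>e\<close> lies
    above the level, bounds \<open>w\<close> from below and tends to \<open>e\<close>; from outside
    \<open>w\<close> is \<open>p\<close>. Negative levels are settled by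
    \<open>w \<ge> 0\<close>.\<close>
  have wlsc: "lsc_on UNIV w"
  proof (rule lsc_on_UNIV_I)
    fix x t assume t: "t < w x"
    show "\<forall>\<^sub>F z in nhds x. t < w z"
    proof (cases "x \<in> R")
      case True
      have "lsc_on R P" unfolding P_def using Uc by (rule lsc_SUP)
      then have "\<forall>\<^sub>F z in nhds x. z \<in> R \<longrightarrow> t < P z" using t True by (intro lsc_onD) (auto simp: w_def)
      moreover have "\<forall>\<^sub>F z in nhds x. z \<in> R" using o True by (simp add: eventually_nhds_in_open)
      ultimately show ?thesis by eventually_elim (simp add: w_def)
    next
      case False
      then have "\<forall>\<^sub>F z in nhds x. z \<in> UNIV \<longrightarrow> t < p z" using t by (intro lsc_onD[OF plsc]) (auto simp: w_def)
      then have pe: "\<forall>\<^sub>F z in nhds x. t < p z" by simp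
      consider "t < 0" | "x \<notin> closure R" | "x \<in> frontier R" "0 \<le> t"
        using False o by (cases "t < 0"; cases "x \<in> closure R") (auto simp: frontier_def interior_open)
      then show ?thesis
      proof cases
        case 1
        then show ?thesis using w0 order_less_le_trans by (intro always_eventually) blast
      next
        case 2
        then have "\<forall>\<^sub>F z in nhds x. z \<in> - closure R" by (intro eventually_nhds_in_open) auto
        with pe show ?thesis by eventually_elim (use cl in \<open>auto simp: w_def\<close>)
      next
        case 3
        have tp: "t < p x" using t False by (simp add: w_def)
        then obtain r where r: "t = ereal r" using 3(2) by (cases t) auto
        obtain e where e: "r < e" "ereal e < p x"
          using ereal_dense2[OF tp] r by auto
        have "0 \<le> e" using 3(2) r e(1) by (simp add: zero_ereal_def)
        then obtain f where f: "continuous_on (frontier R) f"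
            "\<forall>z\<in>frontier R. 0 \<le> f z \<and> ereal (f z) \<le> p z" "f x = e"
          using lsc_bump[OF biregular_compact_frontier[OF R] lsc_on_subset[OF plsc] pq(2) 3(1) e(2)] by auto
        then have fA: "f \<in> A" by (simp add: A_def minorants_def)
        have "(U f \<longlongrightarrow> e) (at x within R)"
          using solution(2)[OF R f(1) qr(1)] 3(1) f(3) by (auto simp: has_boundary_values_def U_def[abs_def])
        from order_tendstoD(1)[OF this e(1)] have "\<forall>\<^sub>F z in nhds x. z \<noteq> x \<longrightarrow> z \<in> R \<longrightarrow> r < U f z"
          by (simp add: eventually_at_filter)
        with pe show ?thesis
        proof eventually_elim
          case (elim z)
          show ?case
          proof (cases "z \<in> R")
            case True
            then have "t < ereal (U f z)" using elim False r by auto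
            also have "\<dots> \<le> P z" unfolding P_def by (rule SUP_upper[OF fA])
            finally show ?thesis using True by (simp add: w_def)
          qed (use elim in \<open>simp add: w_def\<close>)
        qed
      qed
    qed
  qed
  have hyp: "(w, q) \<in> hyperharmonic_pairs H UNIV"
  proof (rule hyperharmonic_pairI)
    show "lsc_on UNIV w" "lsc_on UNIV q" by fact+
    show "w x \<noteq> -\<infinity>" "q x \<noteq> -\<infinity>" for x using w0[of x] pq(3)[of x] by auto
    fix R2 x assume R2: "biregular H R2" "closure R2 \<subseteq> UNIV" "x \<in> R2"
    show "ika R2 x q \<le> q x" by (rule hyperharmonic_pairD(2)[OF pq(1) R2])
    note o2 = biregular_open[OF R2(1)]
    show "imu R2 x w + inu R2 x q \<le> w x"
    proof (cases "x \<in> R")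
      case False
      have "imu R2 x w + inu R2 x q
          \<le> imu R2 x p + inu R2 x q"
        by (intro add_right_mono upper_integral_mono wp)
      also have "\<dots> \<le> p x" by (rule hyperharmonic_pairD(1)[OF pq(1) R2])
      finally show ?thesis using False by (simp add: w_def)
    next
      case x: True
      show ?thesis
      proof (rule upper_integral_add_le[OF radon_kernels(1,2)[OF R2(1,3)] w0 pq(3)])
        fix f g assume f: "continuous_on (frontier R2) f" "\<And>z. z \<in> frontier R2 \<Longrightarrow> ereal (f z) \<le> w z"
          and g: "continuous_on (frontier R2) g" "\<And>z. z \<in> frontier R2 \<Longrightarrow> ereal (g z) \<le> q z"
        \<comment> \<open>\<open>u\<close> solves the problem on \<open>R2\<close> with the data
          whose integral at \<open>x\<close> is to be bounded; it suffices to compare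
          \<open>u\<close> with \<open>P\<close> on \<open>R \<inter> R2\<close> by the minimum
          principle.\<close>
        define u where "u z = kmu R2 z f + knu R2 z g" for z
        define v where "v z = kka R2 z g" for z
        have uv: "(u, v) \<in> H R2" "has_boundary_values R2 u f" "continuous_on R2 u"
          using solution[OF R2(1) f(1) g(1)] by (simp_all add: u_def[abs_def] v_def[abs_def])
        have up: "ereal (u z) \<le> p z" if z: "z \<in> R2" for z
        proof -
          have "ereal (u z) = ereal (kmu R2 z f) + ereal (knu R2 z g)" by (simp add: u_def)
          also have "\<dots> \<le> imu R2 z p + inu R2 z q"
            using f(2) wp g(2) by (intro add_mono upper_integralI f(1) g(1)) (auto intro: order_trans)
          also have "\<dots> \<le> p z" by (rule hyperharmonic_pairD(1)[OF pq(1) R2(1,2) z])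
          finally show ?thesis .
        qed
        \<comment> \<open>The second components are compared beforehand because their
          \<open>\<nu>\<close>-integrals enter the mean values of the first ones.\<close>
        have vq: "v z \<le> qr z" if z: "z \<in> R2" "z \<in> R" for z
        proof -
          have "ereal (v z) \<le> ika R2 z q"
            unfolding v_def by (rule upper_integralI[OF g])
          also have "\<dots> \<le> q z" by (rule hyperharmonic_pairD(2)[OF pq(1) R2(1,2) z(1)])
          finally show ?thesis using qr(2)[of z] cl z(2) by auto
        qed
        define W where "W = R \<inter> R2"
        have W: "open W" "compact (closure W)" "W \<subseteq> R" "W \<subseteq> R2" "x \<in> W"
          using o o2 x R2(3) compact_Int_closed[OF biregular_compact[OF R] closed_closure, of W]
            closure_mono[of W R] by (auto simp: W_def inf_absorb2)
        \<comment> \<open>This is \<open>P - u\<close> as a supremum of continuous real functions,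
          so that no infinite value is subtracted from.\<close>
        define s where "s z = (SUP f\<in>A. ereal (U f z - u z))" for z
        have sge: "ereal (U f z - u z) \<le> s z" if "f \<in> A" for f z
          unfolding s_def by (rule SUP_upper[OF that])
        have "0 \<le> s x"
        proof (rule minimum1[OF W(1,2) _ _ _ _ W(5)])
          have dc: "continuous_on W (\<lambda>z. U f z - u z)" if "f \<in> A" for f
            using Uc[OF that] uv(3) W(3,4) by (intro continuous_on_diff) (auto intro: continuous_on_subset)
          then show "lsc_on W s" unfolding s_def by (rule lsc_SUP)
          show "s z \<noteq> -\<infinity>" for z using sge[OF A0, of z] by auto
          fix R' x' assume R': "biregular H R'" "closure R' \<subseteq> W" "x' \<in> R'"
          have fW: "frontier R' \<subseteq> W" using R'(2) by (auto simp: frontier_def)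
          note r' = radon_kernels[OF R'(1,3)]
          show "imu R' x' s \<le> s x'"
          proof (rule upper_integral_le)
            fix \<phi> assume \<phi>: "continuous_on (frontier R') \<phi>" "\<And>z. z \<in> frontier R' \<Longrightarrow> ereal (\<phi> z) \<le> s z"
            show "ereal (kmu R' x' \<phi>) \<le> s x'"
            proof (rule ereal_le_epsilon2)
              fix e :: real assume e: "0 < e"
              \<comment> \<open>A single member comes within \<open>e\<close> of
                \<open>\<phi>\<close> on the whole compact boundary, so the mean value formula can
                be used for that member; mass at most 1 keeps the error below
                \<open>e\<close>.\<close>
              have "\<exists>h\<in>(\<lambda>f z. U f z - u z) ` A. \<forall>z\<in>frontier R'. \<phi> z - e < h z"
              proof (rule directed_family_exceeds[OF biregular_compact_frontier[OF R'(1)]])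
                show "(\<lambda>f z. U f z - u z) ` A \<noteq> {}" using A0 by auto
                show "continuous_on (frontier R') h" if "h \<in> (\<lambda>f z. U f z - u z) ` A" for h
                  using that dc continuous_on_subset[OF _ fW] by auto
                show "continuous_on (frontier R') (\<lambda>z. \<phi> z - e)" by (intro continuous_intros \<phi>(1))
                fix h1 h2 assume "h1 \<in> (\<lambda>f z. U f z - u z) ` A" "h2 \<in> (\<lambda>f z. U f z - u z) ` A"
                then obtain f1 f2 where f12: "f1 \<in> A" "f2 \<in> A" "h1 = (\<lambda>z. U f1 z - u z)" "h2 = (\<lambda>z. U f2 z - u z)"
                  by blast
                obtain f3 where f3: "f3 \<in> A"
                    "\<And>z. z \<in> R \<Longrightarrow> kmu R z f1 \<le> kmu R z f3 \<and> kmu R z f2 \<le> kmu R z f3"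
                  using minorants_directed[OF R f12(1,2)[unfolded A_def], folded A_def] by blast
                have "h1 z \<le> U f3 z - u z \<and> h2 z \<le> U f3 z - u z" if "z \<in> frontier R'" for z
                  using f3(2)[of z] f12(3,4) that fW W(3) by (auto simp: U_def)
                then show "\<exists>h\<in>(\<lambda>f z. U f z - u z) ` A. \<forall>z\<in>frontier R'. h1 z \<le> h z \<and> h2 z \<le> h z"
                  using f3(1) by (intro bexI[of _ "\<lambda>z. U f3 z - u z"]) auto
              next
                fix z assume "z \<in> frontier R'"
                then have "ereal (\<phi> z - e) < s z" using \<phi>(2)[of z] e by (cases "s z") auto
                then show "\<exists>h\<in>(\<lambda>f z. U f z - u z) ` A. \<phi> z - e < h z"
                  by (auto simp: s_def less_SUP_iff)
              qed
              then obtain f1 where f1: "f1 \<in> A" "\<And>z. z \<in> frontier R' \<Longrightarrow> \<phi> z - e < U f1 z - u z" by blast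
              have Uf: "(U f1, \<lambda>z. kka R z qr) \<in> H R"
                using solution(1)[OF R Ac[OF f1(1)] qr(1)] by (simp add: U_def[abs_def])
              have m1: "U f1 x' = kmu R' x' (U f1) + knu R' x' (\<lambda>z. kka R z qr)"
                using solution_mean(1)[OF o Uf R'(1) _ R'(3)] R'(2) W(3) by blast
              have m2: "u x' = kmu R' x' u + knu R' x' v"
                using solution_mean(1)[OF o2 uv(1) R'(1) _ R'(3)] R'(2) W(4) by blast
              have c1: "continuous_on (frontier R') (U f1)" "continuous_on (frontier R') (\<lambda>z. kka R z qr)"
                "continuous_on (frontier R') u" "continuous_on (frontier R') v"
                using pair_continuous[OF o Uf] pair_continuous[OF o2 uv(1)] fW W(3,4)
                by (auto intro: continuous_on_subset)
              have "knu R' x' v \<le> knu R' x' (\<lambda>z. kka R z qr)"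
              proof (rule radon_mono[OF r'(2) c1(4,2)])
                fix z assume "z \<in> frontier R'"
                then have "z \<in> R" "z \<in> R2" using fW W(3,4) by auto
                then show "v z \<le> kka R z qr" using vq qr(3) by simp
              qed
              moreover have "kmu R' x' (\<lambda>z. \<phi> z - e) \<le> kmu R' x' (\<lambda>z. U f1 z - u z)"
                using f1(2) by (intro radon_mono[OF r'(1)] continuous_intros \<phi>(1) c1) (auto intro: less_imp_le)
              moreover have "kmu R' x' (\<lambda>z. \<phi> z - e) = kmu R' x' \<phi> - e * kmu R' x' (\<lambda>z. 1)"
                by (rule radon_add_const(2)[OF r'(1) \<phi>(1)])
              moreover have "kmu R' x' (\<lambda>z. U f1 z - u z) = kmu R' x' (U f1) - kmu R' x' u"
                by (rule radon_diff[OF r'(1) c1(1,3)])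
              moreover have "e * kmu R' x' (\<lambda>z. 1) \<le> e * 1"
                using e kmu_one[OF R'(1,3)] by (intro mult_left_mono) auto
              ultimately have "kmu R' x' \<phi> \<le> U f1 x' - u x' + e" using m1 m2 by linarith
              then have "ereal (kmu R' x' \<phi>) \<le> ereal (U f1 x' - u x') + ereal e" by simp
              also have "\<dots> \<le> s x' + ereal e" by (intro add_right_mono sge f1(1))
              finally show "ereal (kmu R' x' \<phi>) \<le> s x' + ereal e" .
            qed
          qed
        next
          fix z and t :: real assume z: "z \<in> frontier W" and t: "t < 0"
          \<comment> \<open>Boundary points of \<open>R \<inter> R2\<close> inside \<open>R2\<close>
            lie outside \<open>R\<close>, where \<open>w\<close> is \<open>p\<close> and dominates
            \<open>u\<close>; the others are on the boundary of \<open>R2\<close>, where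
            \<open>u\<close> tends to the minorant \<open>f\<close> of \<open>w\<close>.\<close>
          have "\<exists>L. (u \<longlongrightarrow> L) (at z within W) \<and> ereal L \<le> w z"
          proof (cases "z \<in> R2")
            case True
            have "z \<notin> W" using z interior_open[OF W(1)] by (simp add: frontier_def)
            then have "z \<notin> R" using True by (simp add: W_def)
            moreover have "isCont u z" using uv(3) o2 True continuous_on_eq_continuous_at by blast
            then have "(u \<longlongrightarrow> u z) (at z within W)"
              unfolding isCont_def by (rule tendsto_within_subset) simp
            ultimately show ?thesis using up[OF True] by (auto simp: w_def)
          next
            case False
            have "z \<in> closure R2" using z closure_mono[OF W(4)] by (auto simp: frontier_def)
            then have "z \<in> frontier R2" using False o2 by (simp add: frontier_def interior_open)
            then show ?thesis using boundary_subset_tendsto[OF uv(2) W(4)] f(2) by blast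
          qed
          then obtain L where L: "(u \<longlongrightarrow> L) (at z within W)" "ereal L \<le> w z" by blast
          \<comment> \<open>The allowance \<open>t < 0\<close> is halved: \<open>w\<close> stays
            above \<open>L + t / 2\<close> and \<open>u\<close> below
            \<open>L - t / 2\<close>.\<close>
          have "ereal (L + t / 2) < w z" using L(2) t by (cases "w z") auto
          from lsc_onD[OF wlsc UNIV_I this] have "\<forall>\<^sub>F x in nhds z. ereal (L + t / 2) < w x" by simp
          then have "\<forall>\<^sub>F x in at z within W. ereal (L + t / 2) < w x"
            by (simp add: eventually_at_filter eventually_mono)
          moreover have "\<forall>\<^sub>F x in at z within W. u x < L - t / 2"
            by (rule order_tendstoD(2)[OF L(1)]) (use t in simp)
          moreover have "\<forall>\<^sub>F x in at z within W. x \<in> W" by (simp add: eventually_at_filter)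
          ultimately show "\<forall>\<^sub>F x in at z within W. ereal t < s x"
          proof eventually_elim
            case (elim x)
            then have "ereal (L + t / 2) < P x" using W(3) by (auto simp: w_def)
            then obtain f1 where f1: "f1 \<in> A" "L + t / 2 < U f1 x" by (auto simp: P_def less_SUP_iff)
            then have "ereal t < ereal (U f1 x - u x)" using elim(2) by simp
            also have "\<dots> \<le> s x" by (rule sge[OF f1(1)])
            finally show ?case .
          qed
        qed
        also have "s x \<le> P x - ereal (u x)"
          unfolding s_def
        proof (rule SUP_least)
          fix f1 assume "f1 \<in> A"
          then have "ereal (U f1 x) \<le> P x" unfolding P_def by (rule SUP_upper)
          then have "ereal (U f1 x) - ereal (u x) \<le> P x - ereal (u x)" by (rule ereal_minus_mono) simp
          then show "ereal (U f1 x - u x) \<le> P x - ereal (u x)" by simp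
        qed
        finally have "ereal (u x) \<le> P x" by (cases "P x") auto
        then show "ereal (kmu R2 x f + knu R2 x g) \<le> w x" using x by (simp add: u_def w_def)
      qed
    qed
  qed
  have "p x0 \<le> w x0" by (rule min[OF hyp w0])
  then have "p x0 = w x0" using wp[of x0] by (rule order_antisym)
  then show ?thesis using xR by (simp add: w_def P_def U_def)
qed

end

section \<open>Joint limits and regularization in two variables\<close>

text \<open>The product is first countable, so sequences suffice. Uniformity on \<open>N\<close>
  controls the change of \<open>y\<close> at moving points, continuity of \<open>f y0\<close> the
  change of \<open>x\<close>.\<close>

lemma jointly_continuous_of_uniform_limits:
  fixes f :: "'a::{first_countable_topology,t2_space} \<Rightarrow> 'a \<Rightarrow> real"
  assumes N: "open N" "x0 \<in> N" and c: "isCont (f y0) x0"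
    and u: "\<And>Y. Y \<longlonglongrightarrow> y0 \<Longrightarrow> uniform_limit N (\<lambda>n. f (Y n)) (f y0) sequentially"
  shows "((\<lambda>(x, y). f y x) \<longlongrightarrow> f y0 x0) (nhds (x0, y0))"
proof (rule tendstoI)
  fix e :: real assume e: "0 < e"
  have "eventually (\<lambda>w. dist (case w of (x, y) \<Rightarrow> f y x) (f y0 x0) < e) (inf (nhds (x0, y0)) (principal UNIV))"
  proof (rule sequentially_imp_eventually_nhds_within, safe)
    fix S :: "nat \<Rightarrow> 'a \<times> 'a" assume S: "S \<longlonglongrightarrow> (x0, y0)"
    have X: "(\<lambda>n. fst (S n)) \<longlonglongrightarrow> x0" and Y: "(\<lambda>n. snd (S n)) \<longlonglongrightarrow> y0"
      using tendsto_fst[OF S] tendsto_snd[OF S] by simp_all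
    have "\<forall>\<^sub>F n in sequentially. \<forall>x\<in>N. dist (f (snd (S n)) x) (f y0 x) < e / 2"
      using uniform_limitD[OF u[OF Y], of "e/2"] e by simp
    moreover have "\<forall>\<^sub>F n in sequentially. fst (S n) \<in> N" using topological_tendstoD[OF X N] .
    moreover have "(\<lambda>n. f y0 (fst (S n))) \<longlonglongrightarrow> f y0 x0" using isCont_tendsto_compose[OF c X] .
    then have "\<forall>\<^sub>F n in sequentially. dist (f y0 (fst (S n))) (f y0 x0) < e / 2"
      using tendstoD[of _ _ _ "e/2"] e by simp
    ultimately show "\<forall>\<^sub>F n in sequentially. dist (case S n of (x, y) \<Rightarrow> f y x) (f y0 x0) < e"
    proof eventually_elim
      case (elim n)
      then have "dist (f (snd (S n)) (fst (S n))) (f y0 (fst (S n))) < e / 2" by blast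
      then show ?case
        using elim(3) dist_triangle[of "f (snd (S n)) (fst (S n))" "f y0 x0" "f y0 (fst (S n))"]
        by (simp add: case_prod_beta)
    qed
  qed
  then show "eventually (\<lambda>w. dist (case w of (x, y) \<Rightarrow> f y x) (f y0 x0) < e) (nhds (x0, y0))" by simp
qed

lemma uniform_limit_transfer:
  assumes "uniform_limit N f h F" "\<forall>\<^sub>F n in F. \<forall>x\<in>N. f n x = g n x" "\<And>x. x \<in> N \<Longrightarrow> h x = k x"
  shows "uniform_limit N g k F"
  using assms(1) uniform_limit_cong[of N f g F h k, OF assms(2,3)] by blast

lemma lsc_regularization_less:
  assumes "t < lsc_regularization \<Phi> w"
  shows "eventually (\<lambda>w. t < lsc_regularization \<Phi> w) (nhds w)"
proof -
  obtain t' where t': "t < t'" "t' < lsc_regularization \<Phi> w" using dense[OF assms] by blast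
  then have "eventually (\<lambda>w. t' < \<Phi> w) (nhds w)"
    unfolding lsc_regularization_def by (intro less_LiminfD)
  then have "eventually (\<lambda>w. eventually (\<lambda>w. t' < \<Phi> w) (nhds w)) (nhds w)" by (simp add: eventually_eventually)
  then show ?thesis
  proof eventually_elim
    case (elim w)
    then have "t' \<le> lsc_regularization \<Phi> w" unfolding lsc_regularization_def
      by (intro Liminf_bounded) (auto elim: eventually_mono)
    with t'(1) show ?case by (rule order_less_le_trans)
  qed
qed

lemma lsc_regularization_nonneg: "(\<And>w. 0 \<le> \<Phi> w) \<Longrightarrow> 0 \<le> lsc_regularization \<Phi> w"
  unfolding lsc_regularization_def by (intro Liminf_bounded) simp

text \<open>Near each \<open>(z, y0)\<close> one half of \<open>e\<close> pays for the lower limit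
  and the other for the variation of \<open>f\<close>; the tube lemma makes the neighbourhood of
  \<open>y0\<close> common to all of \<open>K\<close>. A minorant of the regularization thus becomes
  one for all nearby \<open>y\<close>, whose supermean inequalities can be used.\<close>

lemma tube_minorant:
  fixes \<Phi> :: "'a::topological_space \<times> 'b::topological_space \<Rightarrow> ereal"
  assumes "compact K" "continuous_on K f" and le: "\<And>z. z \<in> K \<Longrightarrow> ereal (f z) \<le> lsc_regularization \<Phi> (z, y0)"
    and e: "0 < e"
  shows "\<exists>V. open V \<and> y0 \<in> V \<and> (\<forall>z\<in>K. \<forall>y\<in>V. ereal (f z - e) \<le> \<Phi> (z, y))"
proof -
  define Q where "Q z A B \<longleftrightarrow> open A \<and> open B \<and> z \<in> A \<and> y0 \<in> B \<and>
      (\<forall>z'\<in>A \<inter> K. \<forall>y\<in>B. ereal (f z' - e) \<le> \<Phi> (z', y))" for z A B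
  have "\<exists>A B. Q z A B" if z: "z \<in> K" for z
  proof -
    have "ereal (f z - e / 2) < ereal (f z)" using e by simp
    also have "\<dots> \<le> lsc_regularization \<Phi> (z, y0)" by (rule le[OF z])
    finally have "eventually (\<lambda>w. ereal (f z - e / 2) < \<Phi> w) (nhds (z, y0))"
      unfolding lsc_regularization_def by (rule less_LiminfD)
    then obtain S where S: "open S" "(z, y0) \<in> S" "\<And>w. w \<in> S \<Longrightarrow> ereal (f z - e / 2) < \<Phi> w"
      unfolding eventually_nhds by blast
    obtain A B where AB: "open A" "open B" "z \<in> A" "y0 \<in> B" "A \<times> B \<subseteq> S"
      using open_prod_elim[OF S(1,2)] by (metis mem_Sigma_iff)
    obtain T where T: "open T" "T \<inter> K = f -` {..<f z + e / 2} \<inter> K"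
      using assms(2)[unfolded continuous_on_open_invariant, rule_format, of "{..<f z + e / 2}"] by auto
    have "z \<in> T" using T(2) z e by auto
    moreover have "ereal (f z' - e) \<le> \<Phi> (z', y)" if "z' \<in> A \<inter> T \<inter> K" "y \<in> B" for z' y
    proof -
      have "z' \<in> f -` {..<f z + e / 2} \<inter> K" using that T(2) by blast
      then have "ereal (f z' - e) \<le> ereal (f z - e / 2)" by simp
      also have "\<dots> \<le> \<Phi> (z', y)" using S(3)[of "(z', y)"] AB(5) that by (intro less_imp_le) blast
      finally show ?thesis .
    qed
    moreover have "open (A \<inter> T)" using AB(1) T(1) by (rule open_Int)
    ultimately have "Q z (A \<inter> T) B" unfolding Q_def using AB(2-4) by blast
    then show ?thesis by blast
  qed
  then obtain A B where "\<And>z. z \<in> K \<Longrightarrow> Q z (A z) (B z)" by metis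
  then have AB: "open (A z)" "open (B z)" "z \<in> A z" "y0 \<in> B z"
      "\<And>z' y. z' \<in> A z \<Longrightarrow> z' \<in> K \<Longrightarrow> y \<in> B z \<Longrightarrow> ereal (f z' - e) \<le> \<Phi> (z', y)"
    if "z \<in> K" for z
    using that unfolding Q_def by blast+
  \<comment> \<open>The coordinates are exchanged to suit the tube lemma.\<close>
  define W where "W = (\<Union>z\<in>K. B z \<times> A z)"
  have W: "open W" unfolding W_def using AB(1,2) by (intro open_UN ballI open_Times)
  have yW: "{y0} \<times> K \<subseteq> W" using AB(3,4) unfolding W_def by blast
  obtain V where V: "y0 \<in> V" "open V" "V \<times> K \<subseteq> W"
    using Elementary_Topology.tube_lemma[OF \<open>compact K\<close> W yW] by blast
  have "ereal (f z - e) \<le> \<Phi> (z, y)" if zy: "z \<in> K" "y \<in> V" for z y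
  proof -
    have "(y, z) \<in> W" using V(3) zy by blast
    then obtain z0 where "z0 \<in> K" "y \<in> B z0" "z \<in> A z0" by (auto simp: W_def)
    then show ?thesis using AB(5) zy(1) by blast
  qed
  then show ?thesis using V(1,2) by blast
qed

text \<open>The way back from \<open>tube_minorant\<close>: an integral that is continuous in
  \<open>z\<close> and a lower bound for all \<open>y\<close> near \<open>y0\<close> also bounds the
  lower limit in both variables.\<close>

lemma lsc_regularization_geI:
  fixes \<Phi> :: "'a::topological_space \<times> 'b::topological_space \<Rightarrow> ereal"
  assumes "open R" "x \<in> R" "continuous_on R a" "open V" "y0 \<in> V"
    and le: "\<And>z y. z \<in> R \<Longrightarrow> y \<in> V \<Longrightarrow> ereal (a z) \<le> \<Phi> (z, y)"
  shows "ereal (a x) \<le> lsc_regularization \<Phi> (x, y0)"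
  unfolding lsc_regularization_def le_Liminf_iff
proof (intro allI impI)
  fix t assume t: "t < ereal (a x)"
  have "lsc_on R (\<lambda>x. ereal (a x))" using lsc_on_continuous[OF continuous_on_ereal[OF assms(3)]] .
  from lsc_onD[OF this assms(2) t]
  have "\<forall>\<^sub>F z in nhds x. z \<in> R \<longrightarrow> t < ereal (a z)" .
  moreover have "\<forall>\<^sub>F z in nhds x. z \<in> R" using assms(1,2) by (simp add: eventually_nhds_in_open)
  ultimately have "\<forall>\<^sub>F z in nhds x. z \<in> R \<and> t < ereal (a z)" by eventually_elim simp
  then obtain S where S: "open S" "x \<in> S" "\<And>z. z \<in> S \<Longrightarrow> z \<in> R \<and> t < ereal (a z)"
    unfolding eventually_nhds by blast
  have "t < \<Phi> w" if w: "w \<in> S \<times> V" for w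
  proof -
    obtain z y where zy: "w = (z, y)" "z \<in> S" "y \<in> V" using w by blast
    then show ?thesis using S(3)[OF zy(2)] le[of z y] by (auto intro: order_less_le_trans)
  qed
  moreover have "open (S \<times> V)" "(x, y0) \<in> S \<times> V" using S assms(4,5) by (auto intro: open_Times)
  ultimately show "\<forall>\<^sub>F w in nhds (x, y0). t < \<Phi> w" unfolding eventually_nhds by blast
qed

text \<open>On a regular set away from \<open>y\<close> the Poisson formula exhibits
  \<open>p\<close> as a directed supremum of harmonic functions plus a continuous function. On a
  component that supremum is harmonic or identically infinite, and finiteness of \<open>p\<close> on
  a dense set excludes the latter.\<close>

lemma (in biharmonic) pure_biharmonic:
  assumes pure: "pure_hyperharmonic H q p" and sup: "p \<in> superharmonic (hyperharmonic1 H)"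
    and q: "\<And>x. 0 \<le> q x" "\<And>x. x \<noteq> y \<Longrightarrow> q x = ereal (qr x)" "qr \<in> harmonic2 H (- {y})"
  defines "pr \<equiv> \<lambda>x. real_of_ereal (p x)"
  shows "x \<noteq> y \<Longrightarrow> p x = ereal (pr x)" "continuous_on (- {y}) pr"
    "biregular H R \<Longrightarrow> closure R \<subseteq> - {y} \<Longrightarrow> x \<in> R \<Longrightarrow> pr x = kmu R x pr + knu R x qr"
proof -
  have oy: "open (- {y})" by (simp add: open_Compl)
  have pq: "(p, q) \<in> hyperharmonic_pairs H UNIV" "\<And>x. 0 \<le> p x"
    and min0: "\<And>w x. w \<in> hyperharmonic1 H UNIV \<Longrightarrow> (\<forall>x. 0 \<le> w x) \<Longrightarrow> (w, q) \<in> hyperharmonic_pairs H UNIV \<Longrightarrow> p x \<le> w x"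
    using pure by (auto simp: pure_hyperharmonic_def Let_def)
  have min: "p x \<le> w x" if "(w, q) \<in> hyperharmonic_pairs H UNIV" "\<And>z. 0 \<le> w z" for w x
    using min0[OF hyperharmonic_pair_hyperharmonic1[OF that(1) q(1)] _ that(1)] that(2) by blast
  have dense: "UNIV \<subseteq> closure {x. \<bar>p x\<bar> \<noteq> \<infinity>}" using sup by (simp add: superharmonic_def dense_finite_def)
  have qc: "continuous_on (- {y}) qr" by (rule B2.harmonic_continuous[OF oy q(3)])
  have P: "p x = (SUP f\<in>minorants (frontier R) p.
        ereal (kmu R x f + knu R x qr))"
    and qcf: "continuous_on (frontier R) qr"
    if R: "biregular H R" "closure R \<subseteq> - {y}" "x \<in> R" for R x
  proof -
    show c: "continuous_on (frontier R) qr"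
      using R(2) by (intro continuous_on_subset[OF qc]) (auto simp: frontier_def)
    show "p x = (SUP f\<in>minorants (frontier R) p.
        ereal (kmu R x f + knu R x qr))"
    proof (rule pure_poisson[where q = q, OF pq q(1)])
      show "p x \<le> w x" if "(w, q) \<in> hyperharmonic_pairs H UNIV" "\<And>z. 0 \<le> w z" for w x by (rule min[OF that])
      show "q z = ereal (qr z)" if "z \<in> closure R" for z using q(2)[of z] R(2) that by auto
      show "kka R z qr = qr z" if "z \<in> R" for z
        by (rule harmonic2_mean[OF oy q(3) decoupled[OF R(1)] R(1,2) that])
    qed (use R c in auto)
  qed
  have loc: "\<exists>U h. open U \<and> x \<in> U \<and> continuous_on U h \<and> (\<forall>z\<in>U. p z = ereal (h z))" if x: "x \<noteq> y" for x
  proof -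
    obtain R where R: "biregular H R" "x \<in> R" "closure R \<subseteq> - {y}"
      using biregular_nhd[OF oy, of x] x by auto
    note o = biregular_open[OF R(1)]
    define A where "A = minorants (frontier R) p"
    have A0: "(\<lambda>z. 0) \<in> A" using pq(2) by (auto simp: A_def minorants_def zero_ereal_def[symmetric])
    define U where "U = connected_component_set R x"
    have U: "open U" "connected U" "x \<in> U" "U \<subseteq> R"
      using component_facts[OF B1.locally_connected_space o R(2)] by (auto simp: U_def)
    define n where "n z = knu R z qr" for z
    have pP: "p z = (SUP f\<in>A. ereal (kmu R z f)) + ereal (n z)" if "z \<in> U" for z
    proof -
      have "p z = (SUP f\<in>A. ereal (kmu R z f) + ereal (n z))"
        using P[OF R(1,3)] that U(4) by (auto simp: A_def minorants_def n_def)
      also have "\<dots> = (SUP f\<in>A. ereal (kmu R z f)) + ereal (n z)"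
        using A0 by (intro SUP_ereal_add_left) auto
      finally show ?thesis .
    qed
    have "(\<forall>z\<in>U. (SUP g\<in>(\<lambda>f z. kmu R z f) ` A. ereal (g z)) = \<infinity>) \<or>
        (\<exists>h\<in>harmonic1 H U. \<forall>z\<in>U. (SUP g\<in>(\<lambda>f z. kmu R z f) ` A. ereal (g z)) = ereal (h z))"
    proof (rule B1.directed_sup[OF U(1,2)])
      show "(\<lambda>f z. kmu R z f) ` A \<noteq> {}" using A0 by auto
      show "(\<lambda>f z. kmu R z f) ` A \<subseteq> harmonic1 H U"
        using B1.kernel_harmonic[OF kmu_kernel[OF R(1)] _ U(1,4)] by (auto simp: A_def minorants_def)
      fix h1 h2 assume "h1 \<in> (\<lambda>f z. kmu R z f) ` A" "h2 \<in> (\<lambda>f z. kmu R z f) ` A"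
      then obtain f1 f2 where f12: "f1 \<in> A" "f2 \<in> A" "h1 = (\<lambda>z. kmu R z f1)" "h2 = (\<lambda>z. kmu R z f2)"
        by blast
      obtain f where f: "f \<in> A" "\<And>z. z \<in> R \<Longrightarrow> kmu R z f1 \<le> kmu R z f \<and> kmu R z f2 \<le> kmu R z f"
        using minorants_directed[OF R(1) f12(1,2)[unfolded A_def], folded A_def] by blast
      then show "\<exists>h\<in>(\<lambda>f z. kmu R z f) ` A. \<forall>z\<in>U. h1 z \<le> h z \<and> h2 z \<le> h z"
        using f12(3,4) U(4) by (intro bexI[of _ "\<lambda>z. kmu R z f"]) auto
    qed
    then have "(\<forall>z\<in>U. p z = \<infinity>) \<or> (\<exists>h\<in>harmonic1 H U. \<forall>z\<in>U. p z = ereal (h z + n z))"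
      using pP by (auto simp: image_image)
    moreover have "\<not> (\<forall>z\<in>U. p z = \<infinity>)"
    proof
      assume inf: "\<forall>z\<in>U. p z = \<infinity>"
      have "U \<inter> {x. \<bar>p x\<bar> \<noteq> \<infinity>} \<noteq> {}"
        using dense U(1,3) open_Int_closure_eq_empty[OF U(1), of "{x. \<bar>p x\<bar> \<noteq> \<infinity>}"] by auto
      then show False using inf by auto
    qed
    ultimately obtain h where h: "h \<in> harmonic1 H U" "\<forall>z\<in>U. p z = ereal (h z + n z)" by blast
    have "continuous_on U n"
      unfolding n_def using knu_continuous[OF R(1) qcf[OF R(1,3,2)]] U(4) by (rule continuous_on_subset)
    then have "continuous_on U (\<lambda>z. h z + n z)"
      by (intro continuous_on_add B1.harmonic_continuous[OF U(1) h(1)])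
    then show ?thesis using U(1,3) h(2) by (intro exI[of _ U] exI[of _ "\<lambda>z. h z + n z"]) auto
  qed
  show real: "p x = ereal (pr x)" if "x \<noteq> y" for x
    using loc[OF that] by (auto simp: pr_def)
  have "isCont pr x" if "x \<noteq> y" for x
  proof -
    obtain U h where U: "open U" "x \<in> U" "continuous_on U h" "\<forall>z\<in>U. p z = ereal (h z)"
      using loc[OF \<open>x \<noteq> y\<close>] by blast
    have "continuous_on U pr"
      using continuous_on_cong[of U U pr h] U(3,4) by (simp add: pr_def)
    then show ?thesis using U(1,2) continuous_on_eq_continuous_at by blast
  qed
  then show prc: "continuous_on (- {y}) pr" by (intro continuous_at_imp_continuous_on) auto
  show "pr x = kmu R x pr + knu R x qr" if R: "biregular H R" "closure R \<subseteq> - {y}" "x \<in> R" for R x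
  proof -
    let ?A = "minorants (frontier R) p"
    have pf: "p z = ereal (pr z)" if "z \<in> frontier R" for z
      using R(2) that real[of z] by (auto simp: frontier_def)
    have c: "continuous_on (frontier R) pr"
      using R(2) by (intro continuous_on_subset[OF prc]) (auto simp: frontier_def)
    \<comment> \<open>Now that \<open>p\<close> is real and continuous on the boundary, it is its
      own largest continuous minorant and the supremum becomes an integral.\<close>
    have "p x = ereal (kmu R x pr + knu R x qr)"
      unfolding P[OF R]
    proof (rule antisym)
      show "(SUP f\<in>?A. ereal (kmu R x f + knu R x qr)) \<le> ereal (kmu R x pr + knu R x qr)"
        using radon_mono[OF radon_kernels(1)[OF R(1,3)] _ c] pf by (intro SUP_least) (auto simp: minorants_def)
      show "ereal (kmu R x pr + knu R x qr) \<le> (SUP f\<in>?A. ereal (kmu R x f + knu R x qr))"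
        using c pf by (intro SUP_upper) (auto simp: minorants_def)
    qed
    then show ?thesis by (simp add: pr_def)
  qed
qed

section \<open>Continuity of the kernel\<close>

text \<open>The hypotheses in the form in which they are used; \<open>q_limit\<close> expresses the
  continuity of \<open>q\<close> into the topology of Herve.\<close>

locale pure_kernel = biharmonic H
  for H :: "'a::{t2_space, second_countable_topology} pair_sheaf" +
  fixes q p :: "'a \<Rightarrow> 'a \<Rightarrow> ereal"
  assumes q_hyper: "\<And>y. q y \<in> hyperharmonic2 H UNIV" and q_nonneg: "\<And>y x. 0 \<le> q y x"
    and q_finite: "\<And>y x. x \<noteq> y \<Longrightarrow> q y x \<noteq> \<infinity>"
    and q_harmonic: "\<And>y. (\<lambda>x. real_of_ereal (q y x)) \<in> harmonic2 H (- {y})"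
    and q_limit: "\<And>G y. is_ultrafilter G \<Longrightarrow> G \<le> nhds y \<Longrightarrow> q y = lsc_regularization (\<lambda>x. Lim G (\<lambda>z. q z x))"
    and pure: "\<And>y. pure_hyperharmonic H (q y) (p y)"
    and p_super: "\<And>y. p y \<in> superharmonic (hyperharmonic1 H)"
    and p_continuous: "\<And>x. continuous_on (UNIV - {x}) (\<lambda>y. p y x)"
begin

definition qr where "qr y x = real_of_ereal (q y x)"
definition pr where "pr y x = real_of_ereal (p y x)"

lemma q_real: "x \<noteq> y \<Longrightarrow> q y x = ereal (qr y x)"
  using q_finite[of x y] q_nonneg[of y x] by (cases "q y x") (auto simp: qr_def)

lemma qr_nonneg: "0 \<le> qr y x"
  using q_nonneg[of y x] by (simp add: qr_def real_of_ereal_pos)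

lemma open_punctured: "open (- {y :: 'a})"
  by (simp add: open_Compl)

lemma qr_harmonic: "qr y \<in> harmonic2 H (- {y})"
  using q_harmonic[of y] by (simp add: qr_def[abs_def])

lemma qr_harmonic_on: "open U \<Longrightarrow> y \<notin> U \<Longrightarrow> qr y \<in> harmonic2 H U"
  using B2.harmonic_restrict[OF open_punctured _ _ qr_harmonic] by blast

lemma qr_continuous: "continuous_on (- {y}) (qr y)"
  using B2.harmonic_continuous[OF open_punctured qr_harmonic] .

lemma qr_mean: "biregular H R \<Longrightarrow> closure R \<subseteq> - {y} \<Longrightarrow> x \<in> R \<Longrightarrow> kka R x (qr y) = qr y x"
  using harmonic2_mean[OF open_punctured qr_harmonic decoupled] by blast

lemma frontier_continuous: "continuous_on (- {y}) f \<Longrightarrow> closure R \<subseteq> - {y} \<Longrightarrow> continuous_on (frontier R) f"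
  by (erule continuous_on_subset) (auto simp: frontier_def)

lemma p_nonneg: "0 \<le> p y x"
  and pair: "(p y, q y) \<in> hyperharmonic_pairs H UNIV"
  and p_min: "(w, q y) \<in> hyperharmonic_pairs H UNIV \<Longrightarrow> (\<And>x. 0 \<le> w x) \<Longrightarrow> p y x \<le> w x"
proof -
  show "0 \<le> p y x" "(p y, q y) \<in> hyperharmonic_pairs H UNIV"
    using pure[of y] by (auto simp: pure_hyperharmonic_def Let_def)
  assume "(w, q y) \<in> hyperharmonic_pairs H UNIV" "\<And>x. 0 \<le> w x"
  then show "p y x \<le> w x"
    using pure[of y] hyperharmonic_pair_hyperharmonic1[of w "q y"] q_nonneg
    by (auto simp: pure_hyperharmonic_def Let_def)
qed

lemma pr_facts:
  shows p_real: "x \<noteq> y \<Longrightarrow> p y x = ereal (pr y x)"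
    and pr_continuous: "continuous_on (- {y}) (pr y)"
    and pr_mean: "biregular H R \<Longrightarrow> closure R \<subseteq> - {y} \<Longrightarrow> x \<in> R \<Longrightarrow> pr y x = kmu R x (pr y) + knu R x (qr y)"
  using pure_biharmonic[OF pure[of y] p_super[of y] q_nonneg q_real qr_harmonic]
  unfolding pr_def[abs_def] by blast+

lemma pr_nonneg: "0 \<le> pr y x"
  using p_nonneg[of y x] by (simp add: pr_def real_of_ereal_pos)

text \<open>All \<open>q y\<close> with \<open>y\<close> in \<open>V\<close> are harmonic on the
  domain \<open>U\<close>, so one Harnack constant serves them all.\<close>

lemma separated_component:
  fixes x0 y0 :: 'a
  assumes "x0 \<noteq> y0"
  obtains U V where "open U" "connected U" "x0 \<in> U" "open V" "y0 \<in> V" "U \<inter> V = {}"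
proof -
  obtain N V where NV: "open N" "open V" "x0 \<in> N" "y0 \<in> V" "N \<inter> V = {}" using hausdorff[OF assms] by blast
  note c = component_facts[OF B2.locally_connected_space NV(1,3)]
  show ?thesis by (rule that[OF c(1,2,3) NV(2,4)]) (use c(4) NV(5) in blast)
qed

text \<open>Along an ultrafilter the pointwise limit \<open>L\<close> exists for free, and
  \<open>q y0\<close> is its regularization. The point is that \<open>L\<close> is continuous at
  \<open>x0\<close>, so that regularizing leaves its value there unchanged.\<close>

lemma q_tendsto:
  assumes "x0 \<noteq> y0"
  shows "((\<lambda>y. q y x0) \<longlongrightarrow> q y0 x0) (nhds y0)"
proof (rule tendsto_ultrafilterI)
  fix G assume G: "G \<le> nhds y0" "is_ultrafilter G"
  have Gb: "G \<noteq> bot" using G(2) by (simp add: is_ultrafilter_def)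
  obtain U V where UV: "open U" "connected U" "x0 \<in> U" "open V" "y0 \<in> V" "U \<inter> V = {}"
    using separated_component[OF assms] by blast
  have VG: "eventually (\<lambda>y. y \<in> V) G"
    using eventually_nhds_in_open[OF UV(4,5)] G(1) by (rule filter_leD[rotated])
  define L where "L x = Lim G (\<lambda>y. q y x)" for x
  have L: "((\<lambda>y. q y x) \<longlongrightarrow> L x) G" for x
    using ultrafilter_convergent[OF G(2), of "\<lambda>y. q y x"] tendsto_Lim[OF Gb] unfolding L_def by metis
  have qL: "q y0 x0 = Liminf (nhds x0) L"
    using q_limit[OF G(2,1)] by (simp add: lsc_regularization_def L_def[abs_def])
  \<comment> \<open>Were \<open>L\<close> infinite on all of \<open>U\<close>, so would be its
    regularization at \<open>x0\<close>. A single point of finiteness is enough for Harnack's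
    inequality.\<close>
  have "\<exists>x1\<in>U. L x1 < \<infinity>"
  proof (rule ccontr)
    assume "\<not> ?thesis"
    then have "\<forall>\<^sub>F x in nhds x0. \<infinity> \<le> L x"
      using eventually_nhds_in_open[OF UV(1,3)] by (auto elim!: eventually_mono)
    then have "\<infinity> \<le> q y0 x0" unfolding qL by (rule Liminf_bounded)
    then show False using q_finite[OF assms] by simp
  qed
  then obtain x1 c where x1: "x1 \<in> U" "L x1 < ereal c" using ereal_dense2[of "L _" \<infinity>] by blast
  have cG: "eventually (\<lambda>y. q y x1 < ereal c) G" using order_tendstoD(2)[OF L x1(2)] .
  obtain R where R: "biregular H R" "x0 \<in> R" "closure R \<subseteq> U" using biregular_nhd[OF UV(1,3)] by blast
  obtain C where C: "C \<ge> 0" "\<And>h x. h \<in> harmonic2 H U \<Longrightarrow> \<forall>x\<in>U. 0 \<le> h x \<Longrightarrow> x \<in> closure R \<Longrightarrow> h x \<le> C * h x1"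
    using B2.harnack[OF UV(1,2) x1(1) biregular_compact[OF R(1)] R(3)] by blast
  have bG: "eventually (\<lambda>y. y \<in> V \<and> (\<forall>x\<in>closure R. qr y x \<le> C * c)) G"
    using VG cG
  proof eventually_elim
    case (elim y)
    then have y: "y \<notin> U" "x1 \<noteq> y" using UV(6) x1(1) by auto
    have "qr y x1 \<le> c" using q_real[OF y(2)] elim(2) by simp
    then have "C * qr y x1 \<le> C * c" using C(1) by (rule mult_left_mono)
    then show ?case
      using C(2)[OF qr_harmonic_on[OF UV(1) y(1)]] qr_nonneg elim(1) by (meson order_trans)
  qed
  define h where "h x = real_of_ereal (L x)" for x
  have Lh: "L x = ereal (h x)" if x: "x \<in> closure R" for x
  proof -
    have "eventually (\<lambda>y. q y x \<le> ereal (C * c)) G"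
      using bG
    proof eventually_elim
      case (elim y)
      then have "x \<noteq> y" using UV(6) R(3) x by auto
      then show ?case using q_real[of x y] elim x by simp
    qed
    then have "L x \<le> ereal (C * c)" using tendsto_upperbound[OF L _ Gb] by blast
    moreover have "0 \<le> L x" using tendsto_lowerbound[OF L always_eventually Gb] q_nonneg by blast
    ultimately show ?thesis unfolding h_def by (cases "L x") auto
  qed
  obtain N D where N: "open N" "x0 \<in> N" "N \<subseteq> R" "0 \<le> D"
    "\<forall>x\<in>N. \<forall>g. continuous_on (frontier R) g \<and> (\<forall>z\<in>frontier R. 0 \<le> g z) \<longrightarrow> kka R x g \<le> D * kka R x0 g"
    using B2.kernel_harnack[OF kka_kernel[OF R(1)] R(2)] by blast
  \<comment> \<open>\<open>qr_mean\<close> represents all \<open>qr y\<close> by their values on the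
    same boundary, where they are bounded along \<open>G\<close>; this is the setting of the weak
    limit argument.\<close>
  have "continuous_on N h"
  proof (rule weak_limit_continuous[where K = "frontier R" and \<sigma> = "kka R x0" and \<kappa> = "kka R" and C = D
        and f = qr and M = "C * c", OF _ _ _ N(4) _ Gb])
    show "radon_measure (frontier R) (kka R x0)" by (rule radon_kernels(3)[OF R(1,2)])
    show "radon_measure (frontier R) (kka R x)" if "x \<in> N" for x
      using radon_kernels(3)[OF R(1)] that N(3) by blast
    show "kka R x g \<le> D * kka R x0 g" if "x \<in> N" "continuous_on (frontier R) g" "\<And>z. z \<in> frontier R \<Longrightarrow> 0 \<le> g z" for x g
      using N(5) that by blast
    show "continuous_on N (\<lambda>x. kka R x \<phi>)" if "continuous_on (frontier R) \<phi>" for \<phi>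
      using B2.kernel_continuous[OF kka_kernel[OF R(1)] that] N(3) by (rule continuous_on_subset)
    show "\<forall>\<^sub>F y in G. continuous_on (frontier R) (qr y) \<and> (\<forall>z\<in>frontier R. \<bar>qr y z\<bar> \<le> C * c)"
      using bG
    proof eventually_elim
      case (elim y)
      then have "closure R \<subseteq> - {y}" using UV(6) R(3) by auto
      then show ?case using frontier_continuous[OF qr_continuous] elim qr_nonneg by (auto simp: frontier_def)
    qed
    fix x assume x: "x \<in> N"
    then have xR: "x \<in> R" "x \<in> closure R" using N(3) closure_subset by auto
    have "((\<lambda>y. qr y x) \<longlongrightarrow> h x) G"
      unfolding qr_def using L[of x] Lh[OF xR(2)] by (intro lim_real_of_ereal) simp
    moreover have "\<forall>\<^sub>F y in G. qr y x = kka R x (qr y)"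
      using VG
    proof eventually_elim
      case (elim y)
      then have "closure R \<subseteq> - {y}" using UV(6) R(3) by auto
      then show ?case using qr_mean[OF R(1) _ xR(1)] by simp
    qed
    ultimately show "((\<lambda>y. kka R x (qr y)) \<longlongrightarrow> h x) G"
      by (rule Lim_transform_eventually)
  qed
  then have "isCont h x0" using N(1,2) continuous_on_eq_continuous_at by blast
  then have "((\<lambda>x. ereal (h x)) \<longlongrightarrow> ereal (h x0)) (nhds x0)"
    by (intro tendsto_ereal) (simp add: isCont_def tendsto_at_iff_tendsto_nhds)
  moreover have "\<forall>\<^sub>F x in nhds x0. ereal (h x) = L x"
    using eventually_nhds_in_open[OF N(1,2)] 
  proof eventually_elim
    case (elim x)
    then show ?case using Lh[of x] N(3) closure_subset[of R] by auto
  qed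
  ultimately have "(L \<longlongrightarrow> ereal (h x0)) (nhds x0)" by (rule Lim_transform_eventually)
  moreover have "L x0 = ereal (h x0)" using Lh[of x0] R(2) closure_subset by blast
  ultimately have "(L \<longlongrightarrow> L x0) (nhds x0)" by (simp only:)
  then have "q y0 x0 = L x0" unfolding qL by (intro lim_imp_Liminf) auto
  then show "((\<lambda>y. q y x0) \<longlongrightarrow> q y0 x0) G" using L[of x0] by simp
qed

lemma qr_tendsto:
  assumes "x0 \<noteq> y0"
  shows "((\<lambda>y. qr y x0) \<longlongrightarrow> qr y0 x0) (nhds y0)"
proof -
  have "((\<lambda>y. q y x0) \<longlongrightarrow> ereal (qr y0 x0)) (nhds y0)"
    using q_tendsto[OF assms] by (simp only: q_real[OF assms])
  from lim_real_of_ereal[OF this] show ?thesis by (simp only: qr_def)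
qed

text \<open>\<open>N\<close> is fixed before the sequence. Convergence at \<open>x0\<close> bounds
  the values there by \<open>qr y0 x0 + 1\<close>, Harnack's inequality spreads the bound to a
  boundary around \<open>x0\<close>, and dominated convergence on that boundary applies.\<close>

lemma qr_locally_uniform:
  assumes "x0 \<noteq> y0"
  shows "\<exists>N. open N \<and> x0 \<in> N \<and>
    (\<forall>Y. Y \<longlonglongrightarrow> y0 \<longrightarrow> uniform_limit N (\<lambda>n. qr (Y n)) (qr y0) sequentially)"
proof -
  obtain U V where UV: "open U" "connected U" "x0 \<in> U" "open V" "y0 \<in> V" "U \<inter> V = {}"
    using separated_component[OF assms] by blast
  obtain R where R: "biregular H R" "x0 \<in> R" "closure R \<subseteq> U" using biregular_nhd[OF UV(1,3)] by blast
  obtain C where C: "C \<ge> 0" "\<And>h x. h \<in> harmonic2 H U \<Longrightarrow> \<forall>x\<in>U. 0 \<le> h x \<Longrightarrow> x \<in> closure R \<Longrightarrow> h x \<le> C * h x0"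
    using B2.harnack[OF UV(1,2,3) biregular_compact[OF R(1)] R(3)] by blast
  obtain N D where N: "open N" "x0 \<in> N" "N \<subseteq> R" "0 \<le> D"
    "\<forall>x\<in>N. \<forall>g. continuous_on (frontier R) g \<and> (\<forall>z\<in>frontier R. 0 \<le> g z) \<longrightarrow> kka R x g \<le> D * kka R x0 g"
    using B2.kernel_harnack[OF kka_kernel[OF R(1)] R(2)] by blast
  have cl: "closure R \<subseteq> - {y}" if "y \<in> V" for y using UV(6) R(3) that by auto
  have "uniform_limit N (\<lambda>n. qr (Y n)) (qr y0) sequentially" if Y: "Y \<longlonglongrightarrow> y0" for Y
  proof -
    have VY: "\<forall>\<^sub>F n in sequentially. Y n \<in> V" using topological_tendstoD[OF Y UV(4,5)] .
    have lim: "(\<lambda>n. qr (Y n) z) \<longlonglongrightarrow> qr y0 z" if "z \<noteq> y0" for z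
      using filterlim_compose[OF qr_tendsto[OF that] Y] .
    have cY: "\<forall>\<^sub>F n in sequentially. qr (Y n) x0 < qr y0 x0 + 1"
      using order_tendstoD(2)[OF lim[OF assms]] by simp
    have "uniform_limit N (\<lambda>n x. kka R x (qr (Y n))) (\<lambda>x. kka R x (qr y0)) sequentially"
    proof (rule kernel_uniform_limit[where \<sigma> = "kka R x0" and \<kappa> = "kka R" and C = D
          and f = "\<lambda>n. qr (Y n)" and g = "qr y0" and M = "C * (qr y0 x0 + 1)",
          OF biregular_compact_frontier[OF R(1)]])
      show "radon_measure (frontier R) (kka R x0)" by (rule radon_kernels(3)[OF R(1,2)])
      show "radon_measure (frontier R) (kka R x)" if "x \<in> N" for x
        using radon_kernels(3)[OF R(1)] that N(3) by blast
      show "kka R x g \<le> D * kka R x0 g" if "x \<in> N" "continuous_on (frontier R) g" "\<And>z. z \<in> frontier R \<Longrightarrow> 0 \<le> g z" for x g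
        using N(5) that by blast
      show "\<forall>\<^sub>F n in sequentially. continuous_on (frontier R) (qr (Y n)) \<and>
          (\<forall>z\<in>frontier R. \<bar>qr (Y n) z\<bar> \<le> C * (qr y0 x0 + 1))"
        using VY cY
      proof eventually_elim
        case (elim n)
        have "C * qr (Y n) x0 \<le> C * (qr y0 x0 + 1)" using C(1) elim(2) by (intro mult_left_mono) auto
        moreover have "Y n \<notin> U" using UV(6) elim(1) by auto
        ultimately have "qr (Y n) z \<le> C * (qr y0 x0 + 1)" if "z \<in> closure R" for z
          using C(2)[OF qr_harmonic_on[OF UV(1)] _ that] qr_nonneg by (meson order_trans)
        then show ?case
          using frontier_continuous[OF qr_continuous cl[OF elim(1)]] qr_nonneg by (auto simp: frontier_def)
      qed
      show "continuous_on (frontier R) (qr y0)" by (rule frontier_continuous[OF qr_continuous cl[OF UV(5)]])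
      show "(\<lambda>n. qr (Y n) z) \<longlonglongrightarrow> qr y0 z" if "z \<in> frontier R" for z
        using cl[OF UV(5)] that by (intro lim) (auto simp: frontier_def)
    qed
    moreover have "\<forall>\<^sub>F n in sequentially. \<forall>x\<in>N. kka R x (qr (Y n)) = qr (Y n) x"
      using VY by eventually_elim (use qr_mean[OF R(1) cl] N(3) in blast)
    moreover have "kka R x (qr y0) = qr y0 x" if "x \<in> N" for x
      using qr_mean[OF R(1) cl[OF UV(5)]] N(3) that by blast
    ultimately show ?thesis by (rule uniform_limit_transfer)
  qed
  then show ?thesis using N(1,2) by blast
qed

lemma qr_uniform_on_compact:
  assumes "compact K" "y0 \<notin> K" "Y \<longlonglongrightarrow> y0"
  shows "uniform_limit K (\<lambda>n. qr (Y n)) (qr y0) sequentially"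
proof -
  have "\<exists>N. open N \<and> x \<in> N \<and> uniform_limit N (\<lambda>n. qr (Y n)) (qr y0) sequentially" if "x \<in> K" for x
    using qr_locally_uniform[of x y0] assms that by blast
  then obtain N where N: "\<And>x. x \<in> K \<Longrightarrow> open (N x)" "\<And>x. x \<in> K \<Longrightarrow> x \<in> N x"
    "\<And>x. x \<in> K \<Longrightarrow> uniform_limit (N x) (\<lambda>n. qr (Y n)) (qr y0) sequentially"
    by metis
  have "K \<subseteq> (\<Union>x\<in>K. N x)" using N(2) by blast
  then obtain D where D: "D \<subseteq> K" "finite D" "K \<subseteq> (\<Union>x\<in>D. N x)"
    using compactE_image[OF assms(1), of K N] N(1) by blast
  have "uniform_limit (\<Union>x\<in>D. N x) (\<lambda>n. qr (Y n)) (qr y0) sequentially"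
    using D(1,2) N(3) by (intro uniform_limit_on_UNION) auto
  then show ?thesis using D(3) by (rule uniform_limit_on_subset)
qed

lemma qr_jointly_continuous:
  assumes "x0 \<noteq> y0"
  shows "((\<lambda>(x, y). qr y x) \<longlongrightarrow> qr y0 x0) (nhds (x0, y0))"
proof -
  obtain N where N: "open N" "x0 \<in> N"
    "\<And>Y. Y \<longlonglongrightarrow> y0 \<Longrightarrow> uniform_limit N (\<lambda>n. qr (Y n)) (qr y0) sequentially"
    using qr_locally_uniform[OF assms] by blast
  have "isCont (qr y0) x0"
    using qr_continuous[of y0] open_punctured assms continuous_on_eq_continuous_at by blast
  then show ?thesis using jointly_continuous_of_uniform_limits N by blast
qed

lemma eventually_off_diagonal:
  assumes "x0 \<noteq> (y0 :: 'a)"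
  shows "\<forall>\<^sub>F w in nhds (x0, y0). fst w \<noteq> snd w"
proof -
  obtain N V where NV: "open N" "open V" "x0 \<in> N" "y0 \<in> V" "N \<inter> V = {}" using hausdorff[OF assms] by blast
  have "\<forall>\<^sub>F w in nhds (x0, y0). w \<in> N \<times> V"
    using NV by (intro eventually_nhds_in_open open_Times) auto
  then show ?thesis by eventually_elim (use NV(5) in auto)
qed

section \<open>Lower semicontinuity through joint regularization\<close>

definition qs where "qs x y = lsc_regularization (\<lambda>(x, y). q y x) (x, y)"
definition ps where "ps x y = lsc_regularization (\<lambda>(x, y). p y x) (x, y)"

text \<open>A continuous minorant of the regularization, lowered by \<open>e\<close>, minorizes
  \<open>q y\<close> for all \<open>y\<close> near \<open>y0\<close>. Integrating and regularizing
  again costs at most \<open>e\<close>, masses being at most 1.\<close>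

lemma qs_super:
  assumes R: "biregular H R" "x \<in> R"
  shows "ika R x (\<lambda>z. qs z y0) \<le> qs x y0"
proof (rule upper_integral_le)
  fix f assume f: "continuous_on (frontier R) f" "\<And>z. z \<in> frontier R \<Longrightarrow> ereal (f z) \<le> qs z y0"
  show "ereal (kka R x f) \<le> qs x y0"
  proof (rule ereal_le_epsilon2)
    fix e :: real assume e: "0 < e"
    obtain V where V: "open V" "y0 \<in> V" "\<And>z y. z \<in> frontier R \<Longrightarrow> y \<in> V \<Longrightarrow> ereal (f z - e) \<le> q y z"
      using tube_minorant[OF biregular_compact_frontier[OF R(1)] f(1), of "\<lambda>(x, y). q y x" y0 e] f(2) e
      by (auto simp: qs_def)
    have fe: "continuous_on (frontier R) (\<lambda>z. f z - e)" by (intro continuous_intros f(1))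
    have le: "ereal (kka R z (\<lambda>z. f z - e)) \<le> (case (z, y) of (x, y) \<Rightarrow> q y x)" if "z \<in> R" "y \<in> V" for z y
    proof -
      have "ereal (kka R z (\<lambda>z. f z - e)) \<le> ika R z (q y)"
        using V(3) that(2) by (intro upper_integralI fe) auto
      also have "\<dots> \<le> q y z" using hyperharmonic_pairD(2)[OF pair R(1) _ that(1)] by simp
      finally show ?thesis by simp
    qed
    have *: "ereal (kka R x (\<lambda>z. f z - e)) \<le> qs x y0"
      unfolding qs_def
      by (rule lsc_regularization_geI[OF biregular_open[OF R(1)] R(2) B2.kernel_continuous[OF kka_kernel[OF R(1)] fe] V(1,2) le])
    have "kka R x f \<le> kka R x (\<lambda>z. f z - e) + e"
    proof -
      have "e * kka R x (\<lambda>z. 1) \<le> e * 1" using e kernel_one(2)[OF decoupled[OF R(1)] R] by (intro mult_left_mono) auto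
      then show ?thesis using radon_add_const(2)[OF radon_kernels(3)[OF R] f(1), of e] by simp
    qed
    then have "ereal (kka R x f) \<le> ereal (kka R x (\<lambda>z. f z - e)) + ereal e" by simp
    also have "\<dots> \<le> qs x y0 + ereal e" by (rule add_right_mono[OF *])
    finally show "ereal (kka R x f) \<le> qs x y0 + ereal e" .
  qed
qed

text \<open>Off the diagonal this is joint continuity. On it, the supermean inequality carries
  values from a small boundary around \<open>y0\<close> to \<open>y0\<close> with a factor equal to
  the mass, which is close to 1 for small sets.\<close>

lemma q_le_qs: "q y0 x0 \<le> qs x0 y0"
proof -
  have off: "q y0 z \<le> qs z y0" if "z \<noteq> y0" for z
  proof -
    have "((\<lambda>w. ereal (case w of (x, y) \<Rightarrow> qr y x)) \<longlongrightarrow> ereal (qr y0 z)) (nhds (z, y0))"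
      by (rule tendsto_ereal[OF qr_jointly_continuous[OF that]])
    moreover have "\<forall>\<^sub>F w in nhds (z, y0). ereal (case w of (x, y) \<Rightarrow> qr y x) = (case w of (x, y) \<Rightarrow> q y x)"
      using eventually_off_diagonal[OF that] by eventually_elim (auto simp: q_real)
    ultimately have "((\<lambda>(x, y). q y x) \<longlongrightarrow> q y0 z) (nhds (z, y0))"
      unfolding q_real[OF that] by (rule Lim_transform_eventually)
    then show ?thesis unfolding qs_def lsc_regularization_def by (simp add: lim_imp_Liminf)
  qed
  have qs0: "0 \<le> qs x y" for x y
    unfolding qs_def by (rule lsc_regularization_nonneg) (simp add: q_nonneg case_prod_beta)
  have "q y0 y0 \<le> qs y0 y0"
  proof (rule ccontr)
    assume "\<not> ?thesis"
    then have lt: "qs y0 y0 < q y0 y0" by simp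
    then obtain r where r: "qs y0 y0 = ereal r" "0 \<le> r" using qs0[of y0 y0] by (cases "qs y0 y0") auto
    obtain t where t: "r < t" "ereal t < q y0 y0" using ereal_dense2[OF lt] r by auto
    \<comment> \<open>The midpoint of \<open>r / t\<close> and 1: below 1, while
      \<open>a * t\<close> still exceeds \<open>r\<close>.\<close>
    define a where "a = (r / t + 1) / 2"
    have a: "0 < a" "a < 1" "r < a * t" using t(1) r(2) by (auto simp: a_def field_simps)
    \<comment> \<open>A positive harmonic \<open>h\<close> measures the mass: where \<open>h\<close>
      stays below \<open>h y0 / a\<close>, its mean value equation forces mass at least
      \<open>a\<close>.\<close>
    obtain \<delta> h where \<delta>: "open \<delta>" "y0 \<in> \<delta>" "h \<in> harmonic2 H \<delta>" "\<forall>x\<in>\<delta>. 0 < h x"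
      using B2.positive_harmonic_exists by blast
    have hc: "continuous_on \<delta> h" by (rule B2.harmonic_continuous[OF \<delta>(1,3)])
    have "h y0 < h y0 / a" using \<delta>(2,4) a by (simp add: field_simps)
    moreover have "(h \<longlongrightarrow> h y0) (nhds y0)"
      using hc \<delta>(1,2) continuous_on_eq_continuous_at by (metis isCont_def tendsto_at_iff_tendsto_nhds)
    ultimately have "\<forall>\<^sub>F x in nhds y0. h x < h y0 / a" by (rule order_tendstoD(2)[rotated])
    moreover have "\<forall>\<^sub>F x in nhds y0. x \<in> \<delta>" using \<delta>(1,2) by (simp add: eventually_nhds_in_open)
    moreover have "\<forall>\<^sub>F x in nhds y0. ereal t < q y0 x"
      using lsc_onD[of UNIV "q y0" y0 "ereal t"] t(2) pair[of y0] by (auto simp: hyperharmonic_pairs_def)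
    ultimately have "\<forall>\<^sub>F x in nhds y0. h x < h y0 / a \<and> x \<in> \<delta> \<and> ereal t < q y0 x" by eventually_elim simp
    then obtain S where S: "open S" "y0 \<in> S" "\<And>x. x \<in> S \<Longrightarrow> h x < h y0 / a \<and> x \<in> \<delta> \<and> ereal t < q y0 x"
      unfolding eventually_nhds by blast
    obtain R where R: "biregular H R" "y0 \<in> R" "closure R \<subseteq> S" using biregular_nhd[OF S(1,2)] by blast
    note \<kappa> = radon_kernels(3)[OF R(1,2)]
    have fS: "frontier R \<subseteq> S" using R(3) by (auto simp: frontier_def)
    have "closure R \<subseteq> \<delta>" using R(3) S(3) by auto
    then have "h y0 = kka R y0 h" using harmonic2_mean[OF \<delta>(1,3) decoupled[OF R(1)] R(1) _ R(2)] by simp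
    also have "\<dots> \<le> kka R y0 (\<lambda>z. h y0 / a)"
      using S(3) fS by (intro radon_mono[OF \<kappa>] continuous_on_subset[OF hc] continuous_on_const) (auto intro: less_imp_le)
    also have "\<dots> = h y0 / a * kka R y0 (\<lambda>z. 1)" by (rule radon_const[OF \<kappa>])
    finally have "a \<le> kka R y0 (\<lambda>z. 1)" using a(1) \<delta>(2,4) by (simp add: field_simps)
    then have "a * t \<le> t * kka R y0 (\<lambda>z. 1)" using t(1) r(2) by (simp add: mult.commute mult_left_mono)
    also have "\<dots> = kka R y0 (\<lambda>z. t)" by (rule radon_const[OF \<kappa>, symmetric])
    finally have "r < kka R y0 (\<lambda>z. t)" using a(3) by simp
    moreover have "ereal (kka R y0 (\<lambda>z. t)) \<le> ika R y0 (\<lambda>z. qs z y0)"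
    proof (rule upper_integralI)
      fix z assume z: "z \<in> frontier R"
      then have "z \<noteq> y0" using R(2) biregular_open[OF R(1)] by (auto simp: frontier_def interior_open)
      from off[OF this] show "ereal t \<le> qs z y0" using S(3)[of z] fS z by (metis less_imp_le order_trans subsetD)
    qed simp
    then have "ereal (kka R y0 (\<lambda>z. t)) \<le> qs y0 y0" using qs_super[OF R(1,2)] order_trans by blast
    ultimately show False using r(1) by simp
  qed
  with off show ?thesis by (cases "x0 = y0") auto
qed

text \<open>The argument for \<open>qs\<close>, carried out for both components at once. A minorant
  of \<open>q y0\<close> is one of the regularization by \<open>q_le_qs\<close>, hence persists, up
  to \<open>e\<close>, for neighbouring \<open>y\<close>.\<close>

lemma ps_pair: "(\<lambda>x. ps x y0, q y0) \<in> hyperharmonic_pairs H UNIV"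
proof (rule hyperharmonic_pairI)
  have ps0: "0 \<le> ps x y0" for x
    unfolding ps_def by (rule lsc_regularization_nonneg) (simp add: p_nonneg case_prod_beta)
  show "lsc_on UNIV (\<lambda>x. ps x y0)"
  proof (rule lsc_on_UNIV_I)
    fix x t assume "t < ps x y0"
    then have "\<forall>\<^sub>F w in nhds (x, y0). t < lsc_regularization (\<lambda>(x, y). p y x) w"
      unfolding ps_def by (rule lsc_regularization_less)
    then obtain S where S: "open S" "(x, y0) \<in> S" "\<And>w. w \<in> S \<Longrightarrow> t < lsc_regularization (\<lambda>(x, y). p y x) w"
      unfolding eventually_nhds by blast
    obtain A B where "open A" "open B" "(x, y0) \<in> A \<times> B" "A \<times> B \<subseteq> S" using open_prod_elim[OF S(1,2)] by blast
    then show "\<forall>\<^sub>F z in nhds x. t < ps z y0"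
      unfolding eventually_nhds ps_def using S(3) by (intro exI[of _ A]) blast
  qed
  show "lsc_on UNIV (q y0)" using pair[of y0] by (simp add: hyperharmonic_pairs_def)
  show "ps x y0 \<noteq> -\<infinity>" "q y0 x \<noteq> -\<infinity>" for x using ps0[of x] q_nonneg[of y0 x] by auto
  fix R x assume R: "biregular H R" "closure R \<subseteq> UNIV" "x \<in> R"
  show "ika R x (q y0) \<le> q y0 x" by (rule hyperharmonic_pairD(2)[OF pair R])
  show "imu R x (\<lambda>x. ps x y0) + inu R x (q y0) \<le> ps x y0"
  proof (rule upper_integral_add_le[OF radon_kernels(1,2)[OF R(1,3)] ps0 q_nonneg])
    fix f g assume f: "continuous_on (frontier R) f" "\<And>z. z \<in> frontier R \<Longrightarrow> ereal (f z) \<le> ps z y0"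
      and g: "continuous_on (frontier R) g" "\<And>z. z \<in> frontier R \<Longrightarrow> ereal (g z) \<le> q y0 z"
    have g': "ereal (g z) \<le> qs z y0" if "z \<in> frontier R" for z using g(2)[OF that] q_le_qs order_trans by blast
    show "ereal (kmu R x f + knu R x g) \<le> ps x y0"
    proof (rule ereal_le_epsilon2)
      fix e :: real assume e: "0 < e"
      obtain V1 where V1: "open V1" "y0 \<in> V1" "\<And>z y. z \<in> frontier R \<Longrightarrow> y \<in> V1 \<Longrightarrow> ereal (f z - e) \<le> p y z"
        using tube_minorant[OF biregular_compact_frontier[OF R(1)] f(1), of "\<lambda>(x, y). p y x" y0 e] f(2) e
        by (auto simp: ps_def)
      obtain V2 where V2: "open V2" "y0 \<in> V2" "\<And>z y. z \<in> frontier R \<Longrightarrow> y \<in> V2 \<Longrightarrow> ereal (g z - e) \<le> q y z"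
        using tube_minorant[OF biregular_compact_frontier[OF R(1)] g(1), of "\<lambda>(x, y). q y x" y0 e] g' e
        by (auto simp: qs_def)
      let ?f = "\<lambda>z. f z - e" and ?g = "\<lambda>z. g z - e"
      have fe: "continuous_on (frontier R) ?f" "continuous_on (frontier R) ?g" by (intro continuous_intros f(1) g(1))+
      have le: "ereal (kmu R z ?f + knu R z ?g) \<le> (case (z, y) of (x, y) \<Rightarrow> p y x)" if "z \<in> R" "y \<in> V1 \<inter> V2" for z y
      proof -
        have "ereal (kmu R z ?f + knu R z ?g) = ereal (kmu R z ?f) + ereal (knu R z ?g)" by simp
        also have "\<dots> \<le> imu R z (p y) + inu R z (q y)"
          using V1(3) V2(3) that(2) by (intro add_mono upper_integralI fe) auto
        also have "\<dots> \<le> p y z" by (rule hyperharmonic_pairD(1)[OF pair R(1,2) that(1)])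
        finally show ?thesis by simp
      qed
      have *: "ereal (kmu R x ?f + knu R x ?g) \<le> ps x y0"
        unfolding ps_def
        by (rule lsc_regularization_geI[where a = "\<lambda>x. kmu R x ?f + knu R x ?g" and V = "V1 \<inter> V2",
              OF biregular_open[OF R(1)] R(3) solution(3)[OF R(1) fe] _ _ le]) (use V1 V2 in auto)
      have "kmu R x f + knu R x g \<le> (kmu R x ?f + knu R x ?g) + e"
      proof -
        have "e * (kmu R x (\<lambda>z. 1) + knu R x (\<lambda>z. 1)) \<le> e * 1"
          using e kernel_one(1)[OF decoupled[OF R(1)] R(1,3)] by (intro mult_left_mono) auto
        then show ?thesis
          using radon_add_const(2)[OF radon_kernels(1)[OF R(1,3)] f(1), of e]
            radon_add_const(2)[OF radon_kernels(2)[OF R(1,3)] g(1), of e] by (simp add: distrib_left)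
      qed
      then have "ereal (kmu R x f + knu R x g) \<le> ereal (kmu R x ?f + knu R x ?g) + ereal e" by simp
      also have "\<dots> \<le> ps x y0 + ereal e" by (rule add_right_mono[OF *])
      finally show "ereal (kmu R x f + knu R x g) \<le> ps x y0 + ereal e" .
    qed
  qed
qed

lemma p_lsc: "lsc_on (UNIV \<times> UNIV) (\<lambda>(x, y). p y x)"
proof -
  have "lsc_on UNIV (\<lambda>(x, y). p y x)"
  proof (rule lsc_on_UNIV_I)
    fix w t assume t: "t < (case w of (x, y) \<Rightarrow> p y x)"
    obtain x0 y0 where w: "w = (x0, y0)" by (rule prod.exhaust)
    have "p y0 x0 \<le> ps x0 y0"
    proof (rule p_min[OF ps_pair])
      show "0 \<le> ps x y0" for x
        unfolding ps_def by (rule lsc_regularization_nonneg) (simp add: p_nonneg case_prod_beta)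
    qed
    then have "t < Liminf (nhds w) (\<lambda>(x, y). p y x)"
      using t w by (simp add: ps_def lsc_regularization_def)
    then show "\<forall>\<^sub>F z in nhds w. t < (case z of (x, y) \<Rightarrow> p y x)" by (rule less_LiminfD)
  qed
  then show ?thesis by simp
qed

section \<open>Continuity off the diagonal\<close>

lemma pr_tendsto:
  assumes "z \<noteq> y0" "Y \<longlonglongrightarrow> y0"
  shows "(\<lambda>n. pr (Y n) z) \<longlonglongrightarrow> pr y0 z"
proof -
  have "isCont (\<lambda>y. p y z) y0"
    using p_continuous[of z, folded Compl_eq_Diff_UNIV] assms(1)
      continuous_on_eq_continuous_at[OF open_punctured[of z], of "\<lambda>y. p y z"] by simp
  from isCont_tendsto_compose[OF this assms(2)]
  have "(\<lambda>n. p (Y n) z) \<longlonglongrightarrow> ereal (pr y0 z)" by (simp only: p_real[OF assms(1)])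
  from lim_real_of_ereal[OF this] show ?thesis by (simp only: pr_def)
qed

text \<open>Two nested regular sets are used: the decomposition of \<open>pr y\<close> in
  \<open>R\<close> yields bounds on the boundary of \<open>\<delta>\<close>, and in the
  decomposition on \<open>\<delta>\<close> each of the two terms converges uniformly near
  \<open>x0\<close>.\<close>

lemma pr_locally_uniform:
  assumes "x0 \<noteq> y0"
  shows "\<exists>N. open N \<and> x0 \<in> N \<and>
    (\<forall>Y. Y \<longlonglongrightarrow> y0 \<longrightarrow> uniform_limit N (\<lambda>n. pr (Y n)) (pr y0) sequentially)"
proof -
  obtain U V where UV: "open U" "connected U" "x0 \<in> U" "open V" "y0 \<in> V" "U \<inter> V = {}"
    using separated_component[OF assms] by blast
  obtain R where R: "biregular H R" "x0 \<in> R" "closure R \<subseteq> U" using biregular_nhd[OF UV(1,3)] by blast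
  have cl: "closure R \<subseteq> - {y}" if "y \<in> V" for y using UV(6) R(3) that by auto
  define U' where "U' = connected_component_set R x0"
  have U': "open U'" "connected U'" "x0 \<in> U'" "U' \<subseteq> R"
    using component_facts[OF B1.locally_connected_space biregular_open[OF R(1)] R(2)] by (auto simp: U'_def)
  obtain \<delta> where \<delta>: "biregular H \<delta>" "x0 \<in> \<delta>" "closure \<delta> \<subseteq> U'" using biregular_nhd[OF U'(1,3)] by blast
  have cl': "closure \<delta> \<subseteq> - {y}" if "y \<in> V" for y using cl[OF that] \<delta>(3) U'(4) closure_subset[of R] by blast
  obtain C where C: "C \<ge> 0" "\<And>h x. h \<in> harmonic1 H U' \<Longrightarrow> \<forall>x\<in>U'. 0 \<le> h x \<Longrightarrow> x \<in> closure \<delta> \<Longrightarrow> h x \<le> C * h x0"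
    using B1.harnack[OF U'(1,2,3) biregular_compact[OF \<delta>(1)] \<delta>(3)] by blast
  obtain N D where N: "open N" "x0 \<in> N" "N \<subseteq> \<delta>" "0 \<le> D"
    "\<forall>x\<in>N. \<forall>g. continuous_on (frontier \<delta>) g \<and> (\<forall>z\<in>frontier \<delta>. 0 \<le> g z) \<longrightarrow> kmu \<delta> x g \<le> D * kmu \<delta> x0 g"
    using B1.kernel_harnack[OF kmu_kernel[OF \<delta>(1)] \<delta>(2)] by blast
  have y0f: "y0 \<notin> frontier R" "y0 \<notin> frontier \<delta>" using cl[OF UV(5)] cl'[OF UV(5)] by (auto simp: frontier_def)
  have qc: "continuous_on (frontier R) (qr y)" "continuous_on (frontier \<delta>) (qr y)"
      "continuous_on (frontier R) (pr y)" "continuous_on (frontier \<delta>) (pr y)" if "y \<in> V" for y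
    using frontier_continuous[OF qr_continuous] frontier_continuous[OF pr_continuous] cl[OF that] cl'[OF that] by blast+
  have "compact (qr y0 ` frontier R)"
    by (rule compact_continuous_image[OF qc(1)[OF UV(5)] biregular_compact_frontier[OF R(1)]])
  then have "bdd_above (qr y0 ` frontier R)" by (intro bounded_imp_bdd_above compact_imp_bounded)
  then obtain B where B: "\<And>z. z \<in> frontier R \<Longrightarrow> qr y0 z \<le> B" unfolding bdd_above_def by blast
  have "uniform_limit N (\<lambda>n. pr (Y n)) (pr y0) sequentially" if Y: "Y \<longlonglongrightarrow> y0" for Y
  proof -
    have VY: "\<forall>\<^sub>F n in sequentially. Y n \<in> V" using topological_tendstoD[OF Y UV(4,5)] .
    have cY: "\<forall>\<^sub>F n in sequentially. pr (Y n) x0 < pr y0 x0 + 1"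
      using order_tendstoD(2)[OF pr_tendsto[OF assms Y]] by simp
    have qY: "\<forall>\<^sub>F n in sequentially. \<forall>z\<in>frontier R. dist (qr (Y n) z) (qr y0 z) < 1"
      using uniform_limitD[OF qr_uniform_on_compact[OF biregular_compact_frontier[OF R(1)] y0f(1) Y], of 1] by simp
    \<comment> \<open>The first term bounds the \<open>\<mu>\<close>-part through Harnack's
      inequality from \<open>x0\<close>, the second the \<open>\<nu>\<close>-part, since on the
      boundary of \<open>R\<close> the functions \<open>qr (Y n)\<close> are eventually below
      \<open>B + 1\<close>.\<close>
    define M where "M = C * (pr y0 x0 + 1) + \<bar>B + 1\<bar>"
    have "uniform_limit N (\<lambda>n x. kmu \<delta> x (pr (Y n))) (\<lambda>x. kmu \<delta> x (pr y0)) sequentially"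
    proof (rule kernel_uniform_limit[where \<sigma> = "kmu \<delta> x0" and \<kappa> = "kmu \<delta>" and C = D
          and f = "\<lambda>n. pr (Y n)" and g = "pr y0" and M = M,
          OF biregular_compact_frontier[OF \<delta>(1)]])
      show "radon_measure (frontier \<delta>) (kmu \<delta> x0)" by (rule radon_kernels(1)[OF \<delta>(1,2)])
      show "radon_measure (frontier \<delta>) (kmu \<delta> x)" if "x \<in> N" for x
        using radon_kernels(1)[OF \<delta>(1)] that N(3) by blast
      show "kmu \<delta> x g \<le> D * kmu \<delta> x0 g" if "x \<in> N" "continuous_on (frontier \<delta>) g" "\<And>z. z \<in> frontier \<delta> \<Longrightarrow> 0 \<le> g z" for x g
        using N(5) that by blast
      show "\<forall>\<^sub>F n in sequentially. continuous_on (frontier \<delta>) (pr (Y n)) \<and> (\<forall>z\<in>frontier \<delta>. \<bar>pr (Y n) z\<bar> \<le> M)"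
        using VY cY qY
      proof eventually_elim
        case (elim n)
        let ?h = "\<lambda>z. kmu R z (pr (Y n))"
        have hn: "0 \<le> ?h z" if "z \<in> R" for z
          using radon_nonneg[OF radon_kernels(1)[OF R(1) that] qc(3)[OF elim(1)]] pr_nonneg by blast
        have nn: "0 \<le> knu R z (qr (Y n))" if "z \<in> R" for z
          using radon_nonneg[OF radon_kernels(2)[OF R(1) that] qc(1)[OF elim(1)]] qr_nonneg by blast
        have mean: "pr (Y n) z = ?h z + knu R z (qr (Y n))" if "z \<in> R" for z
          using pr_mean[OF R(1) cl[OF elim(1)] that] .
        \<comment> \<open>Both parts are nonnegative, so the harmonic one inherits the bound for
          \<open>pr (Y n) x0\<close>.\<close>
        have "?h x0 \<le> pr y0 x0 + 1" using mean[OF R(2)] nn[OF R(2)] elim(2) by simp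
        then have Cx0: "C * ?h x0 \<le> C * (pr y0 x0 + 1)" using C(1) by (rule mult_left_mono)
        have "pr (Y n) z \<le> M" if z: "z \<in> frontier \<delta>" for z
        proof -
          have z': "z \<in> closure \<delta>" "z \<in> R" using z \<delta>(3) U'(4) by (auto simp: frontier_def)
          have "?h z \<le> C * ?h x0"
          proof (rule C(2)[OF _ _ z'(1)])
            show "?h \<in> harmonic1 H U'"
              by (rule B1.kernel_harmonic[OF kmu_kernel[OF R(1)] qc(3)[OF elim(1)] U'(1,4)])
            show "\<forall>x\<in>U'. 0 \<le> ?h x" using hn U'(4) by blast
          qed
          moreover have "knu R z (qr (Y n)) \<le> \<bar>B + 1\<bar>"
          proof -
            have "knu R z (qr (Y n)) \<le> knu R z (\<lambda>z. \<bar>B + 1\<bar>)"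
            proof (rule radon_mono[OF radon_kernels(2)[OF R(1) z'(2)] qc(1)[OF elim(1)] continuous_on_const])
              fix a assume a: "a \<in> frontier R"
              then have "dist (qr (Y n) a) (qr y0 a) < 1" using elim(3) by blast
              then show "qr (Y n) a \<le> \<bar>B + 1\<bar>" using B[OF a] by (simp add: dist_real_def)
            qed
            also have "\<dots> = \<bar>B + 1\<bar> * knu R z (\<lambda>z. 1)" by (rule radon_const[OF radon_kernels(2)[OF R(1) z'(2)]])
            also have "\<dots> \<le> \<bar>B + 1\<bar> * 1" using knu_one[OF R(1) z'(2)] by (intro mult_left_mono) auto
            finally show ?thesis by simp
          qed
          ultimately show ?thesis using mean[OF z'(2)] Cx0 by (simp add: M_def)
        qed
        then show ?case using qc(4)[OF elim(1)] pr_nonneg by simp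
      qed
      show "continuous_on (frontier \<delta>) (pr y0)" by (rule qc(4)[OF UV(5)])
      show "(\<lambda>n. pr (Y n) z) \<longlonglongrightarrow> pr y0 z" if "z \<in> frontier \<delta>" for z
        using y0f(2) that by (intro pr_tendsto Y) auto
    qed
    \<comment> \<open>For this part uniform convergence of the boundary data and total mass at most
      1 give uniformity in \<open>x\<close> at once.\<close>
    moreover have "uniform_limit N (\<lambda>n x. knu \<delta> x (qr (Y n))) (\<lambda>x. knu \<delta> x (qr y0)) sequentially"
    proof (rule uniform_limitI)
      fix e :: real assume e: "0 < e"
      have "\<forall>\<^sub>F n in sequentially. \<forall>z\<in>frontier \<delta>. dist (qr (Y n) z) (qr y0 z) < e / 2"
        using uniform_limitD[OF qr_uniform_on_compact[OF biregular_compact_frontier[OF \<delta>(1)] y0f(2) Y], of "e/2"] e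
        by simp
      with VY show "\<forall>\<^sub>F n in sequentially. \<forall>x\<in>N. dist (knu \<delta> x (qr (Y n))) (knu \<delta> x (qr y0)) < e"
      proof eventually_elim
        case (elim n)
        show ?case
        proof
          fix x assume "x \<in> N"
          then have x: "x \<in> \<delta>" using N(3) by blast
          note r = radon_kernels(2)[OF \<delta>(1) x] and c = qc(2)[OF elim(1)] qc(2)[OF UV(5)]
          have "dist (knu \<delta> x (qr (Y n))) (knu \<delta> x (qr y0)) = \<bar>knu \<delta> x (\<lambda>z. qr (Y n) z - qr y0 z)\<bar>"
            by (simp add: dist_real_def radon_diff[OF r c])
          also have "\<dots> \<le> knu \<delta> x (\<lambda>z. \<bar>qr (Y n) z - qr y0 z\<bar>)"
            by (intro radon_abs_le[OF r] continuous_on_diff c)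
          also have "\<dots> \<le> knu \<delta> x (\<lambda>z. e / 2)"
            using elim(2) by (intro radon_mono[OF r] continuous_intros c) (auto simp: dist_real_def intro: less_imp_le)
          also have "\<dots> = e / 2 * knu \<delta> x (\<lambda>z. 1)" by (rule radon_const[OF r])
          also have "\<dots> \<le> e / 2 * 1" using e knu_one[OF \<delta>(1) x] by (intro mult_left_mono) auto
          also have "\<dots> < e" using e by simp
          finally show "dist (knu \<delta> x (qr (Y n))) (knu \<delta> x (qr y0)) < e" .
        qed
      qed
    qed
    ultimately have "uniform_limit N (\<lambda>n x. kmu \<delta> x (pr (Y n)) + knu \<delta> x (qr (Y n)))
        (\<lambda>x. kmu \<delta> x (pr y0) + knu \<delta> x (qr y0)) sequentially"
      by (rule uniform_limit_add)
    moreover have "\<forall>\<^sub>F n in sequentially. \<forall>x\<in>N. kmu \<delta> x (pr (Y n)) + knu \<delta> x (qr (Y n)) = pr (Y n) x"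
      using VY
    proof eventually_elim
      case (elim n)
      then show ?case using pr_mean[OF \<delta>(1) cl'[OF elim]] N(3) by auto
    qed
    moreover have "kmu \<delta> x (pr y0) + knu \<delta> x (qr y0) = pr y0 x" if "x \<in> N" for x
      using pr_mean[OF \<delta>(1) cl'[OF UV(5)]] N(3) that by auto
    ultimately show ?thesis by (rule uniform_limit_transfer)
  qed
  then show ?thesis using N(1,2) by blast
qed

lemma p_continuous_off_diagonal: "continuous_on (UNIV \<times> UNIV - {(x, x) | x. True}) (\<lambda>(x, y). p y x)"
proof (rule continuous_at_imp_continuous_on, rule ballI)
  fix w :: "'a \<times> 'a" assume w: "w \<in> UNIV \<times> UNIV - {(x, x) | x. True}"
  obtain x0 y0 where xy: "w = (x0, y0)" by (rule prod.exhaust)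
  then have ne: "x0 \<noteq> y0" using w by auto
  obtain N where N: "open N" "x0 \<in> N"
    "\<And>Y. Y \<longlonglongrightarrow> y0 \<Longrightarrow> uniform_limit N (\<lambda>n. pr (Y n)) (pr y0) sequentially"
    using pr_locally_uniform[OF ne] by blast
  have "isCont (pr y0) x0"
    using pr_continuous[of y0] open_punctured ne continuous_on_eq_continuous_at by blast
  then have "((\<lambda>(x, y). pr y x) \<longlongrightarrow> pr y0 x0) (nhds (x0, y0))"
    using jointly_continuous_of_uniform_limits N by blast
  then have "((\<lambda>w. ereal (case w of (x, y) \<Rightarrow> pr y x)) \<longlongrightarrow> ereal (pr y0 x0)) (nhds (x0, y0))"
    by (rule tendsto_ereal)
  moreover have "\<forall>\<^sub>F w in nhds (x0, y0). ereal (case w of (x, y) \<Rightarrow> pr y x) = (case w of (x, y) \<Rightarrow> p y x)"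
    using eventually_off_diagonal[OF ne] by eventually_elim (auto simp: p_real)
  ultimately have "((\<lambda>(x, y). p y x) \<longlongrightarrow> ereal (pr y0 x0)) (nhds (x0, y0))"
    by (rule Lim_transform_eventually)
  then show "isCont (\<lambda>(x, y). p y x) w"
    unfolding isCont_def xy using p_real[OF ne] tendsto_at_iff_tendsto_nhds[of "\<lambda>(x, y). p y x" "(x0, y0)"] by simp
qed

end

section \<open>From the hypotheses of the theorem to the kernel\<close>

text \<open>The complement of the support is a union of open sets with harmonic representatives of
  \<open>s\<close>; on each of them the representative is \<open>real_of_ereal\<close> of
  \<open>s\<close>, so the sheaf condition glues them.\<close>

lemma (in brelot) harmonic_off_support:
  shows "(\<lambda>x. real_of_ereal (s x)) \<in> F (- harmonic_support F s)"
    and "x \<notin> harmonic_support F s \<Longrightarrow> \<bar>s x\<bar> \<noteq> \<infinity>"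
proof -
  define \<U> where "\<U> = {U. open U \<and> harmonic_on F U s}"
  have "(\<lambda>x. real_of_ereal (s x)) \<in> F U" if U: "U \<in> \<U>" for U
  proof -
    obtain h where "h \<in> F U" "\<forall>x\<in>U. s x = ereal (h x)"
      using U by (auto simp: \<U>_def harmonic_on_def)
    moreover have "open U" using U by (simp add: \<U>_def)
    ultimately show ?thesis by (auto intro: harmonic_cong)
  qed
  moreover have "F (\<Union>\<U>) = (\<Inter>U\<in>\<U>. F U)"
    using sheaf[unfolded is_sheaf_def, THEN spec[of _ \<U>]] by (simp add: \<U>_def)
  moreover have supp: "- harmonic_support F s = \<Union>\<U>" by (simp add: harmonic_support_def \<U>_def)
  ultimately show "(\<lambda>x. real_of_ereal (s x)) \<in> F (- harmonic_support F s)" by simp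
  show "\<bar>s x\<bar> \<noteq> \<infinity>" if "x \<notin> harmonic_support F s"
  proof -
    have "x \<in> \<Union>\<U>" using that supp by blast
    then show ?thesis by (auto simp: \<U>_def harmonic_on_def)
  qed
qed

text \<open>The image of the ultrafilter under \<open>q\<close> is an ultrafilter on the cone and
  converges to \<open>q y\<close> by continuity; the defining property of the topology then
  identifies \<open>q y\<close>.\<close>

lemma herve_limit:
  fixes q :: "'b::topological_space \<Rightarrow> 'a::topological_space \<Rightarrow> ereal"
  assumes T: "herve_topology S T" and q: "continuous_map euclidean T q" "\<And>z. q z \<in> pos_superharmonic S"
    and G: "is_ultrafilter G" "G \<le> nhds y"
  shows "q y = lsc_regularization (\<lambda>x. Lim G (\<lambda>z. q z x))"
proof -
  let ?F = "filtermap q G"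
  have "limitin euclidean (\<lambda>z. z) y G" using G(2) by (simp add: filterlim_def)
  from continuous_map_limit[OF q(1) this] have "limitin T (\<lambda>s. s) (q y) ?F"
    by (simp add: limitin_def eventually_filtermap o_def)
  moreover have "is_ultrafilter ?F" using G(1) by (rule is_ultrafilter_filtermap)
  moreover have "eventually (\<lambda>s. s \<in> pos_superharmonic S) ?F" using q(2) by (simp add: eventually_filtermap)
  ultimately have "q y = lsc_regularization (\<lambda>x. Lim ?F (\<lambda>s. s x))"
    using T[unfolded herve_topology_def, THEN conjunct2, THEN spec[of _ ?F], THEN spec[of _ "q y"]] q(2) by simp
  moreover have "Lim ?F (\<lambda>s. s x) = Lim G (\<lambda>z. q z x)" for x
    by (simp add: t2_space_class.Lim_def filterlim_filtermap)
  ultimately show ?thesis by simp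
qed

theorem theorem7p1:
  fixes H :: "'a::{t2_space, second_countable_topology} pair_sheaf"
    and q p' :: "'a \<Rightarrow> 'a \<Rightarrow> ereal"
    and T :: "('a \<Rightarrow> ereal) topology"
  assumes "green_biharmonic_space H"
    and "strong H"
    and "topological_basis {\<omega>. completely_determining (harmonic1 H) (hyperharmonic1 H) \<omega> \<and>
                               completely_determining (harmonic2 H) (hyperharmonic2 H) \<omega>}"
    and "bipotential H (\<lambda>x. 1) (\<lambda>x. 1)"
    and "herve_topology (hyperharmonic2 H) T"
    and "continuous_map euclidean T q"
    and "\<And>y. potential (harmonic2 H) (hyperharmonic2 H) (q y)"
    and "\<And>y. harmonic_support (harmonic2 H) (q y) = {y}"
    and "\<And>y. pure_hyperharmonic H (q y) (p' y)"
    and "\<And>y. p' y \<in> superharmonic (hyperharmonic1 H)"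
    and "\<And>x. continuous_on (UNIV - {x}) (\<lambda>y. p' y x)"
  shows "lsc_on (UNIV \<times> UNIV) (\<lambda>(x, y). p' y x) \<and>
         continuous_on (UNIV \<times> UNIV - {(x, x) | x. True}) (\<lambda>(x, y). p' y x)"
proof -
  interpret biharmonic H
    by standard (use assms(1,4) in \<open>auto simp: green_biharmonic_space_def green_space_def
      bipotential_def superharmonic_pairs_def\<close>)
  have q: "q y \<in> superharmonic (hyperharmonic2 H)" "0 \<le> q y x" for y x
    using assms(7)[of y] by (auto simp: potential_def)
  interpret pure_kernel H q p'
  proof
    fix x y G
    show "q y \<in> hyperharmonic2 H UNIV" using q(1)[of y] by (simp add: superharmonic_def)
    show "0 \<le> q y x" by (rule q(2))
    show "(\<lambda>x. real_of_ereal (q y x)) \<in> harmonic2 H (- {y})"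
      using B2.harmonic_off_support(1)[of "q y"] assms(8) by simp
    show "q y x \<noteq> \<infinity>" if "x \<noteq> y"
      using B2.harmonic_off_support(2)[of x "q y"] assms(8) that by auto
    show "q y = lsc_regularization (\<lambda>x. Lim G (\<lambda>z. q z x))" if "is_ultrafilter G" "G \<le> nhds y"
      using herve_limit[OF assms(5,6) _ that] q by (simp add: pos_superharmonic_def)
  qed (use assms(9-11) in auto)
  show ?thesis using p_lsc p_continuous_off_diagonal by blast
qed

end
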